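(* Let $$I_n(T)=\int\Delta(z_1,\dots,z_n)^2\prod_{i=1}^n z_i^N e^{V(z_i,T)}\,d\mu(z_i),\qquad \Delta(z_1,\dots,z_n)=\prod_{i<j}(z_i-z_j),\qquad V(z,T)=\sum_{m\ge1}\frac1m z^mT_m,$$ let $T=\mathbf p^{(1)}-\mathbf p^{(2)}$ (that is, $T_m=p^{(1)}_m-p^{(2)}_m$), and let $T$ and $\mathbf p=(p_1,p_2,\dots)$ be linearly related by $$V(z,T)-c(T)=V(x,\mathbf p)+V(x^{-1},\mathbf p),\qquad z=x+x^{-1},\qquad c(T)=\sum_{k=1}^\infty\frac{(2k)!}{k!\,k!}\frac{T_{2k}}{2k}.$$ Then $$I_n(T)=\sum_{h}s_{\{h\}}(T)\,\pi_{\{h\}}(N)=\sum_{h,\tilde h}s_{\{h\}}(\mathbf p^{(1)})\,\pi^{00}_{\{h,\tilde h\}}(N)\,s_{\{\tilde h\}}(\mathbf p^{(2)})$$ $$=\sum_{h,\tilde h}e^{c(\mathbf p)}\,o_{\{h\}}(\mathbf p)\,\pi^{--}_{\{h,\tilde h\}}(N)\,o_{\{\tilde h\}}(\mathbf p)\,e^{c(\mathbf p)} =\sum_{h,\tilde h}e^{c(\mathbf p)}\,sp_{\{h\}}(\mathbf p)\,\pi^{++}_{\{h,\tilde h\}}(N)\,sp_{\{\tilde h\}}(\mathbf p)\,e^{c(\mathbf p)}$$ $$=\sum_{h,\tilde h}e^{c(\mathbf p)}\,o_{\{h\}}(\mathbf p)\,\pi^{-+}_{\{h,\tilde h\}}(N)\,sp_{\{\tilde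 h\}}(\mathbf p)\,e^{c(\mathbf p)} .$$ Here $h=(h_1>\cdots>h_n\ge0)$ and $\tilde h=(\tilde h_1>\cdots>\tilde h_n\ge0)$ run over strictly decreasing sequences of nonnegative integers, $$\pi_{\{h\}}(N)=n!\det\bigl[\pi^{00}_{n-i,h_j}(N)\bigr]_{i,j=1,\dots,n},\qquad \pi^{ab}_{\{h,\tilde h\}}(N)=n!\det\bigl[\pi^{ab}_{h_i,\tilde h_j}(N)\bigr]_{i,j=1,\dots,n},\quad a,b=\pm,0,$$ and the moment matrices are $$\pi^{00}_{i,j}(N)=\int z^{i+j+N}d\mu(z),\qquad \pi^{++}_{i,j}(N)=\int x^{i-j}(x+x^{-1})^N d\mu(z(x)),$$ $$\pi^{--}_{i,j}(N)=\int x^{i-j}(x+x^{-1})^N\frac{d\mu(z(x))}{(1-x^2)^2},\qquad \pi^{-+}_{i,j}(N)=\int x^{i-j}(x+x^{-1})^N\frac{d\mu(z(x))}{1-x^2}.$$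
   Context: $d\mu$ is the integration measure of the ensemble, $T=(T_1,T_2,\dots)$, and $z(x)=x+x^{-1}$. $V(x,\mathbf p)=\sum_{m\ge1}\frac1m x^mp_m$. The symbol $c(\mathbf p)$ denotes the quantity $c(T)$ with $T$ expressed through $\mathbf p$ by the stated linear relation. For $h=(h_1>\cdots>h_n\ge0)$, $s_{\{h\}},o_{\{h\}},sp_{\{h\}}$ mean $s_\lambda,o_\lambda,sp_\lambda$ for the partition $\lambda$ with $\lambda_i=h_i+i-n$. Schur functions: $e^{\sum_{m>0}\frac1m p_mz^m}=\sum_{i\ge0}s_{(i)}(\mathbf p)z^i$, $s_{(i)}=0$ for $i<0$, $s_\lambda(\mathbf p)=\det[s_{(\lambda_i-i+j)}(\mathbf p)]_{i,j}$. Orthogonal and symplectic characters as polynomials in $\mathbf p$: with $\partial_m=\partial/\partial p_m$, $o_\lambda(\mathbf p)=e^{\Omega_-}\cdot s_\lambda(\mathbf p)$ and $sp_\lambda(\mathbf p)=e^{\Omega_+}\cdot s_\lambda(\mathbf p)$, where $\Omega_\mp=\sum_{m>0}(-\frac m2\partial_m^2\mp\partial_{2m})$ (upper sign for $\Omega_-$, lower for $\Omega_+$).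
   Formalization: Corrected: the second Schur function has argument −p^(2); each prefactor e^{c(p)} becomes e^{(n/2)c(p)}; the weight in π^{--} is 1/((1−x²)(1−x^{-2})), not 1/(1−x²)². Absolute convergence of the weighted moments and a.e. nonvanishing of denominators are assumed explicitly. *)

theory Defs
  imports
    "HOL-Analysis.Analysis"
    "HOL-Computational_Algebra.Formal_Power_Series"
    "Jordan_Normal_Form.Determinant"
begin

text \<open>
  A family of parameters \<open>p = (p\<^sub>1, p\<^sub>2, \<dots>)\<close> is a function \<open>nat \<Rightarrow> complex\<close> whose value
  at \<open>0\<close> is ignored by every definition below.
\<close>

definition pot :: "complex \<Rightarrow> (nat \<Rightarrow> complex) \<Rightarrow> complex" where
  "pot x p = (\<Sum>m. x ^ Suc m * p (Suc m) / of_nat (Suc m))"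

definition pot_abs_conv :: "real \<Rightarrow> (nat \<Rightarrow> complex) \<Rightarrow> bool" where
  "pot_abs_conv r p \<longleftrightarrow> summable (\<lambda>m. r ^ Suc m * cmod (p (Suc m)) / real (Suc m))"

definition abs_pot :: "real \<Rightarrow> (nat \<Rightarrow> complex) \<Rightarrow> real" where
  "abs_pot r p = (\<Sum>m. r ^ Suc m * cmod (p (Suc m)) / real (Suc m))"

definition zmap :: "complex \<Rightarrow> complex" where
  "zmap x = x + 1 / x"

text \<open>
  The constant term in \<open>x\<close> of \<open>pot (zmap x) T\<close>.  An \<open>n\<close>-fold integral collects one factor
  \<open>exp (c_const T)\<close> per variable, that is \<open>exp (n / 2 * c_const T)\<close> on each side of a bilinear sum.
\<close>
definition c_const :: "(nat \<Rightarrow> complex) \<Rightarrow> complex" where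
  "c_const T = (\<Sum>i. let k = Suc i in
      of_nat (fact (2 * k)) / of_nat (fact k * fact k) * (T (2 * k) / of_nat (2 * k)))"

text \<open>
  The relation is an identity of functions of \<open>x\<close>, required wherever the three series converge
  absolutely.  Convergence at \<open>r = 2\<close> and \<open>r = 1\<close> puts the whole unit circle into that domain, so
  that \<open>p\<close> is determined by \<open>T\<close> (as Fourier coefficients); it also makes \<open>c_const T\<close> converge
  absolutely.
\<close>
definition linearly_related :: "(nat \<Rightarrow> complex) \<Rightarrow> (nat \<Rightarrow> complex) \<Rightarrow> bool" where
  "linearly_related T p \<longleftrightarrow>
     pot_abs_conv 2 T \<and> pot_abs_conv 1 p \<and>
     (\<forall>x. x \<noteq> 0 \<longrightarrow> pot_abs_conv (cmod (zmap x)) T \<longrightarrow>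
          pot_abs_conv (cmod x) p \<longrightarrow> pot_abs_conv (cmod (1 / x)) p \<longrightarrow>
          pot (zmap x) T - c_const T = pot x p + pot (1 / x) p)"

definition schur_row :: "int \<Rightarrow> (nat \<Rightarrow> complex) \<Rightarrow> complex" where
  "schur_row i p = (if i < 0 then 0 else
     fps_nth (fps_compose (fps_exp 1) (Abs_fps (\<lambda>m. if m = 0 then 0 else p m / of_nat m))) (nat i))"

definition schur :: "nat list \<Rightarrow> (nat \<Rightarrow> complex) \<Rightarrow> complex" where
  "schur la p = Determinant.det (Matrix.mat (length la) (length la)
     (\<lambda>(i, j). schur_row (int (la ! i) - int i + int j) p))"

definition pd :: "nat \<Rightarrow> ((nat \<Rightarrow> complex) \<Rightarrow> complex) \<Rightarrow> (nat \<Rightarrow> complex) \<Rightarrow> complex" where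
  "pd m F = (\<lambda>p. deriv (\<lambda>t. F (p(m := t))) (p m))"

text \<open>
  On polynomials in \<open>p\<^sub>1, p\<^sub>2, \<dots>\<close>, the only functions they are applied to, both operator series
  below have only finitely many nonzero terms.
\<close>
definition Omega_op ::
    "complex \<Rightarrow> ((nat \<Rightarrow> complex) \<Rightarrow> complex) \<Rightarrow> (nat \<Rightarrow> complex) \<Rightarrow> complex" where
  "Omega_op \<sigma> F = (\<lambda>p. \<Sum>i. let m = Suc i in
      - (of_nat m / 2) * pd m (pd m F) p + \<sigma> * pd (2 * m) F p)"

definition exp_op ::
    "(((nat \<Rightarrow> complex) \<Rightarrow> complex) \<Rightarrow> (nat \<Rightarrow> complex) \<Rightarrow> complex) \<Rightarrow>
     ((nat \<Rightarrow> complex) \<Rightarrow> complex) \<Rightarrow> (nat \<Rightarrow> complex) \<Rightarrow> complex" where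
  "exp_op A F = (\<lambda>p. \<Sum>k. (A ^^ k) F p / fact k)"

definition o_char :: "nat list \<Rightarrow> (nat \<Rightarrow> complex) \<Rightarrow> complex" where
  "o_char la = exp_op (Omega_op (- 1)) (schur la)"

definition sp_char :: "nat list \<Rightarrow> (nat \<Rightarrow> complex) \<Rightarrow> complex" where
  "sp_char la = exp_op (Omega_op 1) (schur la)"

definition strict_seqs :: "nat \<Rightarrow> nat list set" where
  "strict_seqs n = {h. length h = n \<and> sorted_wrt (>) h}"

text \<open>\<open>\<lambda>\<^sub>i = h\<^sub>i + i - n\<close> for \<open>i = 1, \<dots>, n\<close>; list positions start at \<open>0\<close>, and the truncated
  subtraction is harmless because \<open>h ! i + i + 1 \<ge> n\<close> on \<^const>\<open>strict_seqs\<close>.\<close>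
definition shape :: "nat list \<Rightarrow> nat list" where
  "shape h = map (\<lambda>i. h ! i + (i + 1) - length h) [0..<length h]"

text \<open>
  The integration measure \<open>d\<mu>\<close> may be complex: \<open>d\<mu>(z) = \<rho>(z) dM(z)\<close> with a Borel measure \<open>M\<close>
  and a Borel density \<open>\<rho>\<close> on the complex plane.  Integration of functions of \<open>x\<close> against
  \<open>d\<mu>(z(x))\<close> uses a measure \<open>L\<close> on the \<open>x\<close>-plane with image \<open>M\<close> under \<^const>\<open>zmap\<close>
  (for instance the image of \<open>M\<close> under a Borel section of \<^const>\<open>zmap\<close>).
\<close>

definition ensemble_integral ::
    "complex measure \<Rightarrow> (complex \<Rightarrow> complex) \<Rightarrow> int \<Rightarrow> nat \<Rightarrow> (nat \<Rightarrow> complex) \<Rightarrow> complex" where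
  "ensemble_integral M \<rho> N n T =
     (LINT z|PiM {..<n} (\<lambda>_. M).
        (\<Prod>j<n. \<Prod>i<j. z i - z j)\<^sup>2 * (\<Prod>i<n. z i powi N * exp (pot (z i) T) * \<rho> (z i)))"

definition mom00 :: "complex measure \<Rightarrow> (complex \<Rightarrow> complex) \<Rightarrow> int \<Rightarrow> nat \<Rightarrow> nat \<Rightarrow> complex" where
  "mom00 M \<rho> N i j = (LINT z|M. z powi (int i + int j + N) * \<rho> z)"

definition mom_x :: "(complex \<Rightarrow> complex) \<Rightarrow>
    complex measure \<Rightarrow> (complex \<Rightarrow> complex) \<Rightarrow> int \<Rightarrow> nat \<Rightarrow> nat \<Rightarrow> complex" where
  "mom_x \<kappa> L \<rho> N i j =
     (LINT x|L. x powi (int i - int j) * (x + 1 / x) powi N * \<kappa> x * \<rho> (zmap x))"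

definition kappa_pp :: "complex \<Rightarrow> complex" where
  "kappa_pp x = 1"

text \<open>
  On the unit circle the denominator of \<open>kappa_mm\<close> is \<open>\<bar>1 - x\<^sup>2\<bar>\<^sup>2\<close>.  It is the product of the two
  factors \<open>1 / (1 - x\<^sup>2)\<close> and \<open>1 / (1 - x\<^sup>-\<^sup>2)\<close> that the Cauchy identity for orthogonal characters
  produces for the arguments \<open>x\<close> and \<open>1 / x\<close>.
\<close>
definition kappa_mm :: "complex \<Rightarrow> complex" where
  "kappa_mm x = 1 / ((1 - x\<^sup>2) * (1 - 1 / x\<^sup>2))"

definition kappa_mp :: "complex \<Rightarrow> complex" where
  "kappa_mp x = 1 / (1 - x\<^sup>2)"

definition pi1 :: "(nat \<Rightarrow> nat \<Rightarrow> complex) \<Rightarrow> nat \<Rightarrow> nat list \<Rightarrow> complex" where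
  "pi1 m n h = fact n * Determinant.det (Matrix.mat n n (\<lambda>(i, j). m (n - (i + 1)) (h ! j)))"

definition pi2 :: "(nat \<Rightarrow> nat \<Rightarrow> complex) \<Rightarrow> nat \<Rightarrow> nat list \<Rightarrow> nat list \<Rightarrow> complex" where
  "pi2 m n h h' = fact n * Determinant.det (Matrix.mat n n (\<lambda>(i, j). m (h ! i) (h' ! j)))"

text \<open>
  Absolute convergence, under the integral sign, of the moments weighted by the exponentials of the
  potentials; this is what gives the integrals and the sums over \<open>h\<close> a meaning as numbers.
\<close>

definition converges_z :: "complex measure \<Rightarrow> (complex \<Rightarrow> complex) \<Rightarrow> int \<Rightarrow>
    (nat \<Rightarrow> complex) \<Rightarrow> (nat \<Rightarrow> complex) \<Rightarrow> bool" where
  "converges_z M \<rho> N p q \<longleftrightarrow>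
     (AE z in M. pot_abs_conv (cmod z) p \<and> pot_abs_conv (cmod z) q) \<and>
     (\<forall>k. integrable M (\<lambda>z. cmod z ^ k * cmod (z powi N) * cmod (\<rho> z)
            * exp (abs_pot (cmod z) p + abs_pot (cmod z) q)))"

definition converges_x :: "(complex \<Rightarrow> complex) \<Rightarrow> complex measure \<Rightarrow> (complex \<Rightarrow> complex) \<Rightarrow> int \<Rightarrow>
    (nat \<Rightarrow> complex) \<Rightarrow> (nat \<Rightarrow> complex) \<Rightarrow> bool" where
  "converges_x \<kappa> L \<rho> N T p \<longleftrightarrow>
     (AE x in L. pot_abs_conv (cmod (zmap x)) T \<and>
        pot_abs_conv (cmod x) p \<and> pot_abs_conv (cmod (1 / x)) p) \<and>
     (\<forall>k. integrable L (\<lambda>x. (cmod x + cmod (1 / x)) ^ k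
            * cmod (zmap x powi N) * cmod (\<kappa> x) * cmod (\<rho> (zmap x))
            * exp (abs_pot (cmod x) p + abs_pot (cmod (1 / x)) p)))"

end

theory Submission
  imports Defs
begin

text \<open>
  With \<open>\<Delta>(z) = det [z\<^sub>i\<^bsup>n-j\<^esup>]\<close>, Andreief's identity turns the ensemble integral into
  \<open>n!\<close> times the determinant of the one-dimensional integrals
  \<open>\<integral> z\<^bsup>i+j\<^esup> z\<^sup>N e\<^bsup>V(z,T)\<^esup> d\<mu>\<close>.  Expanding the exponentials
  under these integrals makes that matrix a product \<open>A\<^sup>T m B\<close> of infinite matrices, with \<open>m\<close> the moment
  matrix and \<open>A\<close>, \<open>B\<close> the Taylor coefficients of \<open>z\<^bsup>n-j\<^esup> e\<^bsup>V(z,p)\<^esup>\<close>;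
  the Cauchy--Binet formula for absolutely convergent products gives the sums over strictly
  decreasing sequences, and the minors of \<open>A\<close> and \<open>B\<close> are Schur functions.

  In the variable \<open>x\<close> one factors \<open>z\<^bsup>i+j\<^esup>\<close> instead as
  \<open>(x\<^bsup>n-1\<^esup> z\<^sup>i) (x\<^bsup>1-n\<^esup> z\<^sup>j)\<close>.  Here
  \<open>x\<^bsup>n-1\<^esup> z\<^sup>j = x\<^bsup>n-1-j\<^esup> (1 + x\<^sup>2)\<^sup>j\<close>, and the minors of the coefficients of
  \<open>x\<^bsup>n-1-j\<^esup> (1 + x\<^sup>2)\<^sup>j e\<^bsup>V(x,p)\<^esup>\<close> are the symplectic characters (the
  orthogonal ones after a further factor \<open>1 - x\<^sup>2\<close>): on the generating function
  \<open>e\<^bsup>V(x\<^sub>1,p) + \<dots> + V(x\<^sub>n,p)\<^esup>\<close> the operator \<open>e\<^bsup>\<Omega>\<^esup>\<close> is multiplication by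
  \<open>\<Prod>i<j. 1 - x\<^sub>i x\<^sub>j\<close> (times \<open>\<Prod>i. 1 - x\<^sub>i\<^sup>2\<close>).
\<close>

section \<open>Determinants and the Vandermonde formula\<close>

text \<open>The operators act by genuine derivatives on functions of \<open>p\<close>, and their
  series are finite only on polynomials, whereas the generating function is not a polynomial. So one
  formal variable t records the degree, with \<open>p m\<close> of degree \<open>m\<close>, while
  the \<open>x_i\<close> stay arbitrary numbers; each coefficient of t^d is then a polynomial in
  \<open>p\<close> on which the operator is nilpotent. Single minors are recovered because a
  polynomial vanishing at all numerical \<open>x\<close> has zero coefficients. Its monomials run
  over all exponent vectors, so the determinants must make sense for arbitrary lists
  \<open>h\<close>.

  The other obstacle is the interchange of integrals with the exponential series and the double
  sums. Every power series is therefore carried along with a majorant of its absolute sum, and the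
  convergence hypotheses make the products of majorants integrable.

  The factor x^(n-1) clears the negative powers of x from z^j, so that one side is a power series in
  x and the other a power series in 1/x. In the two-sided Schur sum
  \<open>V(z,T) = V(z,p1) + V(z,-p2)\<close>, which is why the second Schur function is taken at
  \<open>- p2\<close>.\<close>

abbreviation detf :: "nat \<Rightarrow> (nat \<Rightarrow> nat \<Rightarrow> 'a) \<Rightarrow> 'a :: comm_ring_1" where
  "detf n f \<equiv> Determinant.det (Matrix.mat n n (\<lambda>(i, j). f i j))"

lemma detf_leibniz:
  "detf n f = (\<Sum>p | p permutes {..<n}. signof p * (\<Prod>i<n. f i (p i)))"
proof -
  have "detf n f = (\<Sum>p | p permutes {0..<n}. signof p *
      (\<Prod>i = 0..<n. Matrix.mat n n (\<lambda>(i, j). f i j) $$ (i, p i)))"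
    by (rule det_def') simp
  also have "\<dots> = (\<Sum>p | p permutes {0..<n}. signof p * (\<Prod>i = 0..<n. f i (p i)))"
  proof (intro sum.cong refl arg_cong2[where f = "(*)"] prod.cong)
    fix p i assume "p \<in> {p. p permutes {0..<n}}" "i \<in> {0..<n}"
    hence "i < n" "p i < n" using permutes_in_image[of p "{0..<n}" i] by auto
    thus "Matrix.mat n n (\<lambda>(i, j). f i j) $$ (i, p i) = f i (p i)" by simp
  qed
  finally show ?thesis by (simp add: lessThan_atLeast0)
qed

lemma detf_cong:
  assumes "\<And>i j. i < n \<Longrightarrow> j < n \<Longrightarrow> f i j = g i j"
  shows "detf n f = detf n g"
  by (rule arg_cong[where f = Determinant.det]) (auto intro!: eq_matI simp: assms)

lemma detf_scale_rows:
  "detf n (\<lambda>i j. c i * f i j) = (\<Prod>i<n. c i) * detf n f"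
  by (simp add: detf_leibniz prod.distrib sum_distrib_left mult_ac)

lemma detf_permute_rows:
  assumes "p permutes {..<n}"
  shows "detf n (\<lambda>i. f (p i)) = signof p * detf n f"
proof -
  have *: "p permutes {0..<n}" using assms by (simp add: lessThan_atLeast0)
  have "detf n (\<lambda>i. f (p i)) =
      Determinant.det (Matrix.mat n n (\<lambda>(i, j). Matrix.mat n n (\<lambda>(i, j). f i j) $$ (p i, j)))"
    by (intro arg_cong[where f = Determinant.det] eq_matI)
       (use permutes_in_image[OF assms] in simp_all)
  also have "\<dots> = signof p * detf n f"
    by (rule det_permute_rows[OF _ *]) simp
  finally show ?thesis .
qed

lemma detf_transpose: "detf n (\<lambda>i j. f j i) = detf n f"
proof -
  have "detf n (\<lambda>i j. f j i) =
      Determinant.det (transpose_mat (Matrix.mat n n (\<lambda>(i, j). f i j)))"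
    by (intro arg_cong[where f = Determinant.det]) (auto intro!: eq_matI)
  also have "\<dots> = detf n f" by (rule det_transpose[of _ n]) simp
  finally show ?thesis .
qed

lemma detf_permute_cols:
  assumes "p permutes {..<n}"
  shows "detf n (\<lambda>i j. f i (p j)) = signof p * detf n f"
  by (rule trans[OF detf_transpose[of n "\<lambda>i j. f j (p i)"]],
      rule trans[OF detf_permute_rows[OF assms, of "\<lambda>i j. f j i"]])
     (rule arg_cong[OF detf_transpose])

lemma signof_square: "signof p * signof p = (1 :: 'a :: comm_ring_1)"
  by (auto simp: sign_def)

text \<open>Rows and columns are reversed by the same permutation, so its sign enters twice and
  cancels. This translates between the decreasing exponents \<open>n - Suc j\<close> of the
  Vandermonde matrix and the natural indexing of a Hankel matrix.\<close>

lemma detf_reverse: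
  "detf n (\<lambda>i j. f (n - Suc i) (n - Suc j)) = detf n f"
proof -
  define p where "p i = (if i < n then n - Suc i else i)" for i
  have p: "p permutes {..<n}"
  proof (rule bij_imp_permutes)
    show "bij_betw p {..<n} {..<n}"
      by (rule bij_betw_byWitness[of _ p]) (auto simp: p_def)
    show "p i = i" if "i \<notin> {..<n}" for i using that by (simp add: p_def)
  qed
  have "detf n (\<lambda>i j. f (n - Suc i) (n - Suc j)) = detf n (\<lambda>i j. f (p i) (p j))"
    by (rule detf_cong) (simp add: p_def)
  also have "\<dots> = signof p * detf n (\<lambda>i j. f i (p j))"
    by (rule detf_permute_rows[OF p])
  also have "detf n (\<lambda>i j. f i (p j)) = signof p * detf n f"
    by (rule detf_permute_cols[OF p])
  also have "signof p * (signof p * detf n f) = (signof p * signof p) * detf n f"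
    by (rule mult.assoc[symmetric])
  also have "\<dots> = detf n f" by (simp only: signof_square mult_1_left)
  finally show ?thesis .
qed

lemma detf_eq_0_if_rows_eq:
  assumes "i \<noteq> j" "i < n" "j < n" "f i = f j"
  shows "detf n f = 0"
  by (rule det_identical_rows[of _ n i j]) (use assms in \<open>auto intro!: eq_vecI\<close>)

text \<open>Multiplying by the unitriangular matrix of coefficients of the Newton polynomials
  \<open>\<Prod>k\<in>{j<..<n}. X - x\<^sub>k\<close> turns the Vandermonde matrix into a triangular one.\<close>
lemma vandermonde:
  fixes x :: "nat \<Rightarrow> 'a :: comm_ring_1"
  shows "detf n (\<lambda>i j. x i ^ (n - Suc j)) = (\<Prod>j<n. \<Prod>i<j. x i - x j)"
proof -
  define Q where "Q j = (\<Prod>k\<in>{j<..<n}. [:- x k, 1:])" for j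
  have Q: "degree (Q j) \<le> n - Suc j \<and> coeff (Q j) (n - Suc j) = 1" if "j < n" for j
  proof -
    have gen: "degree (\<Prod>k\<in>K. [:- x k, 1:]) \<le> card K \<and> coeff (\<Prod>k\<in>K. [:- x k, 1:]) (card K) = 1"
      if "finite K" for K :: "nat set"
      using that
    proof (induction K rule: finite_induct)
      case (insert a K)
      let ?P = "\<Prod>k\<in>K. [:- x k, 1:]"
      have "degree ([:- x a, 1:] * ?P) \<le> Suc (card K)"
        by (rule order.trans[OF degree_mult_le]) (use insert.IH in simp)
      moreover have "coeff ?P (Suc (card K)) = 0"
        by (rule coeff_eq_0) (use insert.IH in simp)
      ultimately show ?case using insert by simp
    qed simp
    show ?thesis unfolding Q_def using gen[of "{j<..<n}"] by simp
  qed
  let ?V = "Matrix.mat n n (\<lambda>(i, j). x i ^ (n - Suc j))"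
  let ?U = "Matrix.mat n n (\<lambda>(i, j). coeff (Q j) (n - Suc i))"
  let ?M = "Matrix.mat n n (\<lambda>(i, j). \<Prod>k\<in>{j<..<n}. x i - x k)"
  have "?V * ?U = ?M"
  proof (rule eq_matI)
    fix i j assume "i < dim_row ?M" "j < dim_col ?M"
    hence ij: "i < n" "j < n" by auto
    have "(?V * ?U) $$ (i, j) = (\<Sum>l = 0..<n. x i ^ (n - Suc l) * coeff (Q j) (n - Suc l))"
      using ij by (simp add: times_mat_def scalar_prod_def)
    also have "\<dots> = (\<Sum>l<n. coeff (Q j) l * x i ^ l)"
      unfolding lessThan_atLeast0[symmetric]
      by (subst sum.nat_diff_reindex[symmetric]) (simp add: mult.commute)
    also have "\<dots> = poly (Q j) (x i)"
    proof -
      have "poly (Q j) (x i) = (\<Sum>l\<le>degree (Q j). coeff (Q j) l * x i ^ l)"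
        by (rule poly_altdef)
      also have "\<dots> = (\<Sum>l<n. coeff (Q j) l * x i ^ l)"
        using Q[OF ij(2)] ij by (intro sum.mono_neutral_left) (auto simp: coeff_eq_0)
      finally show ?thesis by simp
    qed
    also have "\<dots> = (\<Prod>k\<in>{j<..<n}. x i - x k)"
      by (simp add: Q_def poly_prod)
    finally show "(?V * ?U) $$ (i, j) = ?M $$ (i, j)" using ij by simp
  qed auto
  hence "Determinant.det ?M = Determinant.det ?V * Determinant.det ?U"
    using det_mult[of ?V n ?U] by simp
  also have "Determinant.det ?U = 1"
  proof (subst det_lower_triangular[of n])
    show "?U $$ (i, j) = 0" if "i < j" "j < n" for i j
      using that Q[of j] by (auto intro!: coeff_eq_0)
    show "prod_list (diag_mat ?U) = 1"
      unfolding prod_list_diag_prod by (rule prod.neutral) (use Q in simp)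
  qed auto
  also have "Determinant.det ?M = (\<Prod>i<n. \<Prod>k\<in>{i<..<n}. x i - x k)"
  proof (subst det_upper_triangular[of _ n])
    \<comment> \<open>An entry below the diagonal, \<open>j < i\<close>, contains the vanishing
      factor for \<open>k = i\<close>.\<close>
    show "upper_triangular ?M"
      by (rule upper_triangularI) (auto intro!: prod_zero)
  qed (auto simp: prod_list_diag_prod lessThan_atLeast0)
  also have "\<dots> = (\<Prod>j<n. \<Prod>i<j. x i - x j)"
    unfolding prod.Sigma[OF finite_lessThan ballI, OF finite_greaterThanLessThan]
      prod.Sigma[OF finite_lessThan ballI, OF finite_lessThan]
    by (rule prod.reindex_bij_witness[of _ "\<lambda>(a, b). (b, a)" "\<lambda>(a, b). (b, a)"]) auto
  finally show ?thesis by simp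
qed

text \<open>Each index belongs to exactly \<open>n - 1\<close> of the pairs
  \<open>i < j\<close>.\<close>

lemma prod_pairs: "(\<Prod>j<n. \<Prod>i<j. b i * b j) = (\<Prod>i<n. b i ^ (n - 1) :: 'a :: comm_ring_1)"
proof (induction n)
  case (Suc n)
  have "(\<Prod>i<n. b i ^ n) = (\<Prod>i<n. b i ^ (n - 1) * b i)"
    by (rule prod.cong) (auto simp: power_Suc2[symmetric] simp del: power_Suc)
  with Suc show ?case by (simp add: prod.distrib mult_ac)
qed simp

text \<open>Taking \<open>b i ^ (n - 1)\<close> out of row \<open>i\<close> leaves the Vandermonde
  matrix of the quotients \<open>a i * c i\<close>, and \<open>prod_pairs\<close> distributes these
  powers over the pairs. Inverses enter as explicit elements \<open>c i\<close> so that the ring may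
  be one of power series, where \<open>b i = 1 + (y i)^2\<close> is a unit.\<close>

lemma homogeneous_vandermonde:
  fixes a b c :: "nat \<Rightarrow> 'a :: comm_ring_1"
  assumes bc: "\<And>i. i < n \<Longrightarrow> b i * c i = 1"
  shows "detf n (\<lambda>i j. a i ^ (n - Suc j) * b i ^ j) = (\<Prod>j<n. \<Prod>i<j. a i * b j - a j * b i)"
proof -
  have "detf n (\<lambda>i j. a i ^ (n - Suc j) * b i ^ j) =
      detf n (\<lambda>i j. b i ^ (n - 1) * (a i * c i) ^ (n - Suc j))"
  proof (rule detf_cong)
    fix i j assume ij: "i < n" "j < n"
    have "b i ^ (n - 1) * (a i * c i) ^ (n - Suc j) =
        b i ^ j * b i ^ (n - Suc j) * (a i * c i) ^ (n - Suc j)"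
      using ij by (simp add: power_add[symmetric])
    also have "\<dots> = a i ^ (n - Suc j) * b i ^ j * (b i * c i) ^ (n - Suc j)"
      by (simp add: power_mult_distrib mult_ac)
    finally show "a i ^ (n - Suc j) * b i ^ j = b i ^ (n - 1) * (a i * c i) ^ (n - Suc j)"
      using bc ij by simp
  qed
  also have "\<dots> = (\<Prod>j<n. \<Prod>i<j. b i * b j) * (\<Prod>j<n. \<Prod>i<j. a i * c i - a j * c j)"
    by (simp only: detf_scale_rows vandermonde prod_pairs)
  also have "\<dots> = (\<Prod>j<n. \<Prod>i<j. a i * b j - a j * b i)"
    unfolding prod.distrib[symmetric]
  proof (intro prod.cong refl)
    fix i j assume "j \<in> {..<n}" "i \<in> {..<j}"
    hence "b i * c i = 1" "b j * c j = 1" using bc by auto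
    moreover have "b i * b j * (a i * c i - a j * c j) =
        a i * b j * (b i * c i) - a j * b i * (b j * c j)"
      by (simp add: algebra_simps)
    ultimately show "b i * b j * (a i * c i - a j * c j) = a i * b j - a j * b i" by simp
  qed
  finally show ?thesis .
qed

section \<open>The Cauchy--Binet formula for infinite matrices\<close>

lemma strict_seqs_nth_inj:
  assumes "h \<in> strict_seqs n"
  shows "inj_on (\<lambda>k. h ! k) {..<n}"
proof (rule inj_onI)
  fix i j assume ij: "i \<in> {..<n}" "j \<in> {..<n}" "h ! i = h ! j"
  with assms show "i = j"
    by (cases i j rule: linorder_cases) (fastforce simp: strict_seqs_def sorted_wrt_iff_nth_less)+
qed

lemma strict_seqs_eqI:
  assumes "h \<in> strict_seqs n" "h' \<in> strict_seqs n" "set h = set h'"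
  shows "h = h'"
proof -
  have "sorted (rev h)" "distinct (rev h)" if "h \<in> strict_seqs n" for h
  proof -
    have "sorted_wrt (<) (rev h)" using that by (simp add: strict_seqs_def sorted_wrt_rev)
    thus "sorted (rev h)" "distinct (rev h)" by (simp_all add: strict_sorted_iff)
  qed
  with assms have "rev h = rev h'" by (intro sorted_distinct_set_unique) auto
  thus ?thesis by simp
qed

text \<open>An injective family is its decreasingly sorted range together with the order in which
  the range is traversed. This turns sums over choices of indices into sums over minors; the
  restriction to \<open>{..<n}\<close> makes the functions extensional, as \<open>PiE\<close>
  demands.\<close>

lemma bij_betw_strict_seqs_permutations:
  "bij_betw (\<lambda>(h, p). \<lambda>i\<in>{..<n}. h ! p i) (strict_seqs n \<times> {p. p permutes {..<n}})
     {f \<in> PiE {..<n} (\<lambda>_. UNIV). inj_on f {..<n}}"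
  (is "bij_betw ?F (_ \<times> ?P) ?I")
proof (rule bij_betw_imageI)
  have image: "(\<lambda>i. h ! p i) ` {..<n} = set h"
    if "h \<in> strict_seqs n" "p permutes {..<n}" for h p
  proof -
    have "(\<lambda>i. h ! p i) ` {..<n} = (\<lambda>k. h ! k) ` {..<n}"
      using permutes_image[OF that(2)] by (metis image_image)
    thus ?thesis using that by (auto simp: strict_seqs_def set_conv_nth)
  qed
  show "inj_on ?F (strict_seqs n \<times> ?P)"
  proof (rule inj_onI, clarify)
    fix h p h' p'
    assume h: "h \<in> strict_seqs n" "h' \<in> strict_seqs n" and p: "p permutes {..<n}" "p' permutes {..<n}"
      and "(\<lambda>i\<in>{..<n}. h ! p i) = (\<lambda>i\<in>{..<n}. h' ! p' i)"
    hence eq: "h ! p i = h' ! p' i" if "i < n" for i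
      using that by (metis lessThan_iff restrict_apply')
    have hh: "h = h'"
      using eq image[OF h(1) p(1)] image[OF h(2) p(2)] h by (intro strict_seqs_eqI[OF h]) force
    moreover have "p = p'"
    proof
      fix i show "p i = p' i"
      proof (cases "i < n")
        case True
        thus ?thesis
          using eq[OF True] hh inj_onD[OF strict_seqs_nth_inj[OF h(2)], of "p i" "p' i"]
            permutes_in_image[OF p(1)] permutes_in_image[OF p(2)] by simp
      next
        case False
        thus ?thesis using p by (simp add: permutes_not_in)
      qed
    qed
    ultimately show "h = h' \<and> p = p'" by simp
  qed
  show "?F ` (strict_seqs n \<times> ?P) = ?I"
  proof (intro equalityI subsetI)
    fix f assume "f \<in> ?F ` (strict_seqs n \<times> ?P)"
    then obtain h p where hp: "h \<in> strict_seqs n" "p permutes {..<n}"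
      and f: "f = (\<lambda>i\<in>{..<n}. h ! p i)" by auto
    have "inj_on (\<lambda>i. h ! p i) {..<n}"
      using comp_inj_on[of p "{..<n}" "\<lambda>k. h ! k"] permutes_inj_on[OF hp(2)]
        strict_seqs_nth_inj[OF hp(1)] permutes_image[OF hp(2)] by (simp add: o_def)
    thus "f \<in> ?I" by (auto simp: f inj_on_def)
  next
    fix f assume f: "f \<in> ?I"
    define h where "h = rev (sorted_list_of_set (f ` {..<n}))"
    have card: "card (f ` {..<n}) = n" using f by (simp add: card_image)
    have h: "h \<in> strict_seqs n"
      using card by (simp add: h_def strict_seqs_def sorted_wrt_rev)
    have seth: "set h = f ` {..<n}" by (simp add: h_def)
    have bij: "bij_betw (\<lambda>k. h ! k) {..<n} (f ` {..<n})"
      using strict_seqs_nth_inj[OF h] h seth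
      by (auto simp: bij_betw_def strict_seqs_def set_conv_nth)
    define p where "p i = (if i < n then inv_into {..<n} (\<lambda>k. h ! k) (f i) else i)" for i
    have "bij_betw (inv_into {..<n} (\<lambda>k. h ! k) \<circ> f) {..<n} {..<n}"
      by (rule bij_betw_trans[OF _ bij_betw_inv_into[OF bij]]) (use f in \<open>simp add: bij_betw_def\<close>)
    hence "bij_betw p {..<n} {..<n}"
      by (rule bij_betw_cong[THEN iffD1, rotated]) (simp add: p_def)
    hence p: "p permutes {..<n}" by (rule bij_imp_permutes) (simp add: p_def)
    have "f = ?F (h, p)"
    proof
      fix i show "f i = ?F (h, p) i"
        using f bij_betw_inv_into_right[OF bij, of "f i"] by (auto simp: p_def)
    qed
    thus "f \<in> ?F ` (strict_seqs n \<times> ?P)" using h p by blast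
  qed
qed

lemma has_sum_finite_sum:
  fixes f :: "'i \<Rightarrow> 'b \<Rightarrow> 'c :: topological_comm_monoid_add"
  assumes "finite I" "\<And>i. i \<in> I \<Longrightarrow> (f i has_sum s i) A"
  shows "((\<lambda>x. \<Sum>i\<in>I. f i x) has_sum (\<Sum>i\<in>I. s i)) A"
  using assms by (induction I rule: finite_induct) (auto intro!: has_sum_add)

lemma summable_on_finite_sum:
  fixes f :: "'i \<Rightarrow> 'b \<Rightarrow> 'c :: topological_comm_monoid_add"
  assumes "finite I" "\<And>i. i \<in> I \<Longrightarrow> f i summable_on A"
  shows "(\<lambda>x. \<Sum>i\<in>I. f i x) summable_on A"
  using assms by (induction I rule: finite_induct) (auto intro!: summable_on_add)

lemma has_sum_prod_PiE:
  fixes f :: "'i \<Rightarrow> 'b :: countable \<Rightarrow> complex"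
  assumes "finite I" and "\<And>i. i \<in> I \<Longrightarrow> (\<lambda>b. norm (f i b)) summable_on UNIV"
  shows "(\<lambda>g. norm (\<Prod>i\<in>I. f i (g i))) summable_on PiE I (\<lambda>_. UNIV)"
    and "((\<lambda>g. \<Prod>i\<in>I. f i (g i)) has_sum (\<Prod>i\<in>I. infsum (f i) UNIV)) (PiE I (\<lambda>_. UNIV))"
proof -
  show *: "(\<lambda>g. norm (\<Prod>i\<in>I. f i (g i))) summable_on PiE I (\<lambda>_. UNIV)"
    unfolding abs_summable_equivalent
    by (rule abs_summable_on_prod_PiE) (use assms in \<open>auto simp: abs_summable_equivalent[symmetric]\<close>)
  have "infsum (\<lambda>g. \<Prod>i\<in>I. f i (g i)) (PiE I (\<lambda>_. UNIV)) = (\<Prod>i\<in>I. infsum (f i) UNIV)"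
    by (rule infsum_prod_PiE_abs) (use assms in auto)
  with abs_summable_summable[OF *]
  show "((\<lambda>g. \<Prod>i\<in>I. f i (g i)) has_sum (\<Prod>i\<in>I. infsum (f i) UNIV)) (PiE I (\<lambda>_. UNIV))"
    by (simp add: has_sum_iff)
qed

text \<open>Expanding the Leibniz sum and then each product of \<open>n\<close> series gives a sum
  over all choices \<open>f\<close> of summation indices. A choice that repeats an index produces
  two equal rows of \<open>B\<close>; the injective ones are grouped by their sorted range
  \<open>h\<close>, and the signs of the reorderings assemble the minor of \<open>C\<close>.\<close>

theorem infinite_cauchy_binet:
  fixes C B :: "nat \<Rightarrow> nat \<Rightarrow> complex"
  assumes "\<And>i j. i < n \<Longrightarrow> j < n \<Longrightarrow> (\<lambda>b. norm (C i b * B b j)) summable_on UNIV"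
  shows "((\<lambda>h. detf n (\<lambda>i k. C i (h ! k)) * detf n (\<lambda>k j. B (h ! k) j))
     has_sum detf n (\<lambda>i j. \<Sum>\<^sub>\<infinity>b. C i b * B b j)) (strict_seqs n)"
proof -
  let ?P = "{p. p permutes {..<n}}" and ?I = "PiE {..<n} (\<lambda>_. UNIV :: nat set)"
  let ?t = "\<lambda>f. (\<Prod>i<n. C i (f i)) * detf n (\<lambda>i j. B (f i) j)"
  have finP: "finite ?P" by (simp add: finite_permutations)
  have "((\<lambda>f. \<Sum>p\<in>?P. signof p * (\<Prod>i<n. C i (f i) * B (f i) (p i))) has_sum
      (\<Sum>p\<in>?P. signof p * (\<Prod>i<n. \<Sum>\<^sub>\<infinity>b. C i b * B b (p i)))) ?I"
  proof (intro has_sum_finite_sum has_sum_cmult_right has_sum_prod_PiE)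
    fix p i assume "p \<in> ?P" "i \<in> {..<n}"
    thus "(\<lambda>b. norm (C i b * B b (p i))) summable_on UNIV"
      using assms[of i "p i"] permutes_in_image[of p "{..<n}" i] by simp
  qed (auto simp: finite_permutations)
  hence "(?t has_sum detf n (\<lambda>i j. \<Sum>\<^sub>\<infinity>b. C i b * B b j)) ?I"
    by (simp add: detf_leibniz prod.distrib sum_distrib_left mult_ac)
  hence "(?t has_sum detf n (\<lambda>i j. \<Sum>\<^sub>\<infinity>b. C i b * B b j)) {f \<in> ?I. inj_on f {..<n}}"
  proof (rule has_sum_cong_neutral[THEN iffD1, rotated -1])
    fix f assume "f \<in> ?I - {f \<in> ?I. inj_on f {..<n}}"
    then obtain i j where "i < n" "j < n" "i \<noteq> j" "f i = f j" by (auto simp: inj_on_def)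
    thus "?t f = 0" using detf_eq_0_if_rows_eq[of i j n "\<lambda>i j. B (f i) j"] by simp
  qed auto
  hence *: "((\<lambda>(h, p). ?t (\<lambda>i\<in>{..<n}. h ! p i)) has_sum
      detf n (\<lambda>i j. \<Sum>\<^sub>\<infinity>b. C i b * B b j)) (strict_seqs n \<times> ?P)"
    using has_sum_reindex_bij_betw[OF bij_betw_strict_seqs_permutations, of ?t n]
    by (simp only: case_prod_unfold)
  show ?thesis
  proof (rule has_sum_SigmaD[OF *])
    fix h
    have "?t (\<lambda>i\<in>{..<n}. h ! p i) =
        (signof p * (\<Prod>i<n. C i (h ! p i))) * detf n (\<lambda>k j. B (h ! k) j)" if "p \<in> ?P" for p
    proof -
      have "detf n (\<lambda>i. B ((\<lambda>i\<in>{..<n}. h ! p i) i)) = detf n (\<lambda>i. B (h ! p i))"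
        by (rule detf_cong) simp
      also have "\<dots> = signof p * detf n (\<lambda>k j. B (h ! k) j)"
        using that by (intro detf_permute_rows[of p n "\<lambda>k. B (h ! k)"]) simp
      finally show ?thesis by (simp add: mult_ac)
    qed
    hence "(\<Sum>p\<in>?P. ?t (\<lambda>i\<in>{..<n}. h ! p i)) =
        (\<Sum>p\<in>?P. (signof p * (\<Prod>i<n. C i (h ! p i))) * detf n (\<lambda>k j. B (h ! k) j))"
      by (rule sum.cong[OF refl])
    also have "\<dots> = detf n (\<lambda>i k. C i (h ! k)) * detf n (\<lambda>k j. B (h ! k) j)"
      by (simp only: detf_leibniz[of n "\<lambda>i k. C i (h ! k)"] sum_distrib_right)
    finally show "((\<lambda>p. case (h, p) of (h, p) \<Rightarrow> ?t (\<lambda>i\<in>{..<n}. h ! p i)) has_sum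
        detf n (\<lambda>i k. C i (h ! k)) * detf n (\<lambda>k j. B (h ! k) j)) ?P"
      using finP by (simp only: prod.case has_sum_finite_iff)
  qed
qed

lemma norm_detf_le: "norm (detf n f) \<le> (\<Sum>p | p permutes {..<n}. \<Prod>i<n. norm (f i (p i)))"
  for f :: "nat \<Rightarrow> nat \<Rightarrow> complex"
  unfolding detf_leibniz
  by (intro order.trans[OF norm_sum] sum_mono) (auto simp: norm_mult sign_def prod_norm)

text \<open>A sum over pairs needs joint summability, which iterated summation does not give. Each
  determinant is bounded by the permanent of its absolute values, and each resulting term occurs in
  the product of \<open>n\<close> absolutely convergent double series, at an index that determines
  \<open>(h, h')\<close>.\<close>

lemma summable_on_triple_detf:
  fixes A m B :: "nat \<Rightarrow> nat \<Rightarrow> complex"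
  assumes abs: "\<And>i j. i < n \<Longrightarrow> j < n \<Longrightarrow>
      (\<lambda>(b, b'). norm (A i b * m b b' * B b' j)) summable_on UNIV"
  shows "(\<lambda>(h, h'). norm (detf n (\<lambda>i k. A i (h ! k)) * detf n (\<lambda>k l. m (h ! k) (h' ! l)) *
      detf n (\<lambda>l j. B (h' ! l) j))) summable_on strict_seqs n \<times> strict_seqs n"
proof -
  let ?P = "{p. p permutes {..<n}}"
  let ?a = "\<lambda>h p. \<Prod>i<n. norm (A i (h ! p i))"
  let ?b = "\<lambda>h h' q. \<Prod>k<n. norm (m (h ! k) (h' ! q k))"
  let ?c = "\<lambda>h' r. \<Prod>l<n. norm (B (h' ! l) (r l))"
  have "(\<lambda>(h, h'). ?a h p * ?b h h' q * ?c h' r) summable_on strict_seqs n \<times> strict_seqs n"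
    if p: "p \<in> ?P" and q: "q \<in> ?P" and r: "r \<in> ?P" for p q r
  proof -
    \<comment> \<open>Following row \<open>i\<close> of \<open>A\<close> through \<open>p\<close>,
      then \<open>q\<close>, then \<open>r\<close> aligns all three products along the single index
      \<open>i\<close>.\<close>
    let ?s = "q \<circ> p"
    have s: "?s permutes {..<n}" using p q by (simp add: permutes_compose)
    have rs: "r (?s i) < n" if "i < n" for i
      using permutes_in_image[OF s, of i] permutes_in_image[of r "{..<n}" "?s i"] that r by simp
    let ?G = "\<lambda>i (b, b'). norm (A i b * m b b' * B b' (r (?s i)))"
    let ?g = "\<lambda>(h, h'). \<lambda>i\<in>{..<n}. (h ! p i, h' ! ?s i)"
    have "(\<lambda>g. norm (\<Prod>i<n. (\<lambda>(b, b'). A i b * m b b' * B b' (r (?s i))) (g i)))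
        summable_on PiE {..<n} (\<lambda>_. UNIV :: (nat \<times> nat) set)"
      by (rule has_sum_prod_PiE) (use abs rs in \<open>auto simp: case_prod_unfold\<close>)
    hence "(\<lambda>g. norm (\<Prod>i<n. (\<lambda>(b, b'). A i b * m b b' * B b' (r (?s i))) (g i)))
        summable_on ?g ` (strict_seqs n \<times> strict_seqs n)"
      by (rule summable_on_subset_banach) (auto simp: PiE_def Pi_def extensional_def)
    moreover have "inj_on ?g (strict_seqs n \<times> strict_seqs n)"
    proof (rule inj_onI, clarify)
      fix h h' k k'
      assume mem: "h \<in> strict_seqs n" "h' \<in> strict_seqs n" "k \<in> strict_seqs n" "k' \<in> strict_seqs n"
        and "(\<lambda>i\<in>{..<n}. (h ! p i, h' ! ?s i)) = (\<lambda>i\<in>{..<n}. (k ! p i, k' ! ?s i))"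
      hence eq: "h ! p i = k ! p i \<and> h' ! ?s i = k' ! ?s i" if "i < n" for i
        using that by (metis (no_types, lifting) lessThan_iff restrict_apply' prod.inject)
      have "h ! i = k ! i" "h' ! i = k' ! i" if "i < n" for i
      proof -
        have "i \<in> p ` {..<n}" "i \<in> ?s ` {..<n}"
          using that permutes_image[OF s] permutes_image[of p "{..<n}"] p by auto
        then obtain a b where "a < n" "i = p a" "b < n" "i = ?s b" by blast
        thus "h ! i = k ! i" "h' ! i = k' ! i" using eq[of a] eq[of b] by auto
      qed
      thus "h = k \<and> h' = k'" using mem by (auto simp: strict_seqs_def intro!: nth_equalityI)
    qed
    ultimately have "((\<lambda>g. norm (\<Prod>i<n. (\<lambda>(b, b'). A i b * m b b' * B b' (r (?s i))) (g i))) \<circ> ?g)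
        summable_on strict_seqs n \<times> strict_seqs n"
      by (simp add: summable_on_reindex)
    also have "?this \<longleftrightarrow> ?thesis"
    proof (rule summable_on_cong, clarify)
      fix h h'
      have "?b h h' q = (\<Prod>i<n. norm (m (h ! p i) (h' ! ?s i)))"
        using prod.permute[of p "{..<n}" "\<lambda>k. norm (m (h ! k) (h' ! q k))"] p by simp
      moreover have "?c h' r = (\<Prod>i<n. norm (B (h' ! ?s i) (r (?s i))))"
        using prod.permute[OF s, of "\<lambda>l. norm (B (h' ! l) (r l))"] by simp
      ultimately show "((\<lambda>g. norm (\<Prod>i<n. (\<lambda>(b, b'). A i b * m b b' * B b' (r (?s i))) (g i))) \<circ> ?g)
          (h, h') = ?a h p * ?b h h' q * ?c h' r"
        by (simp add: prod_norm[symmetric] norm_mult prod.distrib)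
    qed
    finally show ?thesis .
  qed
  hence "(\<lambda>x. \<Sum>p\<in>?P. \<Sum>q\<in>?P. \<Sum>r\<in>?P. case x of (h, h') \<Rightarrow> ?a h p * ?b h h' q * ?c h' r)
      summable_on strict_seqs n \<times> strict_seqs n"
    by (intro summable_on_finite_sum) (auto simp: finite_permutations)
  hence "(\<lambda>x. norm (case x of (h, h') \<Rightarrow> detf n (\<lambda>i k. A i (h ! k)) *
      detf n (\<lambda>k l. m (h ! k) (h' ! l)) * detf n (\<lambda>l j. B (h' ! l) j)))
      summable_on strict_seqs n \<times> strict_seqs n"
  proof (rule Infinite_Sum.abs_summable_on_comparison_test')
    fix x assume "x \<in> strict_seqs n \<times> strict_seqs n"
    obtain h h' where x: "x = (h, h')" by fastforce
    have "norm (detf n (\<lambda>i k. A i (h ! k)) * detf n (\<lambda>k l. m (h ! k) (h' ! l)) *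
        detf n (\<lambda>l j. B (h' ! l) j)) \<le> (\<Sum>p\<in>?P. ?a h p) * (\<Sum>q\<in>?P. ?b h h' q) * (\<Sum>r\<in>?P. ?c h' r)"
      unfolding norm_mult
      by (intro mult_mono norm_detf_le mult_nonneg_nonneg sum_nonneg prod_nonneg) auto
    also have "\<dots> = (\<Sum>p\<in>?P. \<Sum>q\<in>?P. \<Sum>r\<in>?P. ?a h p * ?b h h' q * ?c h' r)"
      unfolding mult.assoc sum_distrib_right unfolding sum_distrib_left ..
    finally show "norm (case x of (h, h') \<Rightarrow> detf n (\<lambda>i k. A i (h ! k)) *
        detf n (\<lambda>k l. m (h ! k) (h' ! l)) * detf n (\<lambda>l j. B (h' ! l) j)) \<le>
        (\<Sum>p\<in>?P. \<Sum>q\<in>?P. \<Sum>r\<in>?P. case x of (h, h') \<Rightarrow> ?a h p * ?b h h' q * ?c h' r)"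
      by (simp add: x)
  qed
  thus ?thesis by (simp add: case_prod_unfold)
qed

text \<open>The one-sum formula is applied twice: to \<open>A\<close> against the product
  \<open>?D\<close> of \<open>m\<close> and \<open>B\<close>, and then, with \<open>h\<close> fixed,
  to the rows of \<open>m\<close> selected by \<open>h\<close> against \<open>B\<close>.\<close>

theorem infinite_cauchy_binet_bilinear:
  fixes A m B :: "nat \<Rightarrow> nat \<Rightarrow> complex"
  assumes sum: "\<And>i j. i < n \<Longrightarrow> j < n \<Longrightarrow>
      ((\<lambda>(b, b'). A i b * m b b' * B b' j) has_sum g i j) UNIV"
    and abs: "\<And>i j. i < n \<Longrightarrow> j < n \<Longrightarrow>
      (\<lambda>(b, b'). norm (A i b * m b b' * B b' j)) summable_on UNIV"
  shows "((\<lambda>(h, h'). detf n (\<lambda>i k. A i (h ! k)) * detf n (\<lambda>k l. m (h ! k) (h' ! l)) *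
      detf n (\<lambda>l j. B (h' ! l) j)) has_sum detf n g) (strict_seqs n \<times> strict_seqs n)"
proof (rule has_sum_SigmaI)
  let ?D = "\<lambda>b j. \<Sum>\<^sub>\<infinity>b'. m b b' * B b' j"
  have absb: "(\<lambda>b'. norm (A i b * m b b' * B b' j)) summable_on UNIV" if "i < n" "j < n" for i j b
    by (rule summable_on_SigmaD1[of _ UNIV "\<lambda>_. UNIV"]) (use abs[OF that] in auto)
  have absD: "(\<lambda>b. norm (A i b * ?D b j)) summable_on UNIV"
    and sumD: "(\<Sum>\<^sub>\<infinity>b. A i b * ?D b j) = g i j" if ij: "i < n" "j < n" for i j
  proof -
    have "(\<lambda>b. \<Sum>\<^sub>\<infinity>b'. norm (A i b * m b b' * B b' j)) summable_on UNIV"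
      by (rule summable_on_Sigma_banach) (use abs[OF ij] in simp)
    thus "(\<lambda>b. norm (A i b * ?D b j)) summable_on UNIV"
    proof (rule Infinite_Sum.abs_summable_on_comparison_test')
      fix b
      have "A i b * ?D b j = (\<Sum>\<^sub>\<infinity>b'. A i b * m b b' * B b' j)"
        by (simp add: infsum_cmult_right'[symmetric] mult.assoc)
      also have "norm \<dots> \<le> (\<Sum>\<^sub>\<infinity>b'. norm (A i b * m b b' * B b' j))"
        by (rule norm_infsum_bound) (use absb[OF ij] in simp)
      finally show "norm (A i b * ?D b j) \<le> (\<Sum>\<^sub>\<infinity>b'. norm (A i b * m b b' * B b' j))" .
    qed
    have "(\<Sum>\<^sub>\<infinity>b. A i b * ?D b j) = (\<Sum>\<^sub>\<infinity>b. \<Sum>\<^sub>\<infinity>b'. A i b * m b b' * B b' j)"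
      by (simp add: infsum_cmult_right'[symmetric] mult.assoc)
    also have "\<dots> = (\<Sum>\<^sub>\<infinity>(b, b')\<in>UNIV \<times> UNIV. A i b * m b b' * B b' j)"
      by (rule infsum_Sigma'_banach) (use sum[OF ij] has_sum_imp_summable in auto)
    also have "\<dots> = g i j" using sum[OF ij] by (simp add: infsumI)
    finally show "(\<Sum>\<^sub>\<infinity>b. A i b * ?D b j) = g i j" .
  qed
  have "((\<lambda>h. detf n (\<lambda>i k. A i (h ! k)) * detf n (\<lambda>k j. ?D (h ! k) j)) has_sum
      detf n (\<lambda>i j. \<Sum>\<^sub>\<infinity>b. A i b * ?D b j)) (strict_seqs n)"
    by (rule infinite_cauchy_binet) (rule absD)
  thus "((\<lambda>h. detf n (\<lambda>i k. A i (h ! k)) * detf n (\<lambda>k j. ?D (h ! k) j)) has_sum detf n g)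
      (strict_seqs n)"
    using detf_cong[of n "\<lambda>i j. \<Sum>\<^sub>\<infinity>b. A i b * ?D b j" g] sumD by simp
  fix h
  show "((\<lambda>h'. case (h, h') of (h, h') \<Rightarrow> detf n (\<lambda>i k. A i (h ! k)) *
      detf n (\<lambda>k l. m (h ! k) (h' ! l)) * detf n (\<lambda>l j. B (h' ! l) j)) has_sum
      detf n (\<lambda>i k. A i (h ! k)) * detf n (\<lambda>k j. ?D (h ! k) j)) (strict_seqs n)"
  \<comment> \<open>The inner series are controlled only after multiplication by some
    \<open>A i (h ! k)\<close>. If all of these vanish for one \<open>k\<close>, the minor of
    \<open>A\<close> is already zero.\<close>
  proof (cases "\<exists>k<n. \<forall>i<n. A i (h ! k) = 0")
    case True
    then obtain k where k: "k < n" "\<And>i. i < n \<Longrightarrow> A i (h ! k) = 0" by blast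
    have "detf n (\<lambda>i k. A i (h ! k)) = detf n (\<lambda>k i. A i (h ! k))"
      by (rule detf_transpose[symmetric])
    also have "\<dots> = detf n (\<lambda>l i. (if l = k then 0 else 1) * A i (h ! l))"
      by (rule detf_cong) (use k in auto)
    also have "\<dots> = 0" using k(1) unfolding detf_scale_rows by (auto intro!: prod_zero)
    finally show ?thesis by simp
  next
    case False
    have "(\<lambda>b'. norm (m (h ! k) b' * B b' j)) summable_on UNIV" if "k < n" "j < n" for k j
    proof -
      from False that obtain i where i: "i < n" "A i (h ! k) \<noteq> 0" by blast
      have "(\<lambda>b'. norm (A i (h ! k)) * norm (m (h ! k) b' * B b' j)) summable_on UNIV"
        using absb[OF i(1) that(2), of "h ! k"] by (simp add: norm_mult mult.assoc)
      thus ?thesis using i(2) by (subst (asm) summable_on_cmult_right') auto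
    qed
    from has_sum_cmult_right[OF infinite_cauchy_binet[of n "\<lambda>k. m (h ! k)" B, OF this]]
    show ?thesis by (simp add: mult.assoc)
  qed
next
  show "(\<lambda>(h, h'). detf n (\<lambda>i k. A i (h ! k)) * detf n (\<lambda>k l. m (h ! k) (h' ! l)) *
      detf n (\<lambda>l j. B (h' ! l) j)) summable_on strict_seqs n \<times> strict_seqs n"
    by (rule abs_summable_summable) (use summable_on_triple_detf[OF abs] in \<open>simp add: case_prod_unfold\<close>)
qed

section \<open>Integrals of determinants and of power series\<close>

text \<open>For fixed permutations \<open>p\<close> and \<open>q\<close> the integral over the
  product space factors. The sum over \<open>q\<close> is the determinant with rows permuted by
  \<open>p\<close>, whose sign cancels that of \<open>p\<close>, so \<open>n!\<close> equal terms
  remain.\<close>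

lemma andreief:
  fixes \<phi> \<psi> :: "nat \<Rightarrow> 'a \<Rightarrow> complex"
  assumes "sigma_finite_measure M"
    and int: "\<And>i j. i < n \<Longrightarrow> j < n \<Longrightarrow> integrable M (\<lambda>z. \<phi> i z * \<psi> j z * w z)"
  shows "(LINT z|PiM {..<n} (\<lambda>_. M). detf n (\<lambda>i j. \<phi> j (z i)) * detf n (\<lambda>i j. \<psi> j (z i)) *
      (\<Prod>i<n. w (z i))) = fact n * detf n (\<lambda>i j. LINT z|M. \<phi> i z * \<psi> j z * w z)"
proof -
  interpret product_sigma_finite "\<lambda>_. M"
    using assms(1) by (simp add: product_sigma_finite_def)
  let ?P = "{p. p permutes {..<n}}"
  let ?G = "\<lambda>i j. LINT z|M. \<phi> i z * \<psi> j z * w z"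
  have lt: "p i < n" if "p \<in> ?P" "i < n" for p i
    using permutes_in_image[of p "{..<n}" i] that by simp
  have expand: "detf n (\<lambda>i j. \<phi> j (z i)) * detf n (\<lambda>i j. \<psi> j (z i)) * (\<Prod>i<n. w (z i)) =
      (\<Sum>p\<in>?P. \<Sum>q\<in>?P. signof p * signof q * (\<Prod>i<n. \<phi> (p i) (z i) * \<psi> (q i) (z i) * w (z i)))" for z
    unfolding detf_leibniz unfolding sum_product unfolding sum_distrib_right prod.distrib
    by (intro sum.cong refl) (simp only: mult_ac)
  have int': "integrable (PiM {..<n} (\<lambda>_. M)) (\<lambda>z. \<Prod>i<n. \<phi> (p i) (z i) * \<psi> (q i) (z i) * w (z i))"
    and val: "(LINT z|PiM {..<n} (\<lambda>_. M). (\<Prod>i<n. \<phi> (p i) (z i) * \<psi> (q i) (z i) * w (z i))) =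
      (\<Prod>i<n. ?G (p i) (q i))" if "p \<in> ?P" "q \<in> ?P" for p q
    using int lt that by (intro product_integrable_prod product_integral_prod; simp)+
  have "(LINT z|PiM {..<n} (\<lambda>_. M). detf n (\<lambda>i j. \<phi> j (z i)) * detf n (\<lambda>i j. \<psi> j (z i)) *
      (\<Prod>i<n. w (z i))) = (\<Sum>p\<in>?P. \<Sum>q\<in>?P. signof p * signof q * (\<Prod>i<n. ?G (p i) (q i)))"
    unfolding expand using int' val
    by (subst Bochner_Integration.integral_sum, force intro!: Bochner_Integration.integrable_sum)
       (intro sum.cong refl, subst Bochner_Integration.integral_sum, auto)
  also have "\<dots> = (\<Sum>p\<in>?P. signof p * detf n (\<lambda>i. ?G (p i)))"
    by (simp add: detf_leibniz sum_distrib_left mult_ac)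
  also have "\<dots> = (\<Sum>p\<in>?P. (signof p * signof p) * detf n ?G)"
  proof (rule sum.cong[OF refl])
    fix p assume "p \<in> ?P"
    hence "detf n (\<lambda>i. ?G (p i)) = signof p * detf n ?G"
      by (intro detf_permute_rows[of p n ?G]) simp
    thus "signof p * detf n (\<lambda>i. ?G (p i)) = (signof p * signof p) * detf n ?G" by (simp only: mult.assoc)
  qed
  also have "\<dots> = fact n * detf n ?G"
    by (simp only: signof_square mult_1_left sum_constant) (simp add: card_permutations[of _ n])
  finally show ?thesis .
qed

text \<open>The pairs are enumerated by \<open>prod_decode\<close> so that termwise integration of
  an ordinary series applies; absolute convergence of the integrals then makes the sum independent
  of the enumeration.\<close>

lemma has_sum_integral_dominated:
  fixes f :: "nat \<times> nat \<Rightarrow> 'a \<Rightarrow> complex"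
  assumes int: "\<And>i. integrable M (f i)" and g: "integrable M g"
    and dom: "AE x in M. \<forall>F. finite F \<longrightarrow> (\<Sum>i\<in>F. norm (f i x)) \<le> g x"
    and s: "AE x in M. ((\<lambda>i. f i x) has_sum s x) UNIV" and meas: "s \<in> borel_measurable M"
  shows "(\<lambda>i. norm (LINT x|M. f i x)) summable_on UNIV"
    and "((\<lambda>i. LINT x|M. f i x) has_sum (LINT x|M. s x)) UNIV"
proof -
  define F where "F k = f (prod_decode k)" for k
  have intF: "integrable M (F k)" for k using int by (simp add: F_def)
  have partial: "AE x in M. (\<Sum>k<N. norm (F k x)) \<le> g x" for N
    using dom
  proof eventually_elim
    case (elim x)
    have "(\<Sum>k<N. norm (F k x)) = (\<Sum>i\<in>prod_decode ` {..<N}. norm (f i x))"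
      by (subst sum.reindex) (auto simp: F_def intro: inj_on_subset[OF inj_prod_decode])
    with elim show ?case by simp
  qed
  have AE_sum: "AE x in M. summable (\<lambda>k. norm (F k x))"
    using partial[THEN AE_all_countable[THEN iffD2, OF allI]]
    by eventually_elim (auto intro: summableI_nonneg_bounded)
  have int_sum: "summable (\<lambda>k. LINT x|M. norm (F k x))"
  proof (rule summableI_nonneg_bounded)
    fix N
    have "(\<Sum>k<N. LINT x|M. norm (F k x)) = (LINT x|M. (\<Sum>k<N. norm (F k x)))"
      by (rule Bochner_Integration.integral_sum[symmetric]) (use intF in simp)
    also have "\<dots> \<le> (LINT x|M. g x)"
      by (rule integral_mono_AE) (use intF g partial in auto)
    finally show "(\<Sum>k<N. LINT x|M. norm (F k x)) \<le> (LINT x|M. g x)" .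
  qed simp
  have "summable (\<lambda>k. norm (LINT x|M. F k x))"
    by (rule summable_comparison_test'[OF int_sum]) simp
  moreover have "(\<lambda>k. LINT x|M. F k x) sums (LINT x|M. s x)"
  proof -
    have "(LINT x|M. (\<Sum>k. F k x)) = (LINT x|M. s x)"
    proof (rule integral_cong_AE)
      show "AE x in M. (\<Sum>k. F k x) = s x"
        using s
      proof eventually_elim
        case (elim x)
        hence "((\<lambda>k. F k x) has_sum s x) UNIV"
          using has_sum_reindex_bij_betw[OF bij_prod_decode, of "\<lambda>i. f i x"] by (simp add: F_def)
        thus ?case by (intro sums_unique[symmetric] has_sum_imp_sums)
      qed
    qed (use intF meas in measurable)
    thus ?thesis using sums_integral[OF intF AE_sum int_sum] by simp
  qed
  ultimately have 1: "((\<lambda>k. LINT x|M. F k x) has_sum (LINT x|M. s x)) UNIV"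
    and 2: "(\<lambda>k. norm (LINT x|M. F k x)) summable_on UNIV"
    by (auto intro: norm_summable_imp_has_sum summable_nonneg_imp_summable_on)
  show "((\<lambda>i. LINT x|M. f i x) has_sum (LINT x|M. s x)) UNIV"
    using 1 has_sum_reindex_bij_betw[OF bij_prod_decode, of "\<lambda>i. LINT x|M. f i x"] by (simp add: F_def)
  show "(\<lambda>i. norm (LINT x|M. f i x)) summable_on UNIV"
    using 2 summable_on_reindex_bij_betw[OF bij_prod_decode, of "\<lambda>i. norm (LINT x|M. f i x)"]
    by (simp add: F_def)
qed

section \<open>Formal power series evaluated absolutely at a point\<close>

text \<open>\<open>B\<close> is only an upper bound for the absolute sum, so it can be multiplied
  and exponentiated along with the series. It becomes the dominating function under the
  integrals.\<close>

definition fps_abs_eval :: "complex fps \<Rightarrow> complex \<Rightarrow> complex \<Rightarrow> real \<Rightarrow> bool" where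
  "fps_abs_eval f z v B \<longleftrightarrow> summable (\<lambda>b. norm (fps_nth f b * z ^ b)) \<and>
     (\<Sum>b. norm (fps_nth f b * z ^ b)) \<le> B \<and> (\<lambda>b. fps_nth f b * z ^ b) sums v"

lemma fps_abs_eval_mono: "fps_abs_eval f z v B \<Longrightarrow> B \<le> B' \<Longrightarrow> fps_abs_eval f z v B'"
  by (auto simp: fps_abs_eval_def)

lemma fps_abs_eval_nonneg: "fps_abs_eval f z v B \<Longrightarrow> 0 \<le> B"
  unfolding fps_abs_eval_def using suminf_nonneg[of "\<lambda>b. norm (fps_nth f b * z ^ b)"] by force

lemma fps_abs_eval_has_sum:
  assumes "fps_abs_eval f z v B"
  shows "((\<lambda>b. fps_nth f b * z ^ b) has_sum v) UNIV"
    and "(\<lambda>b. norm (fps_nth f b * z ^ b)) summable_on UNIV"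
    and "(\<Sum>\<^sub>\<infinity>b. norm (fps_nth f b * z ^ b)) \<le> B"
  using assms unfolding fps_abs_eval_def
  by (auto intro: norm_summable_imp_has_sum summable_nonneg_imp_summable_on
      simp: infsumI[OF norm_summable_imp_has_sum[OF _ summable_sums]])

lemma fps_abs_evalI:
  assumes "((\<lambda>b. fps_nth f b * z ^ b) has_sum v) UNIV"
    and "(\<lambda>b. norm (fps_nth f b * z ^ b)) summable_on UNIV"
    and "(\<Sum>\<^sub>\<infinity>b. norm (fps_nth f b * z ^ b)) \<le> B"
  shows "fps_abs_eval f z v B"
  unfolding fps_abs_eval_def
proof (intro conjI)
  have "(\<lambda>b. norm (fps_nth f b * z ^ b)) sums (\<Sum>\<^sub>\<infinity>b. norm (fps_nth f b * z ^ b))"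
    using assms(2) by (intro has_sum_imp_sums) simp
  thus "summable (\<lambda>b. norm (fps_nth f b * z ^ b))" "(\<Sum>b. norm (fps_nth f b * z ^ b)) \<le> B"
    using assms(3) by (auto simp: sums_iff)
qed (use assms(1) has_sum_imp_sums in auto)

lemma fps_abs_eval_finite:
  assumes "\<And>b. b \<ge> K \<Longrightarrow> fps_nth f b = 0"
  shows "fps_abs_eval f z (\<Sum>b<K. fps_nth f b * z ^ b) (\<Sum>b<K. norm (fps_nth f b) * norm z ^ b)"
proof -
  have "(\<lambda>b. norm (fps_nth f b * z ^ b)) sums (\<Sum>b<K. norm (fps_nth f b * z ^ b))"
    by (rule sums_finite) (use assms in auto)
  moreover have "(\<lambda>b. fps_nth f b * z ^ b) sums (\<Sum>b<K. fps_nth f b * z ^ b)"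
    by (rule sums_finite) (use assms in auto)
  ultimately show ?thesis
    by (auto simp: fps_abs_eval_def sums_iff norm_mult norm_power)
qed

lemma fps_abs_eval_mult:
  assumes f: "fps_abs_eval f z v B" and g: "fps_abs_eval g z w C"
  shows "fps_abs_eval (f * g) z (v * w) (B * C)"
proof -
  let ?a = "\<lambda>b. fps_nth f b * z ^ b" and ?c = "\<lambda>b. fps_nth g b * z ^ b"
  have nth: "fps_nth (f * g) k * z ^ k = (\<Sum>i\<le>k. ?a i * ?c (k - i))" for k
  proof -
    have "?a i * ?c (k - i) = fps_nth f i * fps_nth g (k - i) * z ^ k" if "i \<le> k" for i
      using that by (simp add: power_add[symmetric] mult_ac)
    hence "(\<Sum>i\<le>k. ?a i * ?c (k - i)) = (\<Sum>i\<le>k. fps_nth f i * fps_nth g (k - i) * z ^ k)"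
      by (intro sum.cong) auto
    thus ?thesis by (simp only: fps_mult_nth atLeast0AtMost sum_distrib_right)
  qed
  have s: "summable (\<lambda>b. norm (?a b))" "summable (\<lambda>b. norm (?c b))"
    and v: "suminf ?a = v" "suminf ?c = w"
    using f g by (auto simp: fps_abs_eval_def sums_iff)
  have 1: "(\<lambda>k. fps_nth (f * g) k * z ^ k) sums (v * w)"
    unfolding nth using Cauchy_product_sums[OF s] v by simp
  have 2: "(\<lambda>k. \<Sum>i\<le>k. norm (?a i) * norm (?c (k - i))) sums
      ((\<Sum>b. norm (?a b)) * (\<Sum>b. norm (?c b)))"
    by (rule Cauchy_product_sums) (use s in simp_all)
  have le: "norm (fps_nth (f * g) k * z ^ k) \<le> (\<Sum>i\<le>k. norm (?a i) * norm (?c (k - i)))" for k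
    unfolding nth by (rule order.trans[OF norm_sum]) (simp add: norm_mult)
  have 3: "summable (\<lambda>k. norm (fps_nth (f * g) k * z ^ k))"
    by (rule summable_comparison_test'[OF sums_summable[OF 2], of 0]) (use le in simp)
  have "(\<Sum>k. norm (fps_nth (f * g) k * z ^ k)) \<le> (\<Sum>b. norm (?a b)) * (\<Sum>b. norm (?c b))"
    using suminf_le[OF le 3 sums_summable[OF 2]] 2 by (simp add: sums_iff)
  also have "\<dots> \<le> B * C"
    using f g fps_abs_eval_nonneg[OF f] s
    by (intro mult_mono suminf_nonneg) (auto simp: fps_abs_eval_def)
  finally show ?thesis using 1 3 by (simp add: fps_abs_eval_def)
qed

lemma fps_abs_eval_1: "fps_abs_eval 1 z 1 1"
  using fps_abs_eval_finite[of 1 1 z] by simp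

lemma fps_abs_eval_power: "fps_abs_eval f z v B \<Longrightarrow> fps_abs_eval (f ^ k) z (v ^ k) (B ^ k)"
  by (induction k) (auto intro: fps_abs_eval_1 fps_abs_eval_mult)

text \<open>The terms of the series \<open>f ^ k / k!\<close> form an absolutely convergent double
  series, since row \<open>k\<close> has absolute sum at most \<open>B ^ k / k!\<close>. Summed by
  rows it is \<open>exp v\<close>. Summed by columns it is the composed series, whose coefficients
  are finite sums because \<open>f\<close> has no constant term.\<close>

lemma fps_abs_eval_exp:
  assumes f: "fps_abs_eval f z v B" and f0: "fps_nth f 0 = 0"
  shows "fps_abs_eval (fps_exp 1 oo f) z (exp v) (exp B)"
proof -
  let ?c = "\<lambda>k b. fps_nth (f ^ k) b * z ^ b / fact k"
  note fk = fps_abs_eval_has_sum[OF fps_abs_eval_power[OF f]]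
  have row: "((\<lambda>b. ?c k b) has_sum (v ^ k / fact k)) UNIV" for k
    using has_sum_cmult_right[OF fk(1)[of k], of "1 / fact k"] by (simp add: field_simps)
  have rown: "(\<lambda>b. norm (?c k b)) summable_on UNIV"
    "(\<Sum>\<^sub>\<infinity>b. norm (?c k b)) \<le> B ^ k / fact k" for k
  proof -
    have eq: "(\<lambda>b. norm (?c k b)) = (\<lambda>b. (1 / fact k) * norm (fps_nth (f ^ k) b * z ^ b))"
      by (simp add: norm_divide)
    show "(\<lambda>b. norm (?c k b)) summable_on UNIV"
      unfolding eq by (rule summable_on_cmult_right[OF fk(2)])
    show "(\<Sum>\<^sub>\<infinity>b. norm (?c k b)) \<le> B ^ k / fact k"
      unfolding eq infsum_cmult_right' using fk(3)[of k] by (simp add: divide_right_mono)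
  qed
  have expB: "((\<lambda>k. B ^ k / fact k) has_sum exp B) UNIV"
    using exp_converges[of B] fps_abs_eval_nonneg[OF f]
    by (intro sums_nonneg_imp_has_sum) (auto simp: field_simps)
  have sn: "(\<lambda>k. \<Sum>\<^sub>\<infinity>b. norm (?c k b)) summable_on UNIV"
    by (rule summable_on_comparison_test[OF has_sum_imp_summable[OF expB]])
       (use rown in \<open>auto intro: infsum_nonneg\<close>)
  have abs: "(\<lambda>(k, b). norm (?c k b)) summable_on UNIV \<times> UNIV"
    by (rule summable_on_SigmaI[where g = "\<lambda>k. \<Sum>\<^sub>\<infinity>b. norm (?c k b)"]) (use rown sn in auto)
  have tot: "((\<lambda>(k, b). ?c k b) has_sum exp v) (UNIV \<times> UNIV)"
  proof (rule has_sum_SigmaI[where g = "\<lambda>k. v ^ k / fact k"])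
    have "(\<lambda>k. v ^ k / fact k) sums exp v"
      using exp_converges[of v] by (simp add: scaleR_conv_of_real field_simps)
    thus "((\<lambda>k. v ^ k / fact k) has_sum exp v) UNIV"
      using summable_norm_exp[of v]
      by (intro norm_summable_imp_has_sum) (auto simp: norm_divide norm_power scaleR_conv_of_real field_simps)
    show "(\<lambda>(k, b). ?c k b) summable_on UNIV \<times> UNIV"
      by (rule abs_summable_summable) (use abs in \<open>simp add: case_prod_unfold\<close>)
  qed (use row in simp)
  have col: "((\<lambda>k. ?c k b) has_sum fps_nth (fps_exp 1 oo f) b * z ^ b) UNIV" for b
  proof (rule has_sum_finite_neutralI[of "{0..b}"])
    show "?c k b = 0" if "k \<in> UNIV - {0..b}" for k
      using startsby_zero_power_prefix[OF f0, of k] that by simp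
  qed (auto simp: fps_compose_nth sum_distrib_right intro!: sum.cong)
  have abs': "(\<lambda>(b, k). norm (?c k b)) summable_on UNIV \<times> UNIV"
    using abs by (subst summable_on_swap) (simp add: case_prod_unfold)
  have coln: "(\<lambda>k. norm (?c k b)) summable_on UNIV" for b
    by (rule summable_on_SigmaD1[of _ UNIV "\<lambda>_. UNIV"]) (use abs' in auto)
  have le: "norm (fps_nth (fps_exp 1 oo f) b * z ^ b) \<le> (\<Sum>\<^sub>\<infinity>k. norm (?c k b))" for b
    using norm_infsum_bound[OF coln[of b]] infsumI[OF col[of b]] by simp
  have sc: "(\<lambda>b. \<Sum>\<^sub>\<infinity>k. norm (?c k b)) summable_on UNIV"
    by (rule summable_on_Sigma_banach) (use abs' in simp)
  show ?thesis
  proof (rule fps_abs_evalI)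
    show "((\<lambda>b. fps_nth (fps_exp 1 oo f) b * z ^ b) has_sum exp v) UNIV"
      by (rule has_sum_SigmaD[where f = "\<lambda>(b, k). ?c k b" and A = UNIV and B = "\<lambda>_. UNIV"])
         (use tot col has_sum_swap[of "\<lambda>(k, b). ?c k b" UNIV UNIV] in auto)
    show s: "(\<lambda>b. norm (fps_nth (fps_exp 1 oo f) b * z ^ b)) summable_on UNIV"
      by (rule Infinite_Sum.abs_summable_on_comparison_test'[OF sc]) (rule le)
    have "(\<Sum>\<^sub>\<infinity>b. norm (fps_nth (fps_exp 1 oo f) b * z ^ b)) \<le> (\<Sum>\<^sub>\<infinity>b. \<Sum>\<^sub>\<infinity>k. norm (?c k b))"
      by (rule infsum_mono[OF s sc le])
    also have "\<dots> = (\<Sum>\<^sub>\<infinity>k. \<Sum>\<^sub>\<infinity>b. norm (?c k b))"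
      by (rule infsum_swap_banach) (use abs' in simp)
    also have "\<dots> \<le> (\<Sum>\<^sub>\<infinity>k. B ^ k / fact k)"
      by (rule infsum_mono[OF sn has_sum_imp_summable[OF expB]]) (rule rown)
    also have "\<dots> = exp B" by (rule infsumI[OF expB])
    finally show "(\<Sum>\<^sub>\<infinity>b. norm (fps_nth (fps_exp 1 oo f) b * z ^ b)) \<le> exp B" .
  qed
qed

definition pot_fps :: "(nat \<Rightarrow> complex) \<Rightarrow> complex fps" where
  "pot_fps p = Abs_fps (\<lambda>m. if m = 0 then 0 else p m / of_nat m)"

definition schur_fps :: "(nat \<Rightarrow> complex) \<Rightarrow> complex fps" where
  "schur_fps p = fps_exp 1 oo pot_fps p"

lemma fps_abs_eval_pot:
  assumes "pot_abs_conv (norm z) p"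
  shows "fps_abs_eval (pot_fps p) z (pot z p) (abs_pot (norm z) p)"
proof -
  let ?t = "\<lambda>m. fps_nth (pot_fps p) m * z ^ m"
  have nrm: "norm (?t (Suc m)) = norm z ^ Suc m * norm (p (Suc m)) / real (Suc m)" for m
    by (simp add: pot_fps_def norm_mult norm_divide norm_power del: of_nat_Suc)
  have t0: "?t 0 = 0" by (simp add: pot_fps_def)
  have "summable (\<lambda>m. norm (?t (Suc m)))"
    using assms by (simp only: nrm pot_abs_conv_def)
  hence 1: "summable (\<lambda>m. norm (?t m))" by (rule summable_Suc_iff[THEN iffD1])
  hence "(\<Sum>m. norm (?t m)) = abs_pot (norm z) p"
    using suminf_split_head[OF 1] by (simp only: nrm abs_pot_def t0 norm_zero diff_0_right)
  moreover have "?t sums pot z p"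
  proof -
    have "suminf ?t = (\<Sum>m. ?t (Suc m))"
      using suminf_split_head[OF summable_norm_cancel[OF 1]] t0 by simp
    also have "\<dots> = pot z p"
      by (simp add: pot_def pot_fps_def mult_ac)
    finally show ?thesis using summable_norm_cancel[OF 1] by (simp add: sums_iff)
  qed
  ultimately show ?thesis using 1 by (simp add: fps_abs_eval_def)
qed

lemma fps_abs_eval_schur:
  assumes "pot_abs_conv (norm z) p"
  shows "fps_abs_eval (schur_fps p) z (exp (pot z p)) (exp (abs_pot (norm z) p))"
  unfolding schur_fps_def by (rule fps_abs_eval_exp[OF fps_abs_eval_pot[OF assms]]) (simp add: pot_fps_def)

lemma has_sum_product_complex:
  fixes f g :: "nat \<Rightarrow> complex"
  assumes "(f has_sum a) UNIV" "(g has_sum b) UNIV"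
    and "(\<lambda>i. norm (f i)) summable_on UNIV" "(\<lambda>i. norm (g i)) summable_on UNIV"
  shows "((\<lambda>(i, j). f i * g j) has_sum a * b) UNIV"
    and "((\<lambda>(i, j). norm (f i * g j)) has_sum (\<Sum>\<^sub>\<infinity>i. norm (f i)) * (\<Sum>\<^sub>\<infinity>j. norm (g j))) UNIV"
proof -
  have abs: "(\<lambda>(i, j). norm (f i * g j)) summable_on UNIV \<times> UNIV"
    by (rule summable_on_SigmaI[where g = "\<lambda>i. norm (f i) * (\<Sum>\<^sub>\<infinity>j. norm (g j))"])
       (use assms(3,4) in \<open>auto simp: norm_mult intro!: has_sum_cmult_right summable_on_cmult_left\<close>)
  show "((\<lambda>(i, j). norm (f i * g j)) has_sum (\<Sum>\<^sub>\<infinity>i. norm (f i)) * (\<Sum>\<^sub>\<infinity>j. norm (g j))) UNIV"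
    unfolding UNIV_Times_UNIV[symmetric]
    by (rule has_sum_SigmaI[where g = "\<lambda>i. norm (f i) * (\<Sum>\<^sub>\<infinity>j. norm (g j))"])
       (use assms(3,4) abs in \<open>auto simp: norm_mult intro!: has_sum_cmult_right has_sum_cmult_left\<close>)
  have "(\<lambda>x. case x of (i, j) \<Rightarrow> f i * g j) summable_on UNIV \<times> UNIV"
    by (rule abs_summable_summable) (use abs in \<open>simp add: case_prod_unfold\<close>)
  thus "((\<lambda>(i, j). f i * g j) has_sum a * b) UNIV"
    unfolding UNIV_Times_UNIV[symmetric]
    by (intro has_sum_SigmaI[where g = "\<lambda>i. f i * b"])
       (use assms(1,2) in \<open>auto intro!: has_sum_cmult_right has_sum_cmult_left\<close>)
qed

text \<open>Pointwise the integrand is a double series dominated by the product of the two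
  majorants. Two evaluation points are allowed because in the variable \<open>x\<close> the columns
  are evaluated at \<open>x\<close> and at \<open>1 / x\<close>; in the variable \<open>z\<close>
  both points are \<open>z\<close>.\<close>

lemma moment_double_series:
  fixes u v w \<phi> \<psi> :: "'a \<Rightarrow> complex"
  assumes [measurable]: "u \<in> borel_measurable M" "v \<in> borel_measurable M" "w \<in> borel_measurable M"
    and meas: "(\<lambda>x. \<phi> x * \<psi> x * w x) \<in> borel_measurable M"
    and F: "AE x in M. fps_abs_eval F (u x) (\<phi> x) (b1 x)"
    and G: "AE x in M. fps_abs_eval G (v x) (\<psi> x) (b2 x)"
    and int: "integrable M (\<lambda>x. b1 x * b2 x * norm (w x))"
  defines "m \<equiv> \<lambda>i j. LINT x|M. u x ^ i * v x ^ j * w x"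
  shows "((\<lambda>(i, j). fps_nth F i * m i j * fps_nth G j) has_sum (LINT x|M. \<phi> x * \<psi> x * w x)) UNIV"
    and "(\<lambda>(i, j). norm (fps_nth F i * m i j * fps_nth G j)) summable_on UNIV"
    and "integrable M (\<lambda>x. \<phi> x * \<psi> x * w x)"
proof -
  let ?f = "\<lambda>(i, j) x. (fps_nth F i * u x ^ i) * (fps_nth G j * v x ^ j) * w x"
  have dom: "AE x in M. \<forall>K. finite K \<longrightarrow> (\<Sum>i\<in>K. norm (?f i x)) \<le> b1 x * b2 x * norm (w x)"
    and lim: "AE x in M. ((\<lambda>i. ?f i x) has_sum \<phi> x * \<psi> x * w x) UNIV"
    and nphi: "AE x in M. norm (\<phi> x * \<psi> x * w x) \<le> b1 x * b2 x * norm (w x)"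
  proof -
    have "AE x in M. (\<forall>K. finite K \<longrightarrow> (\<Sum>i\<in>K. norm (?f i x)) \<le> b1 x * b2 x * norm (w x)) \<and>
        ((\<lambda>i. ?f i x) has_sum \<phi> x * \<psi> x * w x) UNIV \<and>
        norm (\<phi> x * \<psi> x * w x) \<le> b1 x * b2 x * norm (w x)"
      using F G
    proof eventually_elim
      case (elim x)
      note f = fps_abs_eval_has_sum[OF elim(1)] and g = fps_abs_eval_has_sum[OF elim(2)]
      note pr = has_sum_product_complex[OF f(1) g(1) f(2) g(2)]
      let ?h = "\<lambda>(i, j). norm ((fps_nth F i * u x ^ i) * (fps_nth G j * v x ^ j))"
      have bound: "infsum ?h UNIV \<le> b1 x * b2 x"
        using f(3) g(3) fps_abs_eval_nonneg[OF elim(1)]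
        by (subst infsumI[OF pr(2)]) (intro mult_mono infsum_nonneg; simp)
      have le: "(\<Sum>i\<in>K. norm (?f i x)) \<le> b1 x * b2 x * norm (w x)" if "finite K" for K
      proof -
        have "sum ?h K \<le> infsum ?h UNIV"
          by (rule finite_sum_le_infsum) (use pr(2) that has_sum_imp_summable in auto)
        hence "sum ?h K * norm (w x) \<le> b1 x * b2 x * norm (w x)"
          using bound by (intro mult_right_mono) auto
        thus ?thesis by (simp add: sum_distrib_right case_prod_unfold norm_mult)
      qed
      have hs: "((\<lambda>i. ?f i x) has_sum \<phi> x * \<psi> x * w x) UNIV"
        using has_sum_cmult_left[OF pr(1), of "w x"] by (simp add: case_prod_unfold)
      have "norm (\<phi> x * \<psi> x * w x) \<le> b1 x * b2 x * norm (w x)"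
      proof -
        have "norm (\<phi> x * \<psi> x) \<le> infsum ?h UNIV"
          using norm_has_sum_bound[OF _ pr(1), of "infsum ?h UNIV"] has_sum_imp_summable[OF pr(2)]
          by (simp add: case_prod_unfold)
        thus ?thesis using bound by (auto simp: norm_mult intro!: mult_right_mono)
      qed
      with le hs show ?case by blast
    qed
    thus "AE x in M. \<forall>K. finite K \<longrightarrow> (\<Sum>i\<in>K. norm (?f i x)) \<le> b1 x * b2 x * norm (w x)"
      "AE x in M. ((\<lambda>i. ?f i x) has_sum \<phi> x * \<psi> x * w x) UNIV"
      "AE x in M. norm (\<phi> x * \<psi> x * w x) \<le> b1 x * b2 x * norm (w x)"
      by auto
  qed
  have intf: "integrable M (?f i)" for i
  proof (rule Bochner_Integration.integrable_bound[OF int])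
    show "?f i \<in> borel_measurable M" by (simp add: case_prod_unfold)
    show "AE x in M. norm (?f i x) \<le> norm (b1 x * b2 x * norm (w x))"
      using dom
    proof eventually_elim
      case (elim x)
      from elim[rule_format, of "{i}"] show ?case by simp
    qed
  qed
  have eq: "(LINT x|M. ?f i x) = (case i of (i, j) \<Rightarrow> fps_nth F i * m i j * fps_nth G j)" for i
  proof -
    have "(LINT x|M. ?f i x) =
        (LINT x|M. fps_nth F (fst i) * fps_nth G (snd i) * (u x ^ fst i * v x ^ snd i * w x))"
      by (rule Bochner_Integration.integral_cong) (simp_all add: case_prod_unfold mult_ac)
    thus ?thesis by (simp add: m_def case_prod_unfold)
  qed
  note main = has_sum_integral_dominated[OF intf int dom lim meas]
  show "((\<lambda>(i, j). fps_nth F i * m i j * fps_nth G j) has_sum (LINT x|M. \<phi> x * \<psi> x * w x)) UNIV"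
    using main(2) by (simp only: eq)
  show "(\<lambda>(i, j). norm (fps_nth F i * m i j * fps_nth G j)) summable_on UNIV"
    using main(1) by (simp only: eq) (simp add: case_prod_unfold)
  show "integrable M (\<lambda>x. \<phi> x * \<psi> x * w x)"
    by (rule Bochner_Integration.integrable_bound[OF int meas]) (use nphi in auto)
qed

section \<open>The differential operators on graded polynomials\<close>

text \<open>Polynomials in \<open>p\<^sub>1, p\<^sub>2, \<dots>\<close> of degree at most \<open>d\<close>, where \<open>p\<^sub>m\<close> has degree \<open>m\<close>.\<close>
inductive wpoly :: "nat \<Rightarrow> ((nat \<Rightarrow> complex) \<Rightarrow> complex) \<Rightarrow> bool" where
  wpoly_const: "wpoly d (\<lambda>_. c)"
| wpoly_add: "wpoly d F \<Longrightarrow> wpoly d G \<Longrightarrow> wpoly d (\<lambda>p. F p + G p)"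
| wpoly_var_mult: "wpoly d F \<Longrightarrow> 1 \<le> m \<Longrightarrow> m + d \<le> e \<Longrightarrow> wpoly e (\<lambda>p. p m * F p)"

lemma wpoly_mono: "wpoly d F \<Longrightarrow> d \<le> e \<Longrightarrow> wpoly e F"
proof (induction arbitrary: e rule: wpoly.induct)
  case (wpoly_var_mult d F m d')
  thus ?case using wpoly.wpoly_var_mult[of d F m e] by simp
qed (auto intro: wpoly.intros)

lemma wpoly_cmult: "wpoly d F \<Longrightarrow> wpoly d (\<lambda>p. c * F p)"
proof (induction rule: wpoly.induct)
  case (wpoly_add d F G)
  thus ?case using wpoly.wpoly_add[OF wpoly_add.IH] by (simp add: distrib_left)
next
  case (wpoly_var_mult d F m e)
  thus ?case using wpoly.wpoly_var_mult[OF wpoly_var_mult.IH, of m e] by (simp add: mult.left_commute)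
qed (auto intro: wpoly_const)

lemma wpoly_mult: "wpoly d F \<Longrightarrow> wpoly e G \<Longrightarrow> wpoly (d + e) (\<lambda>p. F p * G p)"
proof (induction rule: wpoly.induct)
  case (wpoly_const d c)
  thus ?case by (intro wpoly_cmult wpoly_mono[OF wpoly_const]) auto
next
  case (wpoly_add d F1 F2)
  thus ?case using wpoly.wpoly_add[of "d + e" "\<lambda>p. F1 p * G p" "\<lambda>p. F2 p * G p"]
    by (simp add: distrib_right)
next
  case (wpoly_var_mult d F m e')
  thus ?case using wpoly.wpoly_var_mult[of "d + e" "\<lambda>p. F p * G p" m "e' + e"]
    by (simp add: mult.assoc)
qed

lemma wpoly_sum: "(\<And>i. i \<in> I \<Longrightarrow> wpoly d (F i)) \<Longrightarrow> wpoly d (\<lambda>p. \<Sum>i\<in>I. F i p)"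
  by (induction I rule: infinite_finite_induct) (auto intro: wpoly.intros)

lemma wpoly_prod: "(\<And>i. i < n \<Longrightarrow> wpoly d (F i)) \<Longrightarrow> wpoly (n * d) (\<lambda>p. \<Prod>i<n. F i p)"
proof (induction n)
  case (Suc n)
  thus ?case using wpoly_mult[of "n * d" "\<lambda>p. \<Prod>i<n. F i p" d "F n"] by (simp add: add.commute)
qed (auto intro: wpoly_const)

text \<open>The weight drops by \<open>m\<close>, and a polynomial of weight below \<open>m\<close>
  cannot contain \<open>p m\<close>. A true derivative is exhibited, since a value of
  \<open>deriv\<close> by itself says nothing about differentiability.\<close>

lemma wpoly_has_derivative:
  assumes "wpoly d F" "1 \<le> m"
  shows "\<exists>F'. (\<forall>p. ((\<lambda>t. F (p(m := t))) has_field_derivative F' p) (at (p m))) \<and>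
    (if m \<le> d then wpoly (d - m) F' else F' = (\<lambda>_. 0))"
  using assms
proof (induction rule: wpoly.induct)
  case (wpoly_const d c)
  thus ?case by (intro exI[of _ "\<lambda>_. 0"]) (auto intro: wpoly.wpoly_const)
next
  case (wpoly_add d F G)
  then obtain F' G' where
    "\<And>p. ((\<lambda>t. F (p(m := t))) has_field_derivative F' p) (at (p m))"
    "\<And>p. ((\<lambda>t. G (p(m := t))) has_field_derivative G' p) (at (p m))"
    "if m \<le> d then wpoly (d - m) F' else F' = (\<lambda>_. 0)"
    "if m \<le> d then wpoly (d - m) G' else G' = (\<lambda>_. 0)" by blast
  thus ?case
    by (intro exI[of _ "\<lambda>p. F' p + G' p"] conjI allI DERIV_add)
       (auto simp del: fun_upd_apply intro: wpoly.wpoly_add split: if_splits)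
next
  case (wpoly_var_mult d F k e)
  then obtain F' where F': "\<And>p. ((\<lambda>t. F (p(m := t))) has_field_derivative F' p) (at (p m))"
    and w: "if m \<le> d then wpoly (d - m) F' else F' = (\<lambda>_. 0)" by blast
  show ?case
  proof (cases "k = m")
    case True
    have "((\<lambda>t. (p(m := t)) k * F (p(m := t))) has_field_derivative F p + p m * F' p) (at (p m))" for p
      using True F'[of p] by (auto intro!: derivative_eq_intros)
    moreover have "wpoly (e - m) (\<lambda>p. F p + p m * F' p)"
    proof (intro wpoly.wpoly_add)
      show "wpoly (e - m) F" by (rule wpoly_mono[OF wpoly_var_mult.hyps(1)]) (use wpoly_var_mult True in simp)
      show "wpoly (e - m) (\<lambda>p. p m * F' p)"
        using w wpoly_var_mult True
        by (cases "m \<le> d") (auto intro: wpoly.wpoly_var_mult[of "d - m"] wpoly_const)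
    qed
    moreover have "m \<le> e" using wpoly_var_mult True by simp
    ultimately show ?thesis by (intro exI[of _ "\<lambda>p. F p + p m * F' p"] conjI allI) (simp_all del: fun_upd_apply)
  next
    case False
    have "((\<lambda>t. (p(m := t)) k * F (p(m := t))) has_field_derivative p k * F' p) (at (p m))" for p
      using False F'[of p] by (auto intro!: derivative_eq_intros)
    moreover have "if m \<le> e then wpoly (e - m) (\<lambda>p. p k * F' p) else (\<lambda>p. p k * F' p) = (\<lambda>_. 0)"
    proof (cases "m \<le> d")
      case True
      have "wpoly (e - m) (\<lambda>p. p k * F' p)"
        by (rule wpoly.wpoly_var_mult[of "d - m"]) (use w wpoly_var_mult True in auto)
      thus ?thesis using True wpoly_var_mult by auto
    qed (use w in \<open>auto intro: wpoly_const\<close>)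
    ultimately show ?thesis by (intro exI[of _ "\<lambda>p. p k * F' p"] conjI allI)
  qed
qed

lemma pd_eqI:
  assumes "\<And>p. ((\<lambda>t. F (p(m := t))) has_field_derivative F' p) (at (p m))"
  shows "pd m F = F'"
  using assms by (intro ext) (simp add: pd_def DERIV_imp_deriv)

lemma wpoly_pd_has_derivative:
  assumes "wpoly d F" "1 \<le> m"
  shows "((\<lambda>t. F (p(m := t))) has_field_derivative pd m F p) (at (p m))"
  using wpoly_has_derivative[OF assms] pd_eqI[of F m] by metis

lemma wpoly_pd:
  assumes "wpoly d F" "1 \<le> m"
  shows "m \<le> d \<Longrightarrow> wpoly (d - m) (pd m F)" and "d < m \<Longrightarrow> pd m F = (\<lambda>_. 0)"
  using wpoly_has_derivative[OF assms] pd_eqI[of F m] by (metis not_le)+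

lemma wpoly_pd':
  assumes "wpoly d F" "1 \<le> m"
  shows "wpoly d (pd m F)"
  using wpoly_pd[OF assms] by (cases "m \<le> d") (auto intro: wpoly_mono wpoly_const)

text \<open>Additivity of \<open>deriv\<close> rests on differentiability of the summands, hence the
  restriction to \<open>wpoly\<close>.\<close>

lemma pd_linear:
  assumes "\<And>i. i \<in> I \<Longrightarrow> wpoly d (F i)" "1 \<le> m"
  shows "pd m (\<lambda>p. \<Sum>i\<in>I. c i * F i p) = (\<lambda>p. \<Sum>i\<in>I. c i * pd m (F i) p)"
  by (rule pd_eqI) (auto intro!: DERIV_sum DERIV_cmult wpoly_pd_has_derivative assms)

lemma pd_zero: "pd m (\<lambda>_. 0) = (\<lambda>_. 0)"
  by (simp add: pd_def)

lemma Omega_finite: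
  assumes "wpoly d F" "d \<le> D"
  shows "Omega_op \<sigma> F p = (\<Sum>i<D. - (of_nat (Suc i) / 2) * pd (Suc i) (pd (Suc i) F) p +
    \<sigma> * pd (2 * Suc i) F p)"
  unfolding Omega_op_def Let_def
proof (rule suminf_finite)
  fix i assume "i \<notin> {..<D}"
  hence "pd (Suc i) F = (\<lambda>_. 0)" "pd (2 * Suc i) F = (\<lambda>_. 0)"
    using assms(2) by (auto intro!: wpoly_pd(2)[OF assms(1)])
  thus "- (of_nat (Suc i) / 2) * pd (Suc i) (pd (Suc i) F) p + \<sigma> * pd (2 * Suc i) F p = 0"
    by (simp only: pd_zero) simp
qed simp

lemma Omega_linear:
  assumes F: "\<And>i. i \<in> I \<Longrightarrow> wpoly d (F i)"
  shows "Omega_op \<sigma> (\<lambda>p. \<Sum>i\<in>I. c i * F i p) = (\<lambda>p. \<Sum>i\<in>I. c i * Omega_op \<sigma> (F i) p)"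
proof
  fix p
  have w: "wpoly d (\<lambda>p. \<Sum>i\<in>I. c i * F i p)" by (intro wpoly_sum wpoly_cmult F)
  have "pd (Suc k) (pd (Suc k) (\<lambda>p. \<Sum>i\<in>I. c i * F i p)) =
      (\<lambda>p. \<Sum>i\<in>I. c i * pd (Suc k) (pd (Suc k) (F i)) p)" for k
    by (subst pd_linear[OF F], simp_all) (subst pd_linear[OF wpoly_pd'[OF F]], simp_all)
  moreover have "pd (2 * Suc k) (\<lambda>p. \<Sum>i\<in>I. c i * F i p) = (\<lambda>p. \<Sum>i\<in>I. c i * pd (2 * Suc k) (F i) p)" for k
    by (rule pd_linear[OF F]) simp_all
  ultimately have "Omega_op \<sigma> (\<lambda>p. \<Sum>i\<in>I. c i * F i p) p =
      (\<Sum>k<d. - (of_nat (Suc k) / 2) * (\<Sum>i\<in>I. c i * pd (Suc k) (pd (Suc k) (F i)) p) +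
        \<sigma> * (\<Sum>i\<in>I. c i * pd (2 * Suc k) (F i) p))"
    by (simp only: Omega_finite[OF w order.refl])
  also have "\<dots> = (\<Sum>k<d. \<Sum>i\<in>I. c i * (- (of_nat (Suc k) / 2) * pd (Suc k) (pd (Suc k) (F i)) p +
        \<sigma> * pd (2 * Suc k) (F i) p))"
    by (intro sum.cong refl) (simp add: sum_distrib_left sum.distrib[symmetric] sum_subtractf[symmetric] algebra_simps del: of_nat_Suc mult_Suc_right)
  also have "\<dots> = (\<Sum>i\<in>I. \<Sum>k<d. c i * (- (of_nat (Suc k) / 2) * pd (Suc k) (pd (Suc k) (F i)) p +
        \<sigma> * pd (2 * Suc k) (F i) p))"
    by (rule sum.swap)
  also have "\<dots> = (\<Sum>i\<in>I. c i * Omega_op \<sigma> (F i) p)"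
    by (intro sum.cong refl) (simp only: Omega_finite[OF F order.refl] sum_distrib_left)
  finally show "Omega_op \<sigma> (\<lambda>p. \<Sum>i\<in>I. c i * F i p) p = (\<Sum>i\<in>I. c i * Omega_op \<sigma> (F i) p)" .
qed

text \<open>Both kinds of terms lower the weight by \<open>2 * m\<close>, that is, by at least 2.
  Since \<open>d - 2\<close> is truncated, the vanishing for \<open>d < 2\<close> is stated
  separately; it is what makes the operator nilpotent.\<close>

lemma wpoly_Omega:
  assumes F: "wpoly d F"
  shows "wpoly (d - 2) (Omega_op \<sigma> F)" and "d < 2 \<Longrightarrow> Omega_op \<sigma> F = (\<lambda>_. 0)"
proof -
  have 1: "wpoly (d - 2) (pd (Suc i) (pd (Suc i) F)) \<and> (d < 2 \<longrightarrow> pd (Suc i) (pd (Suc i) F) = (\<lambda>_. 0))" for i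
  proof (cases "Suc i \<le> d")
    case True
    hence w: "wpoly (d - Suc i) (pd (Suc i) F)" using wpoly_pd(1)[OF F] by simp
    show ?thesis
    proof (cases "Suc i \<le> d - Suc i")
      case True
      thus ?thesis using wpoly_pd(1)[OF w, of "Suc i"] by (auto elim: wpoly_mono)
    next
      case False
      thus ?thesis using wpoly_pd(2)[OF w] by (auto intro: wpoly_const)
    qed
  next
    case False
    thus ?thesis using wpoly_pd(2)[OF F] by (auto simp: pd_zero intro: wpoly_const)
  qed
  have 2: "wpoly (d - 2) (pd (2 * Suc i) F) \<and> (d < 2 \<longrightarrow> pd (2 * Suc i) F = (\<lambda>_. 0))" for i
    using wpoly_pd[OF F, of "2 * Suc i"] by (cases "2 * Suc i \<le> d") (auto intro: wpoly_mono wpoly_const)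
  have eq: "Omega_op \<sigma> F = (\<lambda>p. \<Sum>i<d. - (of_nat (Suc i) / 2) * pd (Suc i) (pd (Suc i) F) p +
    \<sigma> * pd (2 * Suc i) F p)"
    using Omega_finite[OF F order.refl] by (intro ext)
  show "wpoly (d - 2) (Omega_op \<sigma> F)"
    unfolding eq using 1 2 by (intro wpoly_sum wpoly.wpoly_add wpoly_cmult) blast+
  show "d < 2 \<Longrightarrow> Omega_op \<sigma> F = (\<lambda>_. 0)"
    unfolding eq using 1 2 by (simp del: mult_Suc_right)
qed

lemma Omega_zero: "Omega_op \<sigma> (\<lambda>_. 0) = (\<lambda>_. 0)"
  by (rule wpoly_Omega(2)[of 0]) (auto intro: wpoly_const)

lemma wpoly_Omega_funpow:
  assumes "wpoly d F"
  shows "wpoly (d - 2 * k) ((Omega_op \<sigma> ^^ k) F)" "d < 2 * k \<Longrightarrow> (Omega_op \<sigma> ^^ k) F = (\<lambda>_. 0)"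
proof (induction k)
  case (Suc k)
  case 1
  show ?case using wpoly_Omega(1)[OF Suc(1)] by simp
  case 2
  thus ?case using wpoly_Omega(2)[OF Suc(1)] Suc(2) Omega_zero by (cases "d < 2 * k") auto
qed (use assms in auto)

lemma exp_op_Omega_finite:
  assumes "wpoly d F"
  shows "exp_op (Omega_op \<sigma>) F p = (\<Sum>k\<le>d. (Omega_op \<sigma> ^^ k) F p / fact k)"
  unfolding exp_op_def by (rule suminf_finite) (use wpoly_Omega_funpow(2)[OF assms] in auto)

lemma Omega_funpow_linear:
  assumes F: "\<And>i. i \<in> I \<Longrightarrow> wpoly d (F i)"
  shows "(Omega_op \<sigma> ^^ k) (\<lambda>p. \<Sum>i\<in>I. c i * F i p) = (\<lambda>p. \<Sum>i\<in>I. c i * (Omega_op \<sigma> ^^ k) (F i) p)"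
proof (induction k)
  case (Suc k)
  have "wpoly d ((Omega_op \<sigma> ^^ k) (F i))" if "i \<in> I" for i
    by (rule wpoly_mono[OF wpoly_Omega_funpow(1)[OF F[OF that]]]) simp
  from Omega_linear[OF this] show ?case by (simp add: Suc)
qed simp

lemma exp_op_Omega_linear:
  assumes F: "\<And>i. i \<in> I \<Longrightarrow> wpoly d (F i)"
  shows "exp_op (Omega_op \<sigma>) (\<lambda>p. \<Sum>i\<in>I. c i * F i p) p = (\<Sum>i\<in>I. c i * exp_op (Omega_op \<sigma>) (F i) p)"
proof -
  have "wpoly d (\<lambda>p. \<Sum>i\<in>I. c i * F i p)" by (intro wpoly_sum wpoly_cmult F)
  hence "exp_op (Omega_op \<sigma>) (\<lambda>p. \<Sum>i\<in>I. c i * F i p) p =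
      (\<Sum>k\<le>d. \<Sum>i\<in>I. c i * ((Omega_op \<sigma> ^^ k) (F i) p / fact k))"
    by (simp add: exp_op_Omega_finite Omega_funpow_linear[OF F] sum_divide_distrib)
  also have "\<dots> = (\<Sum>i\<in>I. c i * (\<Sum>k\<le>d. (Omega_op \<sigma> ^^ k) (F i) p / fact k))"
    by (subst sum.swap) (simp add: sum_distrib_left)
  also have "\<dots> = (\<Sum>i\<in>I. c i * exp_op (Omega_op \<sigma>) (F i) p)"
    by (intro sum.cong refl) (simp only: exp_op_Omega_finite[OF F])
  finally show ?thesis .
qed

section \<open>Formal exponentials and the eigenvalues of the operators\<close>

text \<open>The difference of two solutions of \<open>W' = W U'\<close> with equal constant terms
  satisfies the same equation, and comparing coefficients determines each one from the lower ones,
  so all vanish. Exponentials can thus be identified without formal logarithms.\<close>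

lemma fps_exp_ode_unique:
  fixes U W :: "complex fps"
  assumes U0: "fps_nth U 0 = 0" and W0: "fps_nth W 0 = 1" and ode: "fps_deriv W = W * fps_deriv U"
  shows "fps_exp 1 oo U = W"
proof -
  define Z where "Z = (fps_exp 1 oo U) - W"
  have dZ: "fps_deriv Z = Z * fps_deriv U"
    using ode by (simp add: Z_def fps_compose_deriv[OF U0] algebra_simps)
  have "fps_nth Z k = 0" for k
  proof (induction k rule: less_induct)
    case (less k)
    show ?case
    proof (cases k)
      case 0
      thus ?thesis using W0 by (simp add: Z_def)
    next
      case (Suc j)
      have "of_nat (Suc j) * fps_nth Z (Suc j) = fps_nth (fps_deriv Z) j" by simp
      also have "\<dots> = (\<Sum>i=0..j. fps_nth Z i * fps_nth (fps_deriv U) (j - i))"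
        unfolding dZ by (rule fps_mult_nth)
      also have "\<dots> = 0" by (rule sum.neutral) (use less Suc in auto)
      finally show ?thesis using Suc by (simp del: of_nat_Suc)
    qed
  qed
  hence "Z = 0" by (intro fps_ext) simp
  thus ?thesis by (simp add: Z_def)
qed

lemma fps_exp_compose_add:
  fixes U V :: "complex fps"
  assumes "fps_nth U 0 = 0" "fps_nth V 0 = 0"
  shows "fps_exp 1 oo (U + V) = (fps_exp 1 oo U) * (fps_exp 1 oo V)"
  by (rule fps_exp_ode_unique) (use assms in \<open>auto simp: fps_compose_deriv algebra_simps\<close>)

lemma fps_exp_compose_sum:
  fixes U :: "'i \<Rightarrow> complex fps"
  assumes "\<And>i. i \<in> I \<Longrightarrow> fps_nth (U i) 0 = 0"
  shows "fps_exp 1 oo (\<Sum>i\<in>I. U i) = (\<Prod>i\<in>I. fps_exp 1 oo U i)"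
  using assms
  by (induction I rule: infinite_finite_induct) (auto simp: fps_exp_compose_add fps_sum_nth)

text \<open>With \<open>X m\<close> the power sums of numbers \<open>x_i\<close>, the series
  \<open>schur_fps (rescale X p)\<close> in t is the product of the
  \<open>exp V(x_i t, p)\<close>.\<close>

definition rescale :: "(nat \<Rightarrow> complex) \<Rightarrow> (nat \<Rightarrow> complex) \<Rightarrow> nat \<Rightarrow> complex" where
  "rescale X p = (\<lambda>m. p m * X m)"

lemma schur_fps_0 [simp]: "fps_nth (schur_fps p) 0 = 1"
  by (simp add: schur_fps_def)

text \<open>Newton's identity, read off from the logarithmic derivative of the generating function.
  Both polynomiality and differentiation in \<open>p\<close> are proved by induction along
  it.\<close>

lemma schur_fps_recursion:
  "of_nat (Suc d) * fps_nth (schur_fps p) (Suc d) =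
    (\<Sum>i\<le>d. p (Suc (d - i)) * fps_nth (schur_fps p) i)"
proof -
  have "fps_deriv (schur_fps p) = schur_fps p * fps_deriv (pot_fps p)"
    unfolding schur_fps_def by (subst fps_compose_deriv) (simp_all add: pot_fps_def)
  from arg_cong[OF this, of "\<lambda>f. fps_nth f d"] show ?thesis
    by (simp add: fps_mult_nth pot_fps_def atLeast0AtMost mult.commute del: of_nat_Suc)
qed

lemma wpoly_schur_fps: "wpoly d (\<lambda>p. fps_nth (schur_fps (rescale X p)) d)"
proof (induction d rule: less_induct)
  case (less d)
  show ?case
  proof (cases d)
    case 0
    thus ?thesis by (simp add: wpoly_const)
  next
    case (Suc e)
    have eq: "(\<lambda>p. fps_nth (schur_fps (rescale X p)) d) =
        (\<lambda>p. 1 / of_nat (Suc e) * (\<Sum>i\<le>e. X (Suc (e - i)) *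
          (p (Suc (e - i)) * fps_nth (schur_fps (rescale X p)) i)))"
      using schur_fps_recursion[of e] Suc
      by (auto simp: rescale_def field_simps simp del: of_nat_Suc)
    show ?thesis unfolding eq
    proof (intro wpoly_cmult wpoly_sum)
      fix i assume "i \<in> {..e}"
      thus "wpoly d (\<lambda>p. p (Suc (e - i)) * fps_nth (schur_fps (rescale X p)) i)"
        using Suc by (intro wpoly_var_mult[OF less]) auto
    qed
  qed
qed

text \<open>Formally, differentiating the exponential generating function in \<open>p m\<close>
  multiplies it by \<open>X m t^m / m\<close>. For single coefficients this follows by strong
  induction along Newton's recursion.\<close>

lemma schur_fps_has_derivative:
  assumes "1 \<le> m"
  shows "((\<lambda>t. fps_nth (schur_fps (rescale X (p(m := t)))) d) has_field_derivative
     (if m \<le> d then X m / of_nat m * fps_nth (schur_fps (rescale X p)) (d - m) else 0)) (at (p m))"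
proof (induction d rule: less_induct)
  case (less d)
  show ?case
  proof (cases d)
    case 0
    thus ?thesis using assms by simp
  next
    case (Suc e)
    let ?G = "\<lambda>p d. fps_nth (schur_fps (rescale X p)) d"
    let ?D = "\<lambda>i. if m \<le> i then X m / of_nat m * ?G p (i - m) else 0"
    have rec: "?G q (Suc e') = 1 / of_nat (Suc e') * (\<Sum>i\<le>e'. X (Suc (e' - i)) * (q (Suc (e' - i)) * ?G q i))"
      for q e'
      using schur_fps_recursion[of e' "rescale X q"]
      by (simp add: rescale_def field_simps del: of_nat_Suc)
    have var: "((\<lambda>t. (p(m := t)) k) has_field_derivative (if k = m then 1 else 0)) (at (p m))" for k
      by (cases "k = m") auto
    have step: "((\<lambda>t. X (Suc (e - i)) * ((p(m := t)) (Suc (e - i)) * ?G (p(m := t)) i)) has_field_derivative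
        X (Suc (e - i)) * ((if Suc (e - i) = m then 1 else 0) * ?G p i + ?D i * p (Suc (e - i)))) (at (p m))"
      if "i \<le> e" for i
      using DERIV_cmult[OF DERIV_mult[OF var[of "Suc (e - i)"] less[of i]], of "X (Suc (e - i))"] that Suc
      by (simp del: fun_upd_apply)
    have "((\<lambda>t. ?G (p(m := t)) (Suc e)) has_field_derivative 1 / of_nat (Suc e) *
        (\<Sum>i\<le>e. X (Suc (e - i)) * ((if Suc (e - i) = m then 1 else 0) * ?G p i + ?D i * p (Suc (e - i)))))
        (at (p m))"
      unfolding rec[of _ e] by (intro DERIV_cmult DERIV_sum step) simp
    moreover have "(\<Sum>i\<le>e. X (Suc (e - i)) * ((if Suc (e - i) = m then 1 else 0) * ?G p i + ?D i * p (Suc (e - i))))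
        = (if m \<le> Suc e then of_nat (Suc e) * (X m / of_nat m * ?G p (Suc e - m)) else 0)"
      (is "?L = ?R")
    proof -
      \<comment> \<open>The derivative hits either the explicit variable or the lower coefficient.
        The second part is again Newton's recursion, in degree \<open>Suc e - m\<close>; the weights
        \<open>m\<close> and \<open>Suc e - m\<close> add up to \<open>Suc e\<close>.\<close>
      have split: "?L = (\<Sum>i\<le>e. if Suc (e - i) = m then X m * ?G p i else 0) +
          (\<Sum>i\<le>e. if m \<le> i then X m / of_nat m * (X (Suc (e - i)) * (p (Suc (e - i)) * ?G p (i - m))) else 0)"
        unfolding sum.distrib[symmetric] by (intro sum.cong refl) (auto simp: algebra_simps)
      have s1: "(\<Sum>i\<le>e. if Suc (e - i) = m then X m * ?G p i else 0) =
          (if m \<le> Suc e then X m * ?G p (Suc e - m) else 0)"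
      proof (cases "m \<le> Suc e")
        case True
        have "(\<Sum>i\<le>e. if Suc (e - i) = m then X m * ?G p i else 0) =
            (\<Sum>i\<le>e. if i = Suc e - m then X m * ?G p i else 0)"
          using True assms by (intro sum.cong refl) auto
        thus ?thesis using True assms by simp
      next
        case False
        thus ?thesis by (intro trans[OF sum.neutral]) auto
      qed
      have s2: "(\<Sum>i\<le>e. if m \<le> i then X m / of_nat m * (X (Suc (e - i)) * (p (Suc (e - i)) * ?G p (i - m))) else 0)
          = (if m \<le> e then X m / of_nat m * (of_nat (Suc (e - m)) * ?G p (Suc (e - m))) else 0)"
      proof (cases "m \<le> e")
        case True
        have "(\<Sum>i\<le>e. if m \<le> i then X m / of_nat m * (X (Suc (e - i)) * (p (Suc (e - i)) * ?G p (i - m))) else 0)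
            = (\<Sum>i\<in>{m..e}. X m / of_nat m * (X (Suc (e - i)) * (p (Suc (e - i)) * ?G p (i - m))))"
          by (subst sum.inter_filter[symmetric]) (auto intro!: sum.cong)
        also have "\<dots> = (\<Sum>i\<le>e - m. X m / of_nat m * (X (Suc (e - m - i)) * (p (Suc (e - m - i)) * ?G p i)))"
          using True by (intro sum.reindex_bij_witness[of _ "\<lambda>i. i + m" "\<lambda>i. i - m"]) auto
        also have "\<dots> = X m / of_nat m * (of_nat (Suc (e - m)) * ?G p (Suc (e - m)))"
          unfolding rec[of p "e - m"] by (simp add: sum_distrib_left del: of_nat_Suc)
        finally show ?thesis using True by simp
      next
        case False
        thus ?thesis by (intro trans[OF sum.neutral]) auto
      qed
      show ?thesis
      proof (cases "m \<le> e")
        case True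
        have "of_nat (Suc (e - m)) = (of_nat (Suc e) - of_nat m :: complex)"
          using True by (simp add: of_nat_diff)
        thus ?thesis
          using True assms unfolding split s1 s2 by (simp add: Suc_diff_le field_simps)
      next
        case False
        thus ?thesis using assms unfolding split s1 s2 by (auto simp: not_le le_Suc_eq simp del: of_nat_Suc)
      qed
    qed
    ultimately show ?thesis using Suc by (auto simp del: of_nat_Suc fun_upd_apply)
  qed
qed

lemma pd_schur_fps:
  assumes "1 \<le> m"
  shows "pd m (\<lambda>p. fps_nth (schur_fps (rescale X p)) d) =
    (\<lambda>p. if m \<le> d then X m / of_nat m * fps_nth (schur_fps (rescale X p)) (d - m) else 0)"
  by (rule pd_eqI) (rule schur_fps_has_derivative[OF assms])

lemma pd_cmult:
  assumes "wpoly d F" "1 \<le> m"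
  shows "pd m (\<lambda>p. c * F p) = (\<lambda>p. c * pd m F p)"
  using pd_linear[of "{()}" d "\<lambda>_. F" m "\<lambda>_. c"] assms by simp

text \<open>The eigenvalue of the operator on \<open>exp (\<Sum>m. p\<^sub>m X\<^sub>m t\<^sup>m / m)\<close>, as a power series in \<open>t\<close>.\<close>
definition Omega_symbol :: "complex \<Rightarrow> (nat \<Rightarrow> complex) \<Rightarrow> complex fps" where
  "Omega_symbol \<sigma> X = Abs_fps (\<lambda>k. if even k \<and> 0 < k
     then (\<sigma> * X k - (X (k div 2))\<^sup>2) / of_nat k else 0)"

text \<open>As \<open>pd m\<close> acts by multiplication with \<open>X m t^m / m\<close>, the
  second-order term contributes \<open>- (X m)^2 t^(2m) / (2m)\<close> and the first-order term
  \<open>\<sigma> X (2m) t^(2m) / (2m)\<close>. Their sum is the coefficient of the symbol at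
  \<open>k = 2m\<close>.\<close>

lemma Omega_schur_fps:
  "Omega_op \<sigma> (\<lambda>p. fps_nth (schur_fps (rescale X p)) d) =
    (\<lambda>p. fps_nth (Omega_symbol \<sigma> X * schur_fps (rescale X p)) d)"
proof
  fix p
  let ?G = "\<lambda>p d. fps_nth (schur_fps (rescale X p)) d"
  have pd2: "pd m (pd m (\<lambda>p. ?G p d)) =
      (\<lambda>p. if 2 * m \<le> d then (X m / of_nat m)\<^sup>2 * ?G p (d - 2 * m) else 0)" if m: "1 \<le> m" for m
  proof (cases "m \<le> d")
    case True
    hence "pd m (pd m (\<lambda>p. ?G p d)) = pd m (\<lambda>p. X m / of_nat m * ?G p (d - m))"
      by (simp add: pd_schur_fps[OF m])
    also have "\<dots> = (\<lambda>p. X m / of_nat m * pd m (\<lambda>p. ?G p (d - m)) p)"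
      by (rule pd_cmult[OF wpoly_schur_fps m])
    also have "\<dots> = (\<lambda>p. if 2 * m \<le> d then (X m / of_nat m)\<^sup>2 * ?G p (d - 2 * m) else 0)"
    proof
      fix p
      have "m \<le> d - m \<longleftrightarrow> 2 * m \<le> d" "d - m - m = d - 2 * m" using True by auto
      thus "X m / of_nat m * pd m (\<lambda>p. ?G p (d - m)) p =
          (if 2 * m \<le> d then (X m / of_nat m)\<^sup>2 * ?G p (d - 2 * m) else 0)"
        by (simp add: pd_schur_fps[OF m] power2_eq_square)
    qed
    finally show ?thesis .
  next
    case False
    thus ?thesis by (auto simp: pd_schur_fps[OF m] pd_zero)
  qed
  have summand: "- (of_nat (Suc i) / 2) * pd (Suc i) (pd (Suc i) (\<lambda>p. ?G p d)) p +
      \<sigma> * pd (2 * Suc i) (\<lambda>p. ?G p d) p =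
      (if 2 * Suc i \<le> d then fps_nth (Omega_symbol \<sigma> X) (2 * Suc i) * ?G p (d - 2 * Suc i) else 0)" for i
  proof -
    have "pd (2 * Suc i) (\<lambda>p. ?G p d) = (\<lambda>p. if 2 * Suc i \<le> d then
        X (2 * Suc i) / of_nat (2 * Suc i) * ?G p (d - 2 * Suc i) else 0)"
      by (rule pd_schur_fps) simp
    moreover have "fps_nth (Omega_symbol \<sigma> X) (2 * Suc i) =
        (\<sigma> * X (2 * Suc i) - (X (Suc i))\<^sup>2) / of_nat (2 * Suc i)"
      unfolding Omega_symbol_def fps_nth_Abs_fps by (simp del: mult_Suc_right of_nat_Suc)
    moreover have "of_nat (2 * Suc i) = (2 * of_nat (Suc i) :: complex)" "of_nat (Suc i) \<noteq> (0 :: complex)"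
      by (simp_all del: of_nat_Suc mult_Suc_right)
    ultimately show ?thesis
      by (simp only: pd2[of "Suc i"]) (simp add: field_simps power2_eq_square del: mult_Suc_right of_nat_Suc)
  qed
  have "Omega_op \<sigma> (\<lambda>p. ?G p d) p =
      (\<Sum>i<d. if 2 * Suc i \<le> d then fps_nth (Omega_symbol \<sigma> X) (2 * Suc i) * ?G p (d - 2 * Suc i) else 0)"
    unfolding Omega_finite[OF wpoly_schur_fps order.refl] summand ..
  also have "\<dots> = (\<Sum>i\<in>{i. i < d \<and> 2 * Suc i \<le> d}. fps_nth (Omega_symbol \<sigma> X) (2 * Suc i) * ?G p (d - 2 * Suc i))"
    by (subst sum.inter_filter[symmetric]) (auto intro!: sum.cong)
  also have "\<dots> = (\<Sum>k\<in>{k. k \<le> d \<and> even k \<and> 0 < k}. fps_nth (Omega_symbol \<sigma> X) k * ?G p (d - k))"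
    by (rule sum.reindex_bij_witness[of _ "\<lambda>k. k div 2 - 1" "\<lambda>i. 2 * Suc i"]) (auto elim!: evenE)
  also have "\<dots> = (\<Sum>k=0..d. fps_nth (Omega_symbol \<sigma> X) k * ?G p (d - k))"
    by (rule sum.mono_neutral_left) (auto simp: Omega_symbol_def)
  also have "\<dots> = fps_nth (Omega_symbol \<sigma> X * schur_fps (rescale X p)) d"
    by (simp add: fps_mult_nth)
  finally show "Omega_op \<sigma> (\<lambda>p. ?G p d) p = \<dots>" .
qed

lemma Omega_funpow_schur_fps:
  "(Omega_op \<sigma> ^^ k) (\<lambda>p. fps_nth (schur_fps (rescale X p)) d) =
    (\<lambda>p. fps_nth (Omega_symbol \<sigma> X ^ k * schur_fps (rescale X p)) d)"
proof (induction k)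
  case (Suc k)
  let ?U = "Omega_symbol \<sigma> X"
  have "(Omega_op \<sigma> ^^ Suc k) (\<lambda>p. fps_nth (schur_fps (rescale X p)) d) =
      Omega_op \<sigma> (\<lambda>p. \<Sum>i\<in>{0..d}. fps_nth (?U ^ k) i * fps_nth (schur_fps (rescale X p)) (d - i))"
    by (simp add: Suc fps_mult_nth)
  also have "\<dots> = (\<lambda>p. \<Sum>i\<in>{0..d}. fps_nth (?U ^ k) i *
      Omega_op \<sigma> (\<lambda>p. fps_nth (schur_fps (rescale X p)) (d - i)) p)"
    by (rule Omega_linear[of _ d]) (auto intro: wpoly_mono[OF wpoly_schur_fps])
  also have "\<dots> = (\<lambda>p. fps_nth (?U ^ k * (?U * schur_fps (rescale X p))) d)"
    unfolding Omega_schur_fps fps_mult_nth[of "?U ^ k"] ..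
  finally show ?case by (simp add: mult_ac)
qed simp

text \<open>The symbol has no constant term, so its powers beyond the \<open>d\<close>-th do not
  reach degree \<open>d\<close>. There the finite operator exponential and the formal exponential
  agree.\<close>

lemma exp_op_schur_fps:
  "exp_op (Omega_op \<sigma>) (\<lambda>p. fps_nth (schur_fps (rescale X p)) d) p =
    fps_nth ((fps_exp 1 oo Omega_symbol \<sigma> X) * schur_fps (rescale X p)) d"
proof -
  let ?U = "Omega_symbol \<sigma> X" and ?S = "schur_fps (rescale X p)"
  have U0: "fps_nth ?U 0 = 0" by (simp add: Omega_symbol_def)
  have "fps_nth (fps_exp 1 oo ?U) i = (\<Sum>k\<le>d. fps_nth (?U ^ k) i / fact k)" if "i \<le> d" for i
  proof -
    have "fps_nth (fps_exp 1 oo ?U) i = (\<Sum>k=0..i. fps_nth (?U ^ k) i / fact k)"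
      by (simp add: fps_compose_nth)
    also have "\<dots> = (\<Sum>k\<le>d. fps_nth (?U ^ k) i / fact k)"
      by (rule sum.mono_neutral_left) (use that startsby_zero_power_prefix[OF U0] in auto)
    finally show ?thesis .
  qed
  hence "fps_nth ((fps_exp 1 oo ?U) * ?S) d =
      (\<Sum>i=0..d. (\<Sum>k\<le>d. fps_nth (?U ^ k) i / fact k) * fps_nth ?S (d - i))"
    by (simp add: fps_mult_nth)
  also have "\<dots> = (\<Sum>k\<le>d. (\<Sum>i=0..d. fps_nth (?U ^ k) i * fps_nth ?S (d - i)) / fact k)"
    by (simp add: sum_distrib_right sum_divide_distrib) (rule sum.swap)
  also have "\<dots> = exp_op (Omega_op \<sigma>) (\<lambda>p. fps_nth (schur_fps (rescale X p)) d) p"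
    by (simp add: exp_op_Omega_finite[OF wpoly_schur_fps] Omega_funpow_schur_fps fps_mult_nth)
  finally show ?thesis ..
qed

text \<open>The inner series is \<open>log (1 - c t^2)\<close> with the summation index written as
  \<open>k = 2j\<close>. In the differential equation, multiplying its derivative by
  \<open>1 - c t^2\<close> cancels all but the linear term.\<close>

lemma fps_exp_compose_log:
  fixes c :: complex
  shows "fps_exp 1 oo Abs_fps (\<lambda>k. if even k \<and> 0 < k then - 2 * c ^ (k div 2) / of_nat k else 0) =
    1 - fps_const c * fps_X\<^sup>2" (is "_ oo ?L = ?R")
proof (rule fps_exp_ode_unique)
  have dL: "fps_nth (fps_deriv ?L) k = (if odd k then - 2 * c ^ (Suc k div 2) else 0)" for k
    by (simp add: field_simps del: of_nat_Suc)
  have dR: "fps_deriv ?R = - (fps_const (2 * c) * fps_X)"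
  proof -
    have "fps_const (2 * c) = fps_const c + fps_const c" by simp
    moreover have "fps_deriv ?R = - (fps_const c * (fps_X + fps_X))"
      by (simp add: power2_eq_square)
    ultimately show ?thesis by (simp only: distrib_left distrib_right)
  qed
  have "?R * fps_deriv ?L = fps_deriv ?L - fps_const c * (fps_X\<^sup>2 * fps_deriv ?L)"
    by (simp only: left_diff_distrib mult_1_left mult.assoc)
  also have "\<dots> = - (fps_const (2 * c) * fps_X)"
  proof (rule fps_ext)
    fix k :: nat
    consider "k = 0" | "k = 1" | j where "k = j + 2"
      by (metis One_nat_def add_2_eq_Suc' not0_implies_Suc)
    thus "fps_nth (fps_deriv ?L - fps_const c * (fps_X\<^sup>2 * fps_deriv ?L)) k =
        fps_nth (- (fps_const (2 * c) * fps_X)) k"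
    proof cases
      case (3 j)
      have "fps_nth (fps_X\<^sup>2 * fps_deriv ?L) k = fps_nth (fps_deriv ?L) j"
        unfolding fps_X_power_mult_nth using 3 by simp
      thus ?thesis unfolding fps_sub_nth fps_mult_left_const_nth dL using 3 by (simp add: fps_X_def)
    qed (simp_all only: fps_sub_nth fps_mult_left_const_nth dL fps_X_power_mult_nth, simp_all)
  qed
  finally show "fps_deriv ?R = ?R * fps_deriv ?L" using dR by simp
qed simp_all

lemma sum_square: "(\<Sum>i<n. a i)\<^sup>2 = (\<Sum>i<n. (a i)\<^sup>2) + 2 * (\<Sum>j<n. \<Sum>i<j. a i * a j)"
  for a :: "nat \<Rightarrow> complex"
  by (induction n) (simp_all add: power2_eq_square algebra_simps sum_distrib_left)

text \<open>By \<open>sum_square\<close>, the square of \<open>X (k div 2)\<close> is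
  \<open>X k\<close> plus twice the sum of \<open>(x i * x j) ^ (k div 2)\<close> over pairs. For
  \<open>\<sigma> = 1\<close> the diagonal \<open>X k\<close> cancels and the logarithms of
  \<open>1 - x_i x_j t^2\<close> remain; for \<open>\<sigma> = -1\<close> it doubles and adds the
  logarithms of \<open>1 - x_i^2 t^2\<close>.\<close>

lemma exp_Omega_symbol:
  fixes x :: "nat \<Rightarrow> complex" and n :: nat
  defines "X \<equiv> \<lambda>m. \<Sum>i<n. x i ^ m"
  shows "fps_exp 1 oo Omega_symbol 1 X = (\<Prod>j<n. \<Prod>i<j. 1 - fps_const (x i * x j) * fps_X\<^sup>2)"
    and "fps_exp 1 oo Omega_symbol (- 1) X =
      (\<Prod>j<n. \<Prod>i<j. 1 - fps_const (x i * x j) * fps_X\<^sup>2) * (\<Prod>i<n. 1 - fps_const ((x i)\<^sup>2) * fps_X\<^sup>2)"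
proof -
  define L where "L c = Abs_fps (\<lambda>k. if even k \<and> 0 < k then - 2 * c ^ (k div 2) / of_nat k else 0)"
    for c :: complex
  have L0: "fps_nth (L c) 0 = 0" for c by (simp add: L_def)
  have L: "fps_exp 1 oo L c = 1 - fps_const c * fps_X\<^sup>2" for c
    unfolding L_def by (rule fps_exp_compose_log)
  have sq: "(X (k div 2))\<^sup>2 = X k + 2 * (\<Sum>j<n. \<Sum>i<j. (x i * x j) ^ (k div 2))" if "even k" for k
    unfolding X_def sum_square using that by (simp add: power_mult[symmetric] power_mult_distrib)
  have 1: "Omega_symbol 1 X = (\<Sum>j<n. \<Sum>i<j. L (x i * x j))"
    by (rule fps_ext) (auto simp: Omega_symbol_def L_def fps_sum_nth sq sum_negf sum_divide_distrib sum_distrib_left)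
  have 2: "Omega_symbol (- 1) X = (\<Sum>j<n. \<Sum>i<j. L (x i * x j)) + (\<Sum>i<n. L ((x i)\<^sup>2))"
  proof (rule fps_ext)
    fix k
    have "(\<Sum>i<n. 2 * ((x i)\<^sup>2) ^ (k div 2)) = 2 * X k" if "even k"
      using that by (simp add: X_def power_mult[symmetric] sum_distrib_left)
    thus "fps_nth (Omega_symbol (- 1) X) k = fps_nth ((\<Sum>j<n. \<Sum>i<j. L (x i * x j)) + (\<Sum>i<n. L ((x i)\<^sup>2))) k"
      by (auto simp: Omega_symbol_def L_def fps_sum_nth sq sum_negf sum_divide_distrib[symmetric]
          sum_distrib_left[symmetric] field_simps)
  qed
  show "fps_exp 1 oo Omega_symbol 1 X = (\<Prod>j<n. \<Prod>i<j. 1 - fps_const (x i * x j) * fps_X\<^sup>2)"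
    unfolding 1 by (simp add: fps_exp_compose_sum fps_sum_nth L0 L)
  show "fps_exp 1 oo Omega_symbol (- 1) X =
      (\<Prod>j<n. \<Prod>i<j. 1 - fps_const (x i * x j) * fps_X\<^sup>2) * (\<Prod>i<n. 1 - fps_const ((x i)\<^sup>2) * fps_X\<^sup>2)"
    unfolding 2 by (simp add: fps_exp_compose_add fps_exp_compose_sum fps_sum_nth L0 L)
qed

section \<open>Determinantal formulas for the characters\<close>

lemma fps_nth_prod_lessThan:
  fixes f :: "nat \<Rightarrow> 'a :: comm_ring_1 fps"
  shows "fps_nth (\<Prod>i<n. f i) d = (\<Sum>h\<in>natpermute d n. \<Prod>i<n. fps_nth (f i) (h ! i))"
proof (cases n)
  case 0
  thus ?thesis by (simp add: natpermute_0)
next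
  case (Suc m)
  have "{..<n} = {0..m}" using Suc by auto
  thus ?thesis using Suc fps_prod_nth[of f m d] by simp
qed

text \<open>Row \<open>i\<close> is evaluated at \<open>x i * t\<close>, so the coefficient of
  \<open>t^d\<close> is the part of degree \<open>d\<close> in the \<open>x i\<close>. The exponent
  vectors in \<open>natpermute d n\<close> may be unordered or have repeated entries.\<close>

lemma fps_nth_detf_rescaled:
  fixes A :: "nat \<Rightarrow> complex fps"
  shows "fps_nth (detf n (\<lambda>i j. A j oo (fps_const (x i) * fps_X))) d =
    (\<Sum>h\<in>natpermute d n. (\<Prod>i<n. x i ^ (h ! i)) * detf n (\<lambda>i j. fps_nth (A j) (h ! i)))"
proof -
  have "fps_nth (detf n (\<lambda>i j. A j oo (fps_const (x i) * fps_X))) d =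
      (\<Sum>p | p permutes {..<n}. \<Sum>h\<in>natpermute d n. (\<Prod>i<n. x i ^ (h ! i)) *
        (signof p * (\<Prod>i<n. fps_nth (A (p i)) (h ! i))))"
    unfolding detf_leibniz fps_sum_nth fps_mult_of_int_nth fps_nth_prod_lessThan sum_distrib_left
    by (intro sum.cong refl, simp only: fps_compose_linear fps_nth_Abs_fps prod.distrib)
       (simp only: mult_ac)
  also have "\<dots> = (\<Sum>h\<in>natpermute d n. (\<Prod>i<n. x i ^ (h ! i)) * detf n (\<lambda>i j. fps_nth (A j) (h ! i)))"
    unfolding detf_leibniz sum_distrib_left by (rule sum.swap)
  finally show ?thesis .
qed

text \<open>With the other variables fixed, the sum is a polynomial in the first one that vanishes
  on an infinite field. Hence each group of terms with the same first exponent vanishes by itself,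
  and induction on \<open>n\<close> applies to it.\<close>

lemma multivariate_coeffs_zero:
  fixes c :: "nat list \<Rightarrow> complex"
  assumes "finite V" "\<And>v. v \<in> V \<Longrightarrow> length v = n"
    and "\<And>x :: nat \<Rightarrow> complex. (\<Sum>v\<in>V. c v * (\<Prod>i<n. x i ^ (v ! i))) = 0"
    and "v \<in> V"
  shows "c v = 0"
  using assms
proof (induction n arbitrary: V c v)
  case 0
  hence "V = {[]}" by auto
  with "0.prems" show ?case by simp
next
  case (Suc n)
  define k where "k = hd v"
  define W where "W = {w \<in> V. hd w = k}"
  have cons: "v = hd v # tl v" "length (tl v) = n" if "v \<in> V" for v
    using Suc.prems(2)[OF that] by (cases v; simp)+
  have zero: "(\<Sum>v\<in>W. c v * (\<Prod>i<n. x i ^ (tl v ! i))) = 0" for x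
  proof -
    define P where "P = (\<Sum>v\<in>V. monom (c v * (\<Prod>i<n. x i ^ (tl v ! i))) (hd v))"
    have "poly P y = 0" for y
    proof -
      have "poly P y = (\<Sum>v\<in>V. c v * (\<Prod>i<Suc n. (case_nat y x) i ^ (v ! i)))"
        unfolding P_def poly_sum
      proof (rule sum.cong[OF refl])
        fix v assume "v \<in> V"
        from cons(1)[OF this] obtain a w where "v = a # w" by metis
        thus "poly (monom (c v * (\<Prod>i<n. x i ^ (tl v ! i))) (hd v)) y =
            c v * (\<Prod>i<Suc n. (case_nat y x) i ^ (v ! i))"
          by (simp add: poly_monom prod.lessThan_Suc_shift mult_ac del: prod.lessThan_Suc)
      qed
      thus ?thesis using Suc.prems(3) by simp
    qed
    hence "P = 0" by (intro poly_all_0_iff_0[THEN iffD1]) auto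
    hence "coeff P k = 0" by simp
    thus ?thesis
      using Suc.prems(1) by (simp add: P_def W_def coeff_sum sum.inter_filter)
  qed
  have Wcons: "w = k # tl w" if "w \<in> W" for w
    using cons(1)[of w] that by (simp add: W_def)
  have inj: "inj_on tl W"
  proof (rule inj_onI)
    fix u w assume "u \<in> W" "w \<in> W" "tl u = tl w"
    thus "u = w" using Wcons[of u] Wcons[of w] by simp
  qed
  have "(\<lambda>w. c (k # w)) (tl v) = 0"
  proof (rule Suc.IH[of "tl ` W" "\<lambda>w. c (k # w)" "tl v"])
    fix x :: "nat \<Rightarrow> complex"
    have "(\<Sum>w\<in>tl ` W. c (k # w) * (\<Prod>i<n. x i ^ (w ! i))) =
        (\<Sum>v\<in>W. c v * (\<Prod>i<n. x i ^ (tl v ! i)))"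
      unfolding sum.reindex[OF inj] o_def
    proof (rule sum.cong[OF refl])
      fix w assume "w \<in> W"
      from Wcons[OF this] show "c (k # tl w) * (\<Prod>i<n. x i ^ (tl w ! i)) =
          c w * (\<Prod>i<n. x i ^ (tl w ! i))" by simp
    qed
    thus "(\<Sum>w\<in>tl ` W. c (k # w) * (\<Prod>i<n. x i ^ (w ! i))) = 0" using zero[of x] by simp
  qed (use Suc.prems cons in \<open>auto simp: W_def k_def\<close>)
  thus ?case using Wcons[of v] Suc.prems(4) by (simp add: W_def k_def)
qed

lemma schur_fps_rescaled_prod:
  "(\<Prod>i<n. schur_fps p oo (fps_const (x i) * fps_X)) = schur_fps (rescale (\<lambda>m. \<Sum>i<n. x i ^ m) p)"
proof -
  have "schur_fps p oo (fps_const c * fps_X) = fps_exp 1 oo (pot_fps p oo (fps_const c * fps_X))" for c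
    unfolding schur_fps_def by (rule fps_compose_assoc[symmetric]) (simp_all add: pot_fps_def)
  hence "(\<Prod>i<n. schur_fps p oo (fps_const (x i) * fps_X)) =
      fps_exp 1 oo (\<Sum>i<n. pot_fps p oo (fps_const (x i) * fps_X))"
    by (subst fps_exp_compose_sum) (auto simp: pot_fps_def)
  also have "(\<Sum>i<n. pot_fps p oo (fps_const (x i) * fps_X)) = pot_fps (rescale (\<lambda>m. \<Sum>i<n. x i ^ m) p)"
    by (rule fps_ext, simp add: fps_sum_nth fps_compose_linear pot_fps_def rescale_def sum_distrib_left
          sum_divide_distrib) (simp add: mult.commute)
  finally show ?thesis by (simp add: schur_fps_def)
qed

text \<open>The Jacobi-Trudi determinant written through \<open>h\<close> instead of the partition.
  It makes sense for every list, as the generating function requires.\<close>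

definition schur_det :: "nat list \<Rightarrow> (nat \<Rightarrow> complex) \<Rightarrow> complex" where
  "schur_det h p = detf (length h)
     (\<lambda>i j. fps_nth (fps_X ^ (length h - Suc j) * schur_fps p) (h ! i))"

lemma strict_seqs_nth_ge:
  assumes "h \<in> strict_seqs n" "i + d < n"
  shows "d \<le> h ! i"
  using assms(2)
proof (induction d arbitrary: i)
  case (Suc d)
  have "d \<le> h ! Suc i" using Suc by simp
  moreover have "h ! Suc i < h ! i"
    using assms(1) Suc.prems by (auto simp: strict_seqs_def sorted_wrt_iff_nth_less)
  ultimately show ?case by simp
qed simp

lemma schur_shape:
  assumes "h \<in> strict_seqs n"
  shows "schur (shape h) = schur_det h"
proof
  fix p
  have n: "length h = n" using assms by (simp add: strict_seqs_def)
  show "schur (shape h) p = schur_det h p"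
    unfolding schur_def schur_det_def n
  proof -
    have len: "length (shape h) = n" using n by (simp add: shape_def)
    show "detf (length (shape h)) (\<lambda>i j. schur_row (int (shape h ! i) - int i + int j) p) =
        detf n (\<lambda>i j. fps_nth (fps_X ^ (n - Suc j) * schur_fps p) (h ! i))"
      unfolding len
    proof (rule detf_cong)
      fix i j assume ij: "i < n" "j < n"
      have "n \<le> h ! i + i + 1" using strict_seqs_nth_ge[OF assms, of i "n - Suc i"] ij by simp
      hence "int (shape h ! i) - int i + int j = int (h ! i) - int (n - Suc j)"
        using ij n by (simp add: shape_def of_nat_diff)
      \<comment> \<open>A negative index of \<open>schur_row\<close> is a coefficient below the
        order of \<open>fps_X ^ (n - Suc j)\<close>; both are zero.\<close>
      thus "schur_row (int (shape h ! i) - int i + int j) p =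
          fps_nth (fps_X ^ (n - Suc j) * schur_fps p) (h ! i)"
        by (auto simp: schur_row_def fps_X_power_mult_nth schur_fps_def pot_fps_def nat_diff_distrib)
    qed
  qed
qed

text \<open>The bound is coarse but common to all of \<open>natpermute d n\<close>, as linearity of
  the operator exponential on the generating sum asks for.\<close>

lemma wpoly_schur_det:
  assumes "h \<in> natpermute d n"
  shows "wpoly (n * d) (schur_det h)"
proof -
  have len: "length h = n" using assms by (simp add: natpermute_def)
  have le: "h ! i \<le> d" if "i < n" for i
    using assms that member_le_sum_list[of "h ! i" h] by (auto simp: natpermute_def)
  have "wpoly d (\<lambda>p. fps_nth (fps_X ^ k * schur_fps p) (h ! i))" if "i < n" for i k
  proof (cases "h ! i < k")
    case False
    have "wpoly (h ! i - k) (\<lambda>p. fps_nth (schur_fps (rescale (\<lambda>_. 1) p)) (h ! i - k))"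
      by (rule wpoly_schur_fps)
    moreover have "rescale (\<lambda>_. 1) p = p" for p by (simp add: rescale_def)
    ultimately show ?thesis
      using False le[OF that] by (auto simp: fps_X_power_mult_nth intro: wpoly_mono)
  qed (simp add: fps_X_power_mult_nth wpoly_const)
  hence "wpoly (n * d) (\<lambda>p. \<Sum>q | q permutes {..<n}. signof q *
      (\<Prod>i<n. fps_nth (fps_X ^ (n - Suc (q i)) * schur_fps p) (h ! i)))"
    by (intro wpoly_sum wpoly_cmult wpoly_prod)
  moreover have "schur_det h = (\<lambda>p. \<Sum>q | q permutes {..<n}. signof q *
      (\<Prod>i<n. fps_nth (fps_X ^ (n - Suc (q i)) * schur_fps p) (h ! i)))"
    unfolding schur_det_def len detf_leibniz ..
  ultimately show ?thesis by (simp only:)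
qed

text \<open>Both sides are compared through the generating polynomial in numerical variables
  \<open>x\<^sub>0, \<dots>, x\<^bsub>n-1\<^esub>\<close>: the operator multiplies the generating function of the Schur
  determinants by \<open>\<Prod>i<j. 1 - x\<^sub>i x\<^sub>j\<close> (times factors depending on a single variable), which turns
  the Vandermonde determinant of the \<open>x\<^sub>i\<close> into the homogeneous one of the pairs
  \<open>(x\<^sub>i, 1 + x\<^sub>i\<^sup>2)\<close>.\<close>
lemma exp_op_schur_det:
  fixes K :: "complex fps"
  assumes symbol: "\<And>(x :: nat \<Rightarrow> complex) (n :: nat). fps_exp 1 oo Omega_symbol \<sigma> (\<lambda>m. \<Sum>i<n. x i ^ m) =
      (\<Prod>j<n. \<Prod>i<j. 1 - fps_const (x i * x j) * fps_X\<^sup>2) * (\<Prod>i<n. K oo (fps_const (x i) * fps_X))"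
    and h: "length h = n"
  shows "exp_op (Omega_op \<sigma>) (schur_det h) p =
    detf n (\<lambda>i j. fps_nth (fps_X ^ (n - Suc j) * (1 + fps_X\<^sup>2) ^ j * K * schur_fps p) (h ! i))"
    (is "_ = ?R h")
proof -
  \<comment> \<open>Fixing the total degree keeps the family of exponent vectors finite; the
    identity is then proved for the whole family at once.\<close>
  define d where "d = sum_list h"
  have hd: "h \<in> natpermute d n" using h by (simp add: natpermute_def d_def)
  have "exp_op (Omega_op \<sigma>) (schur_det h) p - ?R h = 0"
  proof (rule multivariate_coeffs_zero[of "natpermute d n" n "\<lambda>h. exp_op (Omega_op \<sigma>) (schur_det h) p - ?R h"])
    fix x :: "nat \<Rightarrow> complex"
    define y where "y i = fps_const (x i) * fps_X" for i
    define X where "X = (\<lambda>m. \<Sum>i<n. x i ^ m)"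
    define Vd where "Vd = detf n (\<lambda>i j. y i ^ (n - Suc j))"
    have y0: "fps_nth (y i) 0 = 0" for i by (simp add: y_def)
    have cX: "(fps_X ^ k) oo y i = y i ^ k" for k i
      by (simp add: fps_compose_power[OF y0, symmetric] fps_X_fps_compose_startby0[OF y0])
    have prodS: "(\<Prod>i<n. schur_fps p oo y i) = schur_fps (rescale X p)" for p
      unfolding y_def X_def by (rule schur_fps_rescaled_prod)
    have gen: "(\<Sum>h\<in>natpermute d n. (\<Prod>i<n. x i ^ (h ! i)) * schur_det h p) =
        (\<Sum>i\<in>{0..d}. fps_nth Vd i * fps_nth (schur_fps (rescale X p)) (d - i))" for p
    proof -
      have "(\<Sum>h\<in>natpermute d n. (\<Prod>i<n. x i ^ (h ! i)) * schur_det h p) =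
          fps_nth (detf n (\<lambda>i j. (fps_X ^ (n - Suc j) * schur_fps p) oo y i)) d"
        unfolding y_def fps_nth_detf_rescaled
        by (intro sum.cong refl) (simp add: schur_det_def natpermute_def)
      also have "detf n (\<lambda>i j. (fps_X ^ (n - Suc j) * schur_fps p) oo y i) =
          detf n (\<lambda>i j. (schur_fps p oo y i) * y i ^ (n - Suc j))"
        by (simp add: fps_compose_mult_distrib[OF y0] cX mult.commute)
      also have "\<dots> = Vd * schur_fps (rescale X p)"
        unfolding detf_scale_rows prodS Vd_def by (rule mult.commute)
      finally show ?thesis by (simp add: fps_mult_nth)
    qed
    have "(\<Sum>h\<in>natpermute d n. (\<Prod>i<n. x i ^ (h ! i)) * exp_op (Omega_op \<sigma>) (schur_det h) p) =
        exp_op (Omega_op \<sigma>) (\<lambda>p. \<Sum>h\<in>natpermute d n. (\<Prod>i<n. x i ^ (h ! i)) * schur_det h p) p"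
      by (rule exp_op_Omega_linear[symmetric]) (rule wpoly_schur_det)
    also have "\<dots> = (\<Sum>i\<in>{0..d}. fps_nth Vd i *
        exp_op (Omega_op \<sigma>) (\<lambda>p. fps_nth (schur_fps (rescale X p)) (d - i)) p)"
      unfolding gen by (rule exp_op_Omega_linear[of _ d]) (auto intro: wpoly_mono[OF wpoly_schur_fps])
    also have "\<dots> = fps_nth (Vd * ((fps_exp 1 oo Omega_symbol \<sigma> X) * schur_fps (rescale X p))) d"
      unfolding exp_op_schur_fps fps_mult_nth[of Vd] ..
    also have "Vd * ((fps_exp 1 oo Omega_symbol \<sigma> X) * schur_fps (rescale X p)) =
        (Vd * (\<Prod>j<n. \<Prod>i<j. 1 - y i * y j)) * (\<Prod>i<n. K oo y i) * (\<Prod>i<n. schur_fps p oo y i)"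
    proof -
      have "y i * y j = fps_const (x i * x j) * fps_X\<^sup>2" for i j
        by (simp add: y_def power2_eq_square mult_ac flip: fps_const_mult)
      moreover have "fps_exp 1 oo Omega_symbol \<sigma> X =
          (\<Prod>j<n. \<Prod>i<j. 1 - fps_const (x i * x j) * fps_X\<^sup>2) * (\<Prod>i<n. K oo y i)"
        unfolding X_def y_def by (rule symbol)
      ultimately show ?thesis unfolding prodS by (simp only: mult_ac)
    qed
    also have "Vd * (\<Prod>j<n. \<Prod>i<j. 1 - y i * y j) = detf n (\<lambda>i j. y i ^ (n - Suc j) * (1 + (y i)\<^sup>2) ^ j)"
    proof -
      have "detf n (\<lambda>i j. y i ^ (n - Suc j) * (1 + (y i)\<^sup>2) ^ j) =
          (\<Prod>j<n. \<Prod>i<j. y i * (1 + (y j)\<^sup>2) - y j * (1 + (y i)\<^sup>2))"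
      proof (rule homogeneous_vandermonde)
        \<comment> \<open>A power series with constant term 1 is a unit.\<close>
        show "(1 + (y i)\<^sup>2) * inverse (1 + (y i)\<^sup>2) = 1" for i
          by (rule inverse_mult_eq_1') (simp add: y0 power2_eq_square)
      qed
      also have "\<dots> = (\<Prod>j<n. \<Prod>i<j. (y i - y j) * (1 - y i * y j))"
        by (intro prod.cong refl) (simp add: algebra_simps power2_eq_square)
      finally show ?thesis unfolding Vd_def vandermonde prod.distrib by simp
    qed
    also have "detf n (\<lambda>i j. y i ^ (n - Suc j) * (1 + (y i)\<^sup>2) ^ j) * (\<Prod>i<n. K oo y i) *
        (\<Prod>i<n. schur_fps p oo y i) =
        detf n (\<lambda>i j. (fps_X ^ (n - Suc j) * (1 + fps_X\<^sup>2) ^ j * K * schur_fps p) oo y i)"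
    proof -
      have "(fps_X ^ (n - Suc j) * (1 + fps_X\<^sup>2) ^ j * K * schur_fps p) oo y i =
          ((K oo y i) * (schur_fps p oo y i)) * (y i ^ (n - Suc j) * (1 + (y i)\<^sup>2) ^ j)" for i j
        by (simp add: fps_compose_mult_distrib[OF y0] cX cX[of 1, simplified] fps_compose_power[OF y0, symmetric]
            fps_compose_add_distrib mult_ac)
      hence "detf n (\<lambda>i j. (fps_X ^ (n - Suc j) * (1 + fps_X\<^sup>2) ^ j * K * schur_fps p) oo y i) =
          (\<Prod>i<n. (K oo y i) * (schur_fps p oo y i)) *
          detf n (\<lambda>i j. y i ^ (n - Suc j) * (1 + (y i)\<^sup>2) ^ j)"
        by (simp only: detf_scale_rows)
      thus ?thesis by (simp only: prod.distrib mult_ac)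
    qed
    also have "fps_nth \<dots> d = (\<Sum>h\<in>natpermute d n. (\<Prod>i<n. x i ^ (h ! i)) * ?R h)"
      unfolding y_def by (rule fps_nth_detf_rescaled)
    finally show "(\<Sum>h\<in>natpermute d n. (exp_op (Omega_op \<sigma>) (schur_det h) p - ?R h) *
        (\<Prod>i<n. x i ^ (h ! i))) = 0"
      by (simp add: algebra_simps sum_subtractf)
  qed (use hd natpermute_finite in \<open>auto simp: natpermute_def\<close>)
  thus ?thesis by simp
qed

text \<open>For \<open>\<sigma> = 1\<close> the symbol has no single-variable factors, so
  \<open>K = 1\<close>; for the orthogonal characters they are \<open>1 - x_i^2\<close>, so
  \<open>K = 1 - fps_X^2\<close>. The factor \<open>1\<close> is kept so that both determinants have
  the same form.\<close>

lemma sp_char_shape: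
  assumes "h \<in> strict_seqs n"
  shows "sp_char (shape h) p =
    detf n (\<lambda>i j. fps_nth (fps_X ^ (n - Suc j) * (1 + fps_X\<^sup>2) ^ j * 1 * schur_fps p) (h ! i))"
  unfolding sp_char_def schur_shape[OF assms]
  by (rule exp_op_schur_det) (use assms in \<open>simp_all add: exp_Omega_symbol strict_seqs_def\<close>)

lemma o_char_shape:
  assumes "h \<in> strict_seqs n"
  shows "o_char (shape h) p =
    detf n (\<lambda>i j. fps_nth (fps_X ^ (n - Suc j) * (1 + fps_X\<^sup>2) ^ j * (1 - fps_X\<^sup>2) * schur_fps p) (h ! i))"
  unfolding o_char_def schur_shape[OF assms]
proof (rule exp_op_schur_det)
  fix x :: "nat \<Rightarrow> complex" and n :: nat
  have "(1 - fps_X\<^sup>2) oo (fps_const c * fps_X) = 1 - fps_const (c\<^sup>2) * (fps_X\<^sup>2 :: complex fps)" for c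
  proof -
    have "(fps_X\<^sup>2 :: complex fps) oo (fps_const c * fps_X) = (fps_const c * fps_X)\<^sup>2"
      by (subst fps_compose_power[symmetric]) (simp_all add: fps_X_fps_compose_startby0)
    thus ?thesis by (simp add: fps_compose_sub_distrib power_mult_distrib)
  qed
  thus "fps_exp 1 oo Omega_symbol (- 1) (\<lambda>m. \<Sum>i<n. x i ^ m) =
      (\<Prod>j<n. \<Prod>i<j. 1 - fps_const (x i * x j) * fps_X\<^sup>2) *
      (\<Prod>i<n. (1 - fps_X\<^sup>2) oo (fps_const (x i) * fps_X))"
    by (simp only: exp_Omega_symbol)
qed (use assms in \<open>simp add: strict_seqs_def\<close>)

section \<open>Expansions of the ensemble integral\<close>

lemma measurable_power_int [measurable (raw)]:
  fixes f :: "'a \<Rightarrow> complex"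
  assumes [measurable]: "f \<in> borel_measurable M"
  shows "(\<lambda>x. f x powi k) \<in> borel_measurable M"
  unfolding power_int_def by measurable

lemma measurable_pot [measurable (raw)]:
  assumes [measurable]: "f \<in> borel_measurable M"
  shows "(\<lambda>x. pot (f x) p) \<in> borel_measurable M"
  unfolding pot_def by measurable

lemma measurable_abs_pot [measurable (raw)]:
  assumes [measurable]: "f \<in> borel_measurable M"
  shows "(\<lambda>x. abs_pot (f x) p) \<in> borel_measurable M"
  unfolding abs_pot_def by measurable

lemma measurable_zmap [measurable]: "zmap \<in> borel_measurable borel"
  unfolding zmap_def by measurable

lemma fps_abs_eval_X: "fps_abs_eval fps_X z z (norm z)"
  using fps_abs_eval_finite[of 2 fps_X z] by (simp add: numeral_2_eq_2 fps_X_def)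

lemma fps_abs_eval_quadratic:
  "fps_abs_eval (1 + fps_X\<^sup>2) z (1 + z\<^sup>2) (1 + (norm z)\<^sup>2)"
  "fps_abs_eval (1 - fps_X\<^sup>2) z (1 - z\<^sup>2) (1 + (norm z)\<^sup>2)"
  using fps_abs_eval_finite[of 3 "1 + fps_X\<^sup>2" z] fps_abs_eval_finite[of 3 "1 - fps_X\<^sup>2" z]
  by (simp_all add: eval_nat_numeral fps_X_power_iff del: power_Suc)

lemma pot_add:
  assumes "pot_abs_conv (norm z) p" "pot_abs_conv (norm z) q"
  shows "pot z (\<lambda>m. p m + q m) = pot z p + pot z q"
    and "pot_abs_conv (norm z) (\<lambda>m. p m + q m)"
    and "abs_pot (norm z) (\<lambda>m. p m + q m) \<le> abs_pot (norm z) p + abs_pot (norm z) q"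
proof -
  let ?t = "\<lambda>p m. z ^ Suc m * p (Suc m) / of_nat (Suc m)"
  let ?a = "\<lambda>p m. norm z ^ Suc m * norm (p (Suc m)) / real (Suc m)"
  have nrm: "norm (?t p m) = ?a p m" for p m
    by (simp add: norm_mult norm_divide norm_power del: of_nat_Suc)
  have s: "summable (?a p)" "summable (?a q)" using assms by (auto simp: pot_abs_conv_def)
  have le: "?a (\<lambda>m. p m + q m) m \<le> ?a p m + ?a q m" for m
    unfolding add_divide_distrib[symmetric] distrib_left[symmetric]
    by (intro divide_right_mono mult_left_mono norm_triangle_ineq) auto
  have sum: "summable (?a (\<lambda>m. p m + q m))"
    by (rule summable_comparison_test'[OF summable_add[OF s]]) (use le in \<open>auto simp: abs_mult\<close>)
  thus "pot_abs_conv (norm z) (\<lambda>m. p m + q m)" by (simp add: pot_abs_conv_def)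
  have "abs_pot (norm z) (\<lambda>m. p m + q m) \<le> (\<Sum>m. ?a p m + ?a q m)"
    unfolding abs_pot_def by (rule suminf_le[OF le sum summable_add[OF s]])
  also have "\<dots> = abs_pot (norm z) p + abs_pot (norm z) q"
    by (simp only: suminf_add[OF s] abs_pot_def)
  finally show "abs_pot (norm z) (\<lambda>m. p m + q m) \<le> abs_pot (norm z) p + abs_pot (norm z) q" .
  have "summable (?t p)" "summable (?t q)"
    by (rule summable_norm_cancel, simp only: nrm s)+
  from suminf_add[OF this] show "pot z (\<lambda>m. p m + q m) = pot z p + pot z q"
    by (simp add: pot_def distrib_left add_divide_distrib)
qed

lemma pot_abs_conv_uminus [simp]: "pot_abs_conv r (\<lambda>m. - p m) = pot_abs_conv r p"
  and abs_pot_uminus [simp]: "abs_pot r (\<lambda>m. - p m) = abs_pot r p"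
  by (simp_all add: pot_abs_conv_def abs_pot_def)

text \<open>The squared product supplies the two determinants for \<open>andreief\<close>; the
  exponentials are absorbed into the rows of the second.\<close>

lemma ensemble_integral_eq_detf:
  assumes "sigma_finite_measure M"
    and int: "\<And>i j. i < n \<Longrightarrow> j < n \<Longrightarrow>
      integrable M (\<lambda>z. z ^ i * (z ^ j * exp (pot z T)) * (z powi N * \<rho> z))"
  shows "ensemble_integral M \<rho> N n T =
    fact n * detf n (\<lambda>i j. LINT z|M. z ^ i * (z ^ j * exp (pot z T)) * (z powi N * \<rho> z))"
proof -
  let ?G = "\<lambda>i j. LINT z|M. z ^ i * (z ^ j * exp (pot z T)) * (z powi N * \<rho> z)"
  have "(\<Prod>j<n. \<Prod>i<j. z i - z j)\<^sup>2 * (\<Prod>i<n. z i powi N * exp (pot (z i) T) * \<rho> (z i)) =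
      detf n (\<lambda>i j. z i ^ (n - Suc j)) * detf n (\<lambda>i j. z i ^ (n - Suc j) * exp (pot (z i) T)) *
      (\<Prod>i<n. z i powi N * \<rho> (z i))" for z
  proof -
    have "detf n (\<lambda>i j. z i ^ (n - Suc j) * exp (pot (z i) T)) =
        (\<Prod>i<n. exp (pot (z i) T)) * detf n (\<lambda>i j. z i ^ (n - Suc j))"
      by (simp only: detf_scale_rows[symmetric] mult.commute)
    thus ?thesis by (simp only: vandermonde prod.distrib power2_eq_square mult_ac)
  qed
  hence "ensemble_integral M \<rho> N n T = (LINT z|PiM {..<n} (\<lambda>_. M).
      detf n (\<lambda>i j. z i ^ (n - Suc j)) * detf n (\<lambda>i j. z i ^ (n - Suc j) * exp (pot (z i) T)) *
      (\<Prod>i<n. z i powi N * \<rho> (z i)))"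
    by (simp only: ensemble_integral_def)
  also have "\<dots> = fact n * detf n (\<lambda>i j. ?G (n - Suc i) (n - Suc j))"
    by (rule andreief[OF assms(1)]) (rule int; simp)
  also have "detf n (\<lambda>i j. ?G (n - Suc i) (n - Suc j)) = detf n ?G" by (rule detf_reverse)
  finally show ?thesis .
qed

section \<open>Schur function expansions in the variable \<open>z\<close>\<close>

context
  fixes M :: "complex measure" and \<rho> :: "complex \<Rightarrow> complex" and N :: int
    and p1 p2 :: "nat \<Rightarrow> complex"
  assumes sets_M [measurable_cong]: "sets M = sets borel"
    and rho [measurable]: "\<rho> \<in> borel_measurable borel"
    and N: "N \<ge> 0 \<or> (AE z in M. z \<noteq> 0)"
    and conv: "converges_z M \<rho> N p1 p2"
begin

lemma mom00_eq: "(LINT z|M. z ^ i * z ^ j * (z powi N * \<rho> z)) = mom00 M \<rho> N i j"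
  unfolding mom00_def
proof (rule integral_cong_AE)
  \<comment> \<open>At \<open>z = 0\<close> the exponent law can fail for negative \<open>N\<close>:
    \<open>0 powi 0 = 1\<close>, while the separate factors may be zero.\<close>
  have "z powi (int i + int j + N) = z ^ i * z ^ j * z powi N" if "z \<noteq> 0 \<or> N \<ge> 0" for z :: complex
  proof (cases "N \<ge> 0")
    case True
    hence "int i + int j + N = int (i + j + nat N)" "N = int (nat N)" by simp_all
    thus ?thesis by (metis power_add power_int_of_nat)
  next
    case False
    thus ?thesis using that by (simp add: power_int_add)
  qed
  thus "AE z in M. z ^ i * z ^ j * (z powi N * \<rho> z) = z powi (int i + int j + N) * \<rho> z"
    using N by (auto simp: mult.assoc)
qed measurable

text \<open>Only the product of \<open>b1\<close> and \<open>b2\<close> is prescribed, so the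
  exponential majorant may sit entirely in one column or be shared by both.\<close>

lemma z_moment_series:
  assumes F: "AE z in M. fps_abs_eval F z (\<phi> z) (norm z ^ a * b1 z)"
    and G: "AE z in M. fps_abs_eval G z (\<psi> z) (norm z ^ c * b2 z)"
    and b: "AE z in M. b1 z * b2 z = exp (abs_pot (norm z) p1 + abs_pot (norm z) p2)"
    and [measurable]: "\<phi> \<in> borel_measurable borel" "\<psi> \<in> borel_measurable borel"
      "b1 \<in> borel_measurable borel" "b2 \<in> borel_measurable borel"
  shows "((\<lambda>(i, j). fps_nth F i * mom00 M \<rho> N i j * fps_nth G j) has_sum
      (LINT z|M. \<phi> z * \<psi> z * (z powi N * \<rho> z))) UNIV"
    and "(\<lambda>(i, j). norm (fps_nth F i * mom00 M \<rho> N i j * fps_nth G j)) summable_on UNIV"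
    and "integrable M (\<lambda>z. \<phi> z * \<psi> z * (z powi N * \<rho> z))"
proof -
  have "integrable M (\<lambda>z. norm z ^ (a + c) * norm (z powi N) * norm (\<rho> z) *
      exp (abs_pot (norm z) p1 + abs_pot (norm z) p2))"
    using conv by (simp add: converges_z_def)
  hence int: "integrable M (\<lambda>z. (norm z ^ a * b1 z) * (norm z ^ c * b2 z) * norm (z powi N * \<rho> z))"
    by (rule integrable_cong_AE_imp) (use b in \<open>auto simp: power_add norm_mult mult_ac\<close>)
  have meas: "(\<lambda>z. \<phi> z * \<psi> z * (z powi N * \<rho> z)) \<in> borel_measurable M"
    "(\<lambda>z. z) \<in> borel_measurable M" "(\<lambda>z. z powi N * \<rho> z) \<in> borel_measurable M" by measurable
  note series = moment_double_series[OF meas(2) meas(2) meas(3) meas(1) F G int]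
  show "((\<lambda>(i, j). fps_nth F i * mom00 M \<rho> N i j * fps_nth G j) has_sum
      (LINT z|M. \<phi> z * \<psi> z * (z powi N * \<rho> z))) UNIV"
    "(\<lambda>(i, j). norm (fps_nth F i * mom00 M \<rho> N i j * fps_nth G j)) summable_on UNIV"
    "integrable M (\<lambda>z. \<phi> z * \<psi> z * (z powi N * \<rho> z))"
    using series by (simp_all only: mom00_eq)
qed

lemma conv_AE: "AE z in M. pot_abs_conv (norm z) p1" "AE z in M. pot_abs_conv (norm z) p2"
  using conv by (auto simp: converges_z_def)

lemma T_AE:
  "AE z in M. exp (pot z (\<lambda>m. p1 m - p2 m)) = exp (pot z p1) * exp (pot z (\<lambda>m. - p2 m))"
  "AE z in M. pot_abs_conv (norm z) (\<lambda>m. p1 m - p2 m) \<and>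
    abs_pot (norm z) (\<lambda>m. p1 m - p2 m) \<le> abs_pot (norm z) p1 + abs_pot (norm z) p2"
proof -
  have "AE z in M. exp (pot z (\<lambda>m. p1 m - p2 m)) = exp (pot z p1) * exp (pot z (\<lambda>m. - p2 m)) \<and>
      pot_abs_conv (norm z) (\<lambda>m. p1 m - p2 m) \<and>
      abs_pot (norm z) (\<lambda>m. p1 m - p2 m) \<le> abs_pot (norm z) p1 + abs_pot (norm z) p2"
    using conv_AE
  proof eventually_elim
    case (elim z)
    from pot_add[of z p1 "\<lambda>m. - p2 m"] elim show ?case by (simp add: exp_add[symmetric])
  qed
  thus "AE z in M. exp (pot z (\<lambda>m. p1 m - p2 m)) = exp (pot z p1) * exp (pot z (\<lambda>m. - p2 m))"
    "AE z in M. pot_abs_conv (norm z) (\<lambda>m. p1 m - p2 m) \<and>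
    abs_pot (norm z) (\<lambda>m. p1 m - p2 m) \<le> abs_pot (norm z) p1 + abs_pot (norm z) p2" by auto
qed

text \<open>With \<open>fps_X ^ k\<close> as left factor only row \<open>k\<close> of the moment
  matrix survives, and the double series collapses to a single one.\<close>

lemma one_sided_series:
  "((\<lambda>b. mom00 M \<rho> N k b * fps_nth (fps_X ^ c * schur_fps (\<lambda>m. p1 m - p2 m)) b) has_sum
     (LINT z|M. z ^ k * (z ^ c * exp (pot z (\<lambda>m. p1 m - p2 m))) * (z powi N * \<rho> z))) UNIV"
  "(\<lambda>b. norm (mom00 M \<rho> N k b * fps_nth (fps_X ^ c * schur_fps (\<lambda>m. p1 m - p2 m)) b)) summable_on UNIV"
  "integrable M (\<lambda>z. z ^ k * (z ^ c * exp (pot z (\<lambda>m. p1 m - p2 m))) * (z powi N * \<rho> z))"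
proof -
  let ?G = "fps_X ^ c * schur_fps (\<lambda>m. p1 m - p2 m)"
  have F: "AE z in M. fps_abs_eval (fps_X ^ k) z (z ^ k) (norm z ^ k * 1)"
    by (simp add: fps_abs_eval_power fps_abs_eval_X)
  have G: "AE z in M. fps_abs_eval ?G z (z ^ c * exp (pot z (\<lambda>m. p1 m - p2 m)))
      (norm z ^ c * exp (abs_pot (norm z) p1 + abs_pot (norm z) p2))"
    using T_AE(2)
    by eventually_elim (auto intro!: fps_abs_eval_mult fps_abs_eval_power fps_abs_eval_X
        intro: fps_abs_eval_mono[OF fps_abs_eval_schur])
  note series = z_moment_series[OF F G]
  have 1: "((\<lambda>(i, j). fps_nth (fps_X ^ k) i * mom00 M \<rho> N i j * fps_nth ?G j) has_sum
      (LINT z|M. z ^ k * (z ^ c * exp (pot z (\<lambda>m. p1 m - p2 m))) * (z powi N * \<rho> z))) UNIV"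
    by (rule series(1)) measurable
  have 2: "(\<lambda>(i, j). norm (fps_nth (fps_X ^ k) i * mom00 M \<rho> N i j * fps_nth ?G j)) summable_on UNIV"
    by (rule series(2)) measurable
  show "integrable M (\<lambda>z. z ^ k * (z ^ c * exp (pot z (\<lambda>m. p1 m - p2 m))) * (z powi N * \<rho> z))"
    by (rule series(3)) measurable
  have bij: "bij_betw (Pair k) UNIV ({k} \<times> (UNIV :: nat set))"
    by (auto simp: bij_betw_def inj_on_def)
  have "((\<lambda>(i, j). fps_nth (fps_X ^ k) i * mom00 M \<rho> N i j * fps_nth ?G j) has_sum
      (LINT z|M. z ^ k * (z ^ c * exp (pot z (\<lambda>m. p1 m - p2 m))) * (z powi N * \<rho> z))) ({k} \<times> UNIV)"
    using 1 by (rule has_sum_cong_neutral[THEN iffD1, rotated -1]) (auto simp: fps_X_power_iff split: if_splits)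
  from this[folded has_sum_reindex_bij_betw[OF bij]]
  show "((\<lambda>b. mom00 M \<rho> N k b * fps_nth ?G b) has_sum
     (LINT z|M. z ^ k * (z ^ c * exp (pot z (\<lambda>m. p1 m - p2 m))) * (z powi N * \<rho> z))) UNIV"
    by (simp add: fps_X_power_iff)
  show "(\<lambda>b. norm (mom00 M \<rho> N k b * fps_nth ?G b)) summable_on UNIV"
    using summable_on_SigmaD1[of "\<lambda>i j. norm (fps_nth (fps_X ^ k) i * mom00 M \<rho> N i j * fps_nth ?G j)"
      UNIV "\<lambda>_. UNIV" k] 2 by (simp add: fps_X_power_iff)
qed

text \<open>The exponential of the potential of \<open>T\<close> splits into those of
  \<open>p1\<close> and \<open>- p2\<close>, one for each column.\<close>

lemma two_sided_series:
  "((\<lambda>(i, j). fps_nth (fps_X ^ a * schur_fps p1) i * mom00 M \<rho> N i j *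
      fps_nth (fps_X ^ c * schur_fps (\<lambda>m. - p2 m)) j) has_sum
     (LINT z|M. z ^ a * (z ^ c * exp (pot z (\<lambda>m. p1 m - p2 m))) * (z powi N * \<rho> z))) UNIV"
  "(\<lambda>(i, j). norm (fps_nth (fps_X ^ a * schur_fps p1) i * mom00 M \<rho> N i j *
      fps_nth (fps_X ^ c * schur_fps (\<lambda>m. - p2 m)) j)) summable_on UNIV"
proof -
  have F: "AE z in M. fps_abs_eval (fps_X ^ a * schur_fps p1) z (z ^ a * exp (pot z p1))
      (norm z ^ a * exp (abs_pot (norm z) p1))"
    using conv_AE(1)
    by eventually_elim (intro fps_abs_eval_mult fps_abs_eval_power fps_abs_eval_X fps_abs_eval_schur)
  have G: "AE z in M. fps_abs_eval (fps_X ^ c * schur_fps (\<lambda>m. - p2 m)) z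
      (z ^ c * exp (pot z (\<lambda>m. - p2 m))) (norm z ^ c * exp (abs_pot (norm z) p2))"
    using conv_AE(2)
  proof eventually_elim
    case (elim z)
    thus ?case
      using fps_abs_eval_mult[OF fps_abs_eval_power[OF fps_abs_eval_X] fps_abs_eval_schur[of z "\<lambda>m. - p2 m"]]
      by simp
  qed
  note series = z_moment_series[OF F G]
  have 1: "((\<lambda>(i, j). fps_nth (fps_X ^ a * schur_fps p1) i * mom00 M \<rho> N i j *
      fps_nth (fps_X ^ c * schur_fps (\<lambda>m. - p2 m)) j) has_sum
     (LINT z|M. (z ^ a * exp (pot z p1)) * (z ^ c * exp (pot z (\<lambda>m. - p2 m))) * (z powi N * \<rho> z))) UNIV"
    by (rule series(1)) (auto simp: exp_add)
  also have "(LINT z|M. (z ^ a * exp (pot z p1)) * (z ^ c * exp (pot z (\<lambda>m. - p2 m))) * (z powi N * \<rho> z)) =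
      (LINT z|M. z ^ a * (z ^ c * exp (pot z (\<lambda>m. p1 m - p2 m))) * (z powi N * \<rho> z))"
    by (rule integral_cong_AE, measurable) (use T_AE(1) in \<open>auto simp: mult_ac\<close>)
  finally show "((\<lambda>(i, j). fps_nth (fps_X ^ a * schur_fps p1) i * mom00 M \<rho> N i j *
      fps_nth (fps_X ^ c * schur_fps (\<lambda>m. - p2 m)) j) has_sum
     (LINT z|M. z ^ a * (z ^ c * exp (pot z (\<lambda>m. p1 m - p2 m))) * (z powi N * \<rho> z))) UNIV" .
  show "(\<lambda>(i, j). norm (fps_nth (fps_X ^ a * schur_fps p1) i * mom00 M \<rho> N i j *
      fps_nth (fps_X ^ c * schur_fps (\<lambda>m. - p2 m)) j)) summable_on UNIV"
    by (rule series(2)) (auto simp: exp_add)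
qed

lemma ensemble_integral_eq_schur_sums:
  fixes n :: nat
  assumes "sigma_finite_measure M"
  shows "((\<lambda>h. schur (shape h) (\<lambda>m. p1 m - p2 m) * pi1 (mom00 M \<rho> N) n h)
      has_sum ensemble_integral M \<rho> N n (\<lambda>m. p1 m - p2 m)) (strict_seqs n)"
    and "((\<lambda>(h, h'). schur (shape h) p1 * pi2 (mom00 M \<rho> N) n h h' * schur (shape h') (\<lambda>m. - p2 m))
      has_sum ensemble_integral M \<rho> N n (\<lambda>m. p1 m - p2 m)) (strict_seqs n \<times> strict_seqs n)"
proof -
  let ?T = "\<lambda>m. p1 m - p2 m" and ?m = "mom00 M \<rho> N"
  let ?G = "\<lambda>i j. LINT z|M. z ^ i * (z ^ j * exp (pot z ?T)) * (z powi N * \<rho> z)"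
  \<comment> \<open>The decreasing exponents are restored because both \<open>pi1\<close> and
    \<open>schur_det\<close> are written with \<open>n - Suc i\<close>.\<close>
  have val: "ensemble_integral M \<rho> N n ?T = fact n * detf n (\<lambda>i j. ?G (n - Suc i) (n - Suc j))"
    unfolding ensemble_integral_eq_detf[OF assms one_sided_series(3)]
    using detf_reverse[of n ?G] by simp
  have tr: "detf n (\<lambda>i k. fps_nth (fps_X ^ (n - Suc i) * schur_fps q) (h ! k)) = schur (shape h) q"
    if "h \<in> strict_seqs n" for h q
    using that detf_transpose[of n "\<lambda>k i. fps_nth (fps_X ^ (n - Suc i) * schur_fps q) (h ! k)"]
    by (simp add: schur_shape[OF that] schur_det_def strict_seqs_def)
  have tr': "detf n (\<lambda>k i. fps_nth (fps_X ^ (n - Suc i) * schur_fps q) (h ! k)) = schur (shape h) q"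
    if "h \<in> strict_seqs n" for h q
    using that by (simp add: schur_shape[OF that] schur_det_def strict_seqs_def)
  let ?B = "\<lambda>q b j. fps_nth (fps_X ^ (n - Suc j) * schur_fps q) b"
  have "((\<lambda>h. detf n (\<lambda>i k. ?m (n - Suc i) (h ! k)) * detf n (\<lambda>k j. ?B ?T (h ! k) j)) has_sum
      detf n (\<lambda>i j. \<Sum>\<^sub>\<infinity>b. ?m (n - Suc i) b * ?B ?T b j)) (strict_seqs n)"
    by (rule infinite_cauchy_binet) (rule one_sided_series(2))
  also have "detf n (\<lambda>i j. \<Sum>\<^sub>\<infinity>b. ?m (n - Suc i) b * ?B ?T b j) =
      detf n (\<lambda>i j. ?G (n - Suc i) (n - Suc j))"
    by (rule detf_cong) (rule infsumI[OF one_sided_series(1)])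
  finally have "((\<lambda>h. fact n * (detf n (\<lambda>i k. ?m (n - Suc i) (h ! k)) * detf n (\<lambda>k j. ?B ?T (h ! k) j)))
      has_sum ensemble_integral M \<rho> N n ?T) (strict_seqs n)"
    unfolding val by (rule has_sum_cmult_right)
  thus "((\<lambda>h. schur (shape h) ?T * pi1 ?m n h) has_sum ensemble_integral M \<rho> N n ?T) (strict_seqs n)"
    by (rule has_sum_cong[THEN iffD1, rotated]) (simp add: tr' pi1_def mult_ac)
  have "((\<lambda>(h, h'). detf n (\<lambda>i k. ?B p1 (h ! k) i) * detf n (\<lambda>k l. ?m (h ! k) (h' ! l)) *
      detf n (\<lambda>l j. ?B (\<lambda>m. - p2 m) (h' ! l) j)) has_sum detf n (\<lambda>i j. ?G (n - Suc i) (n - Suc j)))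
      (strict_seqs n \<times> strict_seqs n)"
    by (rule infinite_cauchy_binet_bilinear) (rule two_sided_series)+
  hence "((\<lambda>x. fact n * (case x of (h, h') \<Rightarrow> detf n (\<lambda>i k. ?B p1 (h ! k) i) *
      detf n (\<lambda>k l. ?m (h ! k) (h' ! l)) * detf n (\<lambda>l j. ?B (\<lambda>m. - p2 m) (h' ! l) j))) has_sum
      ensemble_integral M \<rho> N n ?T) (strict_seqs n \<times> strict_seqs n)"
    unfolding val by (rule has_sum_cmult_right)
  thus "((\<lambda>(h, h'). schur (shape h) p1 * pi2 ?m n h h' * schur (shape h') (\<lambda>m. - p2 m))
      has_sum ensemble_integral M \<rho> N n ?T) (strict_seqs n \<times> strict_seqs n)"
    by (rule has_sum_cong[THEN iffD1, rotated]) (clarify, simp only: prod.case tr tr' pi2_def, simp only: mult_ac)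
qed

end

section \<open>Character expansions in the variable \<open>x\<close>\<close>

text \<open>The majorant \<open>1 + (norm z)^2\<close> serves both choices of \<open>K\<close>,
  namely \<open>1\<close> and \<open>1 - fps_X^2\<close>; as one more factor of the same kind it
  gives \<open>Suc b\<close>.\<close>

lemma fps_abs_eval_char_column:
  assumes "fps_abs_eval K z k (1 + (norm z)\<^sup>2)" "pot_abs_conv (norm z) p"
  shows "fps_abs_eval (fps_X ^ a * (1 + fps_X\<^sup>2) ^ b * K * schur_fps p) z
    (z ^ a * (1 + z\<^sup>2) ^ b * k * exp (pot z p))
    (norm z ^ a * (1 + (norm z)\<^sup>2) ^ Suc b * exp (abs_pot (norm z) p))"
proof -
  have "fps_abs_eval (fps_X ^ a * (1 + fps_X\<^sup>2) ^ b * K * schur_fps p) z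
    (z ^ a * (1 + z\<^sup>2) ^ b * k * exp (pot z p))
    (norm z ^ a * (1 + (norm z)\<^sup>2) ^ b * (1 + (norm z)\<^sup>2) * exp (abs_pot (norm z) p))"
    by (intro fps_abs_eval_mult fps_abs_eval_power fps_abs_eval_X fps_abs_eval_quadratic
        fps_abs_eval_schur assms)
  thus ?thesis by (simp add: mult_ac)
qed

text \<open>Since \<open>1 + s^2 = s (s + 1/s)\<close> is at most \<open>(s + 1/s)^2\<close>, and
  \<open>s + 1/s\<close> is invariant under inversion, both columns are bounded by powers of the
  weight in \<open>converges_x\<close>.\<close>

lemma char_column_bound:
  fixes r :: real
  assumes "0 < r"
  shows "r ^ a * (1 + r\<^sup>2) ^ b \<le> (r + 1 / r) ^ (a + 2 * b)"
    and "(1 / r) ^ a * (1 + (1 / r)\<^sup>2) ^ b \<le> (r + 1 / r) ^ (a + 2 * b)"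
proof -
  have *: "s ^ a * (1 + s\<^sup>2) ^ b \<le> (s + 1 / s) ^ (a + 2 * b)" if "0 < s" for s :: real
  proof -
    have "1 + s\<^sup>2 = s * (s + 1 / s)" using that by (simp add: field_simps power2_eq_square)
    also have "\<dots> \<le> (s + 1 / s)\<^sup>2"
      unfolding power2_eq_square using that by (intro mult_right_mono) auto
    finally have "(1 + s\<^sup>2) ^ b \<le> ((s + 1 / s)\<^sup>2) ^ b" by (intro power_mono) auto
    hence "s ^ a * (1 + s\<^sup>2) ^ b \<le> (s + 1 / s) ^ a * ((s + 1 / s)\<^sup>2) ^ b"
      using that by (intro mult_mono[OF power_mono]) auto
    thus ?thesis by (simp add: power_add power_mult)
  qed
  show "r ^ a * (1 + r\<^sup>2) ^ b \<le> (r + 1 / r) ^ (a + 2 * b)" by (rule *[OF assms])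
  show "(1 / r) ^ a * (1 + (1 / r)\<^sup>2) ^ b \<le> (r + 1 / r) ^ (a + 2 * b)"
    using *[of "1 / r"] assms by (simp add: add.commute)
qed

lemma power_times_char_poly:
  assumes "x \<noteq> 0" "i < n"
  shows "x ^ (n - Suc i) * (1 + x\<^sup>2) ^ i = x ^ (n - 1) * zmap x ^ i"
proof -
  have "1 + x\<^sup>2 = x * zmap x" using assms by (simp add: zmap_def field_simps power2_eq_square)
  moreover have "x ^ (n - 1) = x ^ (n - Suc i) * x ^ i" using assms by (simp add: power_add[symmetric])
  ultimately show ?thesis by (simp add: power_mult_distrib)
qed

lemma zmap_inverse: "zmap (1 / x) = zmap x"
  by (simp add: zmap_def)

text \<open>In the variable \<open>x\<close> the two columns pair off: \<open>x\<^bsup>n-1\<^esup> z\<^sup>i\<close> from \<open>x\<close> and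
  \<open>x\<^bsup>1-n\<^esup> z\<^sup>j\<close> from \<open>1 / x\<close> multiply to \<open>z\<^bsup>i+j\<^esup>\<close>, an entry of the Hankel
  matrix of the ensemble.\<close>
lemma ensemble_integral_eq_char_sum:
  fixes L M :: "complex measure" and \<rho> \<kappa> k1 k2 :: "complex \<Rightarrow> complex" and N :: int and n :: nat
    and T p :: "nat \<Rightarrow> complex" and K1 K2 :: "complex fps"
  assumes "sigma_finite_measure M"
    and rho [measurable]: "\<rho> \<in> borel_measurable borel"
    and sets_L [measurable_cong]: "sets L = sets borel"
    and x0: "AE x in L. x \<noteq> 0" and M: "distr L borel zmap = M"
    and rel: "linearly_related T p" and conv: "converges_x \<kappa> L \<rho> N T p"
    and kappa [measurable]: "\<kappa> \<in> borel_measurable borel"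
    and K1: "\<And>x. fps_abs_eval K1 x (k1 x) (1 + (norm x)\<^sup>2)"
    and K2: "\<And>x. fps_abs_eval K2 x (k2 x) (1 + (norm x)\<^sup>2)"
    and k [measurable]: "k1 \<in> borel_measurable borel" "k2 \<in> borel_measurable borel"
    and kk: "AE x in L. k1 x * k2 (1 / x) * \<kappa> x = 1"
  defines "D \<equiv> \<lambda>K h. detf n (\<lambda>i j. fps_nth (fps_X ^ (n - Suc j) * (1 + fps_X\<^sup>2) ^ j * K * schur_fps p) (h ! i))"
  shows "((\<lambda>(h, h'). exp (of_nat n / 2 * c_const T) * D K1 h * pi2 (mom_x \<kappa> L \<rho> N) n h h' * D K2 h' *
      exp (of_nat n / 2 * c_const T)) has_sum ensemble_integral M \<rho> N n T) (strict_seqs n \<times> strict_seqs n)"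
proof -
  let ?c = "c_const T"
  let ?F = "\<lambda>K j. fps_X ^ (n - Suc j) * (1 + fps_X\<^sup>2) ^ j * K * schur_fps p"
  let ?w = "\<lambda>x. zmap x powi N * \<kappa> x * \<rho> (zmap x)"
  let ?\<phi> = "\<lambda>i x. x ^ (n - Suc i) * (1 + x\<^sup>2) ^ i * k1 x * exp (pot x p)"
  let ?\<psi> = "\<lambda>j x. (1 / x) ^ (n - Suc j) * (1 + (1 / x)\<^sup>2) ^ j * k2 (1 / x) * exp (pot (1 / x) p)"
  let ?b = "\<lambda>i r. r ^ (n - Suc i) * (1 + r\<^sup>2) ^ Suc i * exp (abs_pot r p)"
  let ?g = "\<lambda>i j z. z ^ i * (z ^ j * exp (pot z T)) * (z powi N * \<rho> z)"
  have convp: "AE x in L. pot_abs_conv (norm x) p" "AE x in L. pot_abs_conv (norm (1 / x)) p"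
    "AE x in L. pot_abs_conv (norm (zmap x)) T"
    using conv by (auto simp: converges_x_def)
  have F1: "AE x in L. fps_abs_eval (?F K1 i) x (?\<phi> i x) (?b i (norm x))" for i
    using convp(1) by eventually_elim (rule fps_abs_eval_char_column[OF K1])
  have F2: "AE x in L. fps_abs_eval (?F K2 j) (1 / x) (?\<psi> j x) (?b j (norm (1 / x)))" for j
    using convp(2) by eventually_elim (rule fps_abs_eval_char_column[OF K2])
  have meas: "(\<lambda>x. x) \<in> borel_measurable L" "(\<lambda>x. 1 / x) \<in> borel_measurable L"
    "?w \<in> borel_measurable L" "(\<lambda>x. ?\<phi> i x * ?\<psi> j x * ?w x) \<in> borel_measurable L" for i j
    by measurable
  have int: "integrable L (\<lambda>x. ?b i (norm x) * ?b j (norm (1 / x)) * norm (?w x))" for i j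
  proof (rule Bochner_Integration.integrable_bound)
    \<comment> \<open>The exponents \<open>a + 2 * b\<close> of \<open>char_column_bound\<close> for
      the two columns, with \<open>b = Suc i\<close> and \<open>b = Suc j\<close>.\<close>
    let ?k = "(n - Suc i + 2 * Suc i) + (n - Suc j + 2 * Suc j)"
    let ?d = "\<lambda>x. (cmod x + cmod (1 / x)) ^ ?k * cmod (zmap x powi N) * cmod (\<kappa> x) * cmod (\<rho> (zmap x)) *
        exp (abs_pot (cmod x) p + abs_pot (cmod (1 / x)) p)"
    show "integrable L ?d" using conv by (simp only: converges_x_def)
    show "(\<lambda>x. ?b i (norm x) * ?b j (norm (1 / x)) * norm (?w x)) \<in> borel_measurable L" by measurable
    show "AE x in L. norm (?b i (norm x) * ?b j (norm (1 / x)) * norm (?w x)) \<le> norm (?d x)"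
      using x0
    proof eventually_elim
      case (elim x)
      let ?r = "norm x" and ?s = "1 / norm x"
      have r: "0 < ?r" using elim by simp
      have "(?r ^ (n - Suc i) * (1 + ?r\<^sup>2) ^ Suc i) * (?s ^ (n - Suc j) * (1 + ?s\<^sup>2) ^ Suc j) \<le>
          (?r + ?s) ^ (n - Suc i + 2 * Suc i) * (?r + ?s) ^ (n - Suc j + 2 * Suc j)"
        by (intro mult_mono char_column_bound[OF r] mult_nonneg_nonneg zero_le_power) (auto intro: add_nonneg_nonneg)
      also have "\<dots> = (?r + ?s) ^ ?k" by (rule power_add[symmetric])
      finally have "(?r ^ (n - Suc i) * (1 + ?r\<^sup>2) ^ Suc i) * (?s ^ (n - Suc j) * (1 + ?s\<^sup>2) ^ Suc j) *
          (exp (abs_pot ?r p) * exp (abs_pot ?s p) * norm (?w x)) \<le>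
          (?r + ?s) ^ ?k * (exp (abs_pot ?r p) * exp (abs_pot ?s p) * norm (?w x))"
        by (intro mult_right_mono) auto
      moreover have "norm (1 / x) = ?s" by (simp add: norm_divide)
      moreover have "norm (?b i (norm x) * ?b j (norm (1 / x)) * norm (?w x)) =
          ?b i (norm x) * ?b j (norm (1 / x)) * norm (?w x)"
        by (simp only: real_norm_def, rule abs_of_nonneg) (intro mult_nonneg_nonneg; simp)
      moreover have "norm (?d x) = ?d x"
        by (simp only: real_norm_def, rule abs_of_nonneg) (intro mult_nonneg_nonneg; simp)
      ultimately show ?case
        by (simp only: exp_add norm_mult mult_ac)
    qed
  qed
  note series = moment_double_series[OF meas(1-4) F1 F2 int]
  have mom: "(LINT x|L. x ^ i * (1 / x) ^ j * ?w x) = mom_x \<kappa> L \<rho> N i j" for i j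
    unfolding mom_x_def
  proof (rule integral_cong_AE)
    show "AE x in L. x ^ i * (1 / x) ^ j * ?w x =
        x powi (int i - int j) * (x + 1 / x) powi N * \<kappa> x * \<rho> (zmap x)"
      using x0
    proof eventually_elim
      case (elim x)
      hence "x powi (int i - int j) = x ^ i * (1 / x) ^ j"
        by (simp add: power_int_diff power_divide)
      thus ?case by (simp add: zmap_def mult_ac)
    qed
  qed measurable
  \<comment> \<open>\<open>kk\<close> cancels the kernel against the factors \<open>k1\<close> at
    \<open>x\<close> and \<open>k2\<close> at \<open>1 / x\<close>; the linear relation turns the
    two potentials in \<open>p\<close> into that of \<open>T\<close>, at the price of
    \<open>exp (- ?c)\<close>.\<close>
  have entry: "AE x in L. ?\<phi> i x * ?\<psi> j x * ?w x = exp (- ?c) * ?g i j (zmap x)"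
    if ij: "i < n" "j < n" for i j
    using x0 convp kk
  proof eventually_elim
    case (elim x)
    have pot: "pot x p + pot (1 / x) p = pot (zmap x) T - ?c"
      using rel elim by (simp add: linearly_related_def)
    have e: "exp (pot x p) * exp (pot (1 / x) p) = exp (- ?c) * exp (pot (zmap x) T)"
      unfolding exp_add[symmetric] pot by simp
    have "x ^ (n - 1) * (1 / x) ^ (n - 1) = 1" using elim(1) by (simp add: power_divide)
    hence a: "(x ^ (n - Suc i) * (1 + x\<^sup>2) ^ i) * ((1 / x) ^ (n - Suc j) * (1 + (1 / x)\<^sup>2) ^ j) =
        zmap x ^ i * zmap x ^ j"
      using power_times_char_poly[OF elim(1) ij(1)] power_times_char_poly[of "1 / x", OF _ ij(2)] elim(1)
      by (simp only: zmap_inverse) (simp add: field_simps)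
    have "?\<phi> i x * ?\<psi> j x * ?w x =
        ((x ^ (n - Suc i) * (1 + x\<^sup>2) ^ i) * ((1 / x) ^ (n - Suc j) * (1 + (1 / x)\<^sup>2) ^ j)) *
        (exp (pot x p) * exp (pot (1 / x) p)) * (k1 x * k2 (1 / x) * \<kappa> x) * (zmap x powi N * \<rho> (zmap x))"
      by (simp only: mult_ac)
    also have "\<dots> = exp (- ?c) * ?g i j (zmap x)"
      unfolding a e elim(5) by (simp only: mult_ac mult_1_left)
    finally show ?case .
  qed
  have gmeas: "?g i j \<in> borel_measurable borel" for i j by measurable
  have zL: "zmap \<in> measurable L borel" by measurable
  have gint: "integrable M (?g i j)" if "i < n" "j < n" for i j
  proof -
    have "integrable L (\<lambda>x. exp (- ?c) * ?g i j (zmap x))"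
      by (rule integrable_cong_AE_imp[OF series(3)[of i j]]) (use entry[OF that] in auto)
    from integrable_mult_right[OF this, of "exp ?c"]
    have "integrable L (\<lambda>x. (exp ?c * exp (- ?c)) * ?g i j (zmap x))" by (simp only: mult.assoc)
    hence "integrable L (\<lambda>x. ?g i j (zmap x))" by (simp only: exp_minus_inverse mult_1_left)
    thus ?thesis unfolding M[symmetric] by (simp only: integrable_distr_eq[OF zL gmeas])
  qed
  have gval: "(LINT x|L. ?\<phi> i x * ?\<psi> j x * ?w x) = exp (- ?c) * (LINT z|M. ?g i j z)"
    if "i < n" "j < n" for i j
  proof -
    have "(LINT x|L. ?\<phi> i x * ?\<psi> j x * ?w x) = (LINT x|L. exp (- ?c) * ?g i j (zmap x))"
      by (rule integral_cong_AE) (use entry[OF that] in auto)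
    also have "\<dots> = exp (- ?c) * (LINT x|L. ?g i j (zmap x))" by simp
    also have "(LINT x|L. ?g i j (zmap x)) = (LINT z|M. ?g i j z)"
      unfolding M[symmetric] by (rule integral_distr[OF zL gmeas, symmetric])
    finally show ?thesis .
  qed
  \<comment> \<open>Each of the \<open>n\<close> rows carries a factor \<open>exp (- ?c)\<close>;
    \<open>?E * ?E\<close> is the inverse of their product.\<close>
  let ?E = "exp (of_nat n / 2 * ?c)"
  have "((\<lambda>(h, h'). detf n (\<lambda>i k. fps_nth (?F K1 i) (h ! k)) *
      detf n (\<lambda>k l. mom_x \<kappa> L \<rho> N (h ! k) (h' ! l)) * detf n (\<lambda>l j. fps_nth (?F K2 j) (h' ! l))) has_sum
      detf n (\<lambda>i j. LINT x|L. ?\<phi> i x * ?\<psi> j x * ?w x)) (strict_seqs n \<times> strict_seqs n)"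
    by (rule infinite_cauchy_binet_bilinear) (use series in \<open>simp_all only: mom\<close>)
  from has_sum_cmult_right[OF this, of "?E * ?E * fact n"]
  have "((\<lambda>(h, h'). ?E * D K1 h * pi2 (mom_x \<kappa> L \<rho> N) n h h' * D K2 h' * ?E) has_sum
      ?E * ?E * fact n * detf n (\<lambda>i j. LINT x|L. ?\<phi> i x * ?\<psi> j x * ?w x)) (strict_seqs n \<times> strict_seqs n)"
  proof (rule has_sum_cong[THEN iffD1, rotated], clarify)
    fix h h' :: "nat list"
    have "detf n (\<lambda>i k. fps_nth (?F K1 i) (h ! k)) = D K1 h"
      unfolding D_def by (rule detf_transpose)
    moreover have "detf n (\<lambda>l j. fps_nth (?F K2 j) (h' ! l)) = D K2 h'" by (simp only: D_def)
    ultimately show "?E * ?E * fact n * (detf n (\<lambda>i k. fps_nth (?F K1 i) (h ! k)) *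
        detf n (\<lambda>k l. mom_x \<kappa> L \<rho> N (h ! k) (h' ! l)) * detf n (\<lambda>l j. fps_nth (?F K2 j) (h' ! l))) =
        ?E * D K1 h * pi2 (mom_x \<kappa> L \<rho> N) n h h' * D K2 h' * ?E"
      unfolding pi2_def by (simp only: mult_ac)
  qed
  also have "detf n (\<lambda>i j. LINT x|L. ?\<phi> i x * ?\<psi> j x * ?w x) =
      detf n (\<lambda>i j. exp (- ?c) * (LINT z|M. ?g i j z))"
    by (rule detf_cong) (rule gval)
  also have "\<dots> = exp (- ?c) ^ n * detf n (\<lambda>i j. LINT z|M. ?g i j z)"
    by (simp only: detf_scale_rows prod_constant card_lessThan)
  also have "?E * ?E * fact n * (exp (- ?c) ^ n * detf n (\<lambda>i j. LINT z|M. ?g i j z)) =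
      (?E * ?E * exp (- ?c) ^ n) * (fact n * detf n (\<lambda>i j. LINT z|M. ?g i j z))"
    by (simp only: mult_ac)
  also have "?E * ?E * exp (- ?c) ^ n = 1"
    by (simp add: exp_of_nat_mult[symmetric] exp_add[symmetric] field_simps)
  also have "1 * (fact n * detf n (\<lambda>i j. LINT z|M. ?g i j z)) = ensemble_integral M \<rho> N n T"
    using ensemble_integral_eq_detf[OF assms(1) gint] by simp
  finally show ?thesis .
qed

text \<open>The expansions in \<open>x\<close> carry separate convergence hypotheses because their
  kernels have different singularities at \<open>x^2 = 1\<close>.\<close>

theorem proposition8:
  fixes M L :: "complex measure" and \<rho> :: "complex \<Rightarrow> complex"
    and N :: int and n :: nat
    and T p p1 p2 :: "nat \<Rightarrow> complex"
  assumes "sigma_finite_measure M" and "sets M = sets borel"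
    and "\<rho> \<in> borel_measurable borel"
    and "sets L = sets borel" and "AE x in L. x \<noteq> 0" and "distr L borel zmap = M"
    and "N \<ge> 0 \<or> (AE z in M. z \<noteq> 0)"
    and "T = (\<lambda>m. p1 m - p2 m)"
  shows
    "(converges_z M \<rho> N p1 p2 \<longrightarrow>
        ((\<lambda>h. schur (shape h) T * pi1 (mom00 M \<rho> N) n h)
           has_sum ensemble_integral M \<rho> N n T) (strict_seqs n) \<and>
        ((\<lambda>(h, h'). schur (shape h) p1 * pi2 (mom00 M \<rho> N) n h h'
              * schur (shape h') (\<lambda>m. - p2 m))
           has_sum ensemble_integral M \<rho> N n T) (strict_seqs n \<times> strict_seqs n)) \<and>
     (linearly_related T p \<longrightarrow>
        ((AE x in L. x\<^sup>2 \<noteq> 1) \<and> converges_x kappa_mm L \<rho> N T p \<longrightarrow>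
          ((\<lambda>(h, h'). exp (of_nat n / 2 * c_const T) * o_char (shape h) p
                * pi2 (mom_x kappa_mm L \<rho> N) n h h'
                * o_char (shape h') p * exp (of_nat n / 2 * c_const T))
             has_sum ensemble_integral M \<rho> N n T) (strict_seqs n \<times> strict_seqs n)) \<and>
        (converges_x kappa_pp L \<rho> N T p \<longrightarrow>
          ((\<lambda>(h, h'). exp (of_nat n / 2 * c_const T) * sp_char (shape h) p
                * pi2 (mom_x kappa_pp L \<rho> N) n h h'
                * sp_char (shape h') p * exp (of_nat n / 2 * c_const T))
             has_sum ensemble_integral M \<rho> N n T) (strict_seqs n \<times> strict_seqs n)) \<and>
        ((AE x in L. x\<^sup>2 \<noteq> 1) \<and> converges_x kappa_mp L \<rho> N T p \<longrightarrow>
          ((\<lambda>(h, h'). exp (of_nat n / 2 * c_const T) * o_char (shape h) p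
                * pi2 (mom_x kappa_mp L \<rho> N) n h h'
                * sp_char (shape h') p * exp (of_nat n / 2 * c_const T))
             has_sum ensemble_integral M \<rho> N n T) (strict_seqs n \<times> strict_seqs n)))"
proof -
  note M = assms(1,2) and rho = assms(3) and L = assms(4) and x0 = assms(5) and distr = assms(6)
  have kappa: "kappa_mm \<in> borel_measurable borel" "kappa_pp \<in> borel_measurable borel"
    "kappa_mp \<in> borel_measurable borel"
    unfolding kappa_mm_def [abs_def] kappa_pp_def [abs_def] kappa_mp_def [abs_def] by measurable
  have one: "fps_abs_eval 1 x 1 (1 + (norm x)\<^sup>2)" for x
    by (rule fps_abs_eval_mono[OF fps_abs_eval_1]) simp
  have meas: "(\<lambda>x :: complex. 1 - x\<^sup>2) \<in> borel_measurable borel"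
    "(\<lambda>x :: complex. 1 :: complex) \<in> borel_measurable borel" by measurable
  note char_sum = ensemble_integral_eq_char_sum[OF assms(1) rho L x0 distr, where n = n]
  let ?S = "strict_seqs n \<times> strict_seqs n"
  have chars: "o_char (shape h) p = detf n (\<lambda>i j. fps_nth (fps_X ^ (n - Suc j) * (1 + fps_X\<^sup>2) ^ j *
      (1 - fps_X\<^sup>2) * schur_fps p) (h ! i))"
    "sp_char (shape h) p = detf n (\<lambda>i j. fps_nth (fps_X ^ (n - Suc j) * (1 + fps_X\<^sup>2) ^ j *
      1 * schur_fps p) (h ! i))" if "h \<in> strict_seqs n" for h
    using that by (rule o_char_shape sp_char_shape)+
  show ?thesis
  proof (intro conjI impI)
    assume "converges_z M \<rho> N p1 p2"
    note sums = ensemble_integral_eq_schur_sums[OF M(2) rho assms(7) this M(1), of n]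
    show "((\<lambda>h. schur (shape h) T * pi1 (mom00 M \<rho> N) n h)
        has_sum ensemble_integral M \<rho> N n T) (strict_seqs n)"
      unfolding assms(8) by (rule sums(1))
    show "((\<lambda>(h, h'). schur (shape h) p1 * pi2 (mom00 M \<rho> N) n h h' * schur (shape h') (\<lambda>m. - p2 m))
        has_sum ensemble_integral M \<rho> N n T) ?S"
      unfolding assms(8) by (rule sums(2))
  next
    assume rel: "linearly_related T p" and h: "(AE x in L. x\<^sup>2 \<noteq> 1) \<and> converges_x kappa_mm L \<rho> N T p"
    \<comment> \<open>Away from 0 and from \<open>x^2 = 1\<close> both denominators of the kernel
      are nonzero.\<close>
    have kk: "AE x in L. (1 - x\<^sup>2) * (1 - (1 / x)\<^sup>2) * kappa_mm x = 1"
      using h[THEN conjunct1] x0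
      by eventually_elim (auto simp: kappa_mm_def power_divide)
    show "((\<lambda>(h, h'). exp (of_nat n / 2 * c_const T) * o_char (shape h) p
          * pi2 (mom_x kappa_mm L \<rho> N) n h h' * o_char (shape h') p * exp (of_nat n / 2 * c_const T))
        has_sum ensemble_integral M \<rho> N n T) ?S"
      using char_sum[OF rel h[THEN conjunct2] kappa(1) fps_abs_eval_quadratic(2)
          fps_abs_eval_quadratic(2) meas(1) meas(1) kk]
      by (rule has_sum_cong[THEN iffD1, rotated]) (clarify, simp only: chars prod.case)
  next
    assume rel: "linearly_related T p" and h: "converges_x kappa_pp L \<rho> N T p"
    have kk: "AE x in L. 1 * 1 * kappa_pp x = 1" by (simp add: kappa_pp_def)
    show "((\<lambda>(h, h'). exp (of_nat n / 2 * c_const T) * sp_char (shape h) p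
          * pi2 (mom_x kappa_pp L \<rho> N) n h h' * sp_char (shape h') p * exp (of_nat n / 2 * c_const T))
        has_sum ensemble_integral M \<rho> N n T) ?S"
      using char_sum[OF rel h kappa(2) one one meas(2) meas(2) kk]
      by (rule has_sum_cong[THEN iffD1, rotated]) (clarify, simp only: chars prod.case)
  next
    assume rel: "linearly_related T p" and h: "(AE x in L. x\<^sup>2 \<noteq> 1) \<and> converges_x kappa_mp L \<rho> N T p"
    \<comment> \<open>Only the column in \<open>x\<close> carries the orthogonal factor, so the
      kernel has a single factor \<open>1 - x^2\<close> to cancel.\<close>
    have kk: "AE x in L. (1 - x\<^sup>2) * 1 * kappa_mp x = 1"
      using h[THEN conjunct1] by eventually_elim (auto simp: kappa_mp_def)
    show "((\<lambda>(h, h'). exp (of_nat n / 2 * c_const T) * o_char (shape h) p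
          * pi2 (mom_x kappa_mp L \<rho> N) n h h' * sp_char (shape h') p * exp (of_nat n / 2 * c_const T))
        has_sum ensemble_integral M \<rho> N n T) ?S"
      using char_sum[OF rel h[THEN conjunct2] kappa(3) fps_abs_eval_quadratic(2) one meas(1) meas(2) kk]
      by (rule has_sum_cong[THEN iffD1, rotated]) (clarify, simp only: chars prod.case)
  qed
qed

end
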